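(* Let $t\in(0,1)$, $r=\sqrt{1-t^2}$, let $\{\gamma_k\}_{k\in\mathbb Z}$ be an arbitrary real sequence, and let the real sequences $\{\theta_k\}_{k\in\mathbb Z}$, $\{\alpha_k\}_{k\in\mathbb Z}$ be such that for some $N\in\mathbb N$, $N\ge2$, and all $k\in\mathbb Z$, $$\theta_{k+N}=\theta_k,\qquad \alpha_k=ak+\pi_k,\quad\text{where }\ \pi_{k+N}=\pi_k\ \text{ and }\ a\in\mathbb R .$$ Then the unitary operator $U=M(\{\theta_k\},\{\alpha_k\},\{\gamma_k\})$ on $\ell^2(\mathbb Z)$ is purely absolutely continuous.
   Context: Let $(\varphi_k)_{k\in\mathbb Z}$ be the canonical orthonormal basis of $\ell^2(\mathbb Z)$. For sequences of real phases $\{\theta_k\},\{\alpha_k\},\{\gamma_k\}$, $k\in\mathbb Z$, and constants $r,t$ with $r^2+t^2=1$, put $$S_k=e^{-i\theta_k}\begin{pmatrix} r e^{-i\alpha_k} & i t e^{i\gamma_k}\\ i t e^{-i\gamma_k} & r e^{i\alpha_k}\end{pmatrix}.$$ $U_e$ is the unitary operator acting on each $\mathrm{span}\{\varphi_{2k},\varphi_{2k+1}\}$, $k\in\mathbb Z$, by the matrix $S_{2k}$ in the ordered basis $(\varphi_{2k},\varphi_{2k+1})$; $U_o$ is the unitary operator acting on each $\mathrm{span}\{\varphi_{2k+1},\varphi_{2k+2}\}$ by $S_{2k+1}$ in the ordered basis $(\varphi_{2k+1},\varphi_{2k+2})$. Set $M(\{\theta_k\},\{\alpha_k\},\{\gamma_k\}):=U_oU_e$.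 (Here $\pi_k$ denotes a real periodic sequence, not the number $\pi$.) *)

theory Defs
  imports "HOL-Analysis.Analysis"
begin

text \<open>The Hilbert space of square-summable two-sided sequences is represented by the carrier set
  \<open>ell2\<close>; an operator is a function on sequences of which only the restriction to \<open>ell2\<close> matters.
  The inner product is linear in its second argument.\<close>

definition ell2 :: "(int \<Rightarrow> complex) set" where
  "ell2 = {f. (\<lambda>k. (cmod (f k))\<^sup>2) summable_on UNIV}"

definition ell2_inner :: "(int \<Rightarrow> complex) \<Rightarrow> (int \<Rightarrow> complex) \<Rightarrow> complex" where
  "ell2_inner f g = (\<Sum>\<^sub>\<infinity>k. cnj (f k) * g k)"

type_synonym seq_op = "(int \<Rightarrow> complex) \<Rightarrow> (int \<Rightarrow> complex)"

definition linear_op :: "seq_op \<Rightarrow> bool" where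
  "linear_op T \<longleftrightarrow>
     (\<forall>f\<in>ell2. T f \<in> ell2) \<and>
     (\<forall>f\<in>ell2. \<forall>g\<in>ell2. T (\<lambda>k. f k + g k) = (\<lambda>k. T f k + T g k)) \<and>
     (\<forall>c. \<forall>f\<in>ell2. T (\<lambda>k. c * f k) = (\<lambda>k. c * T f k))"

definition unitary_op :: "seq_op \<Rightarrow> bool" where
  "unitary_op T \<longleftrightarrow> linear_op T \<and> T ` ell2 = ell2 \<and>
     (\<forall>f\<in>ell2. \<forall>g\<in>ell2. ell2_inner (T f) (T g) = ell2_inner f g)"

definition orthogonal_projection :: "seq_op \<Rightarrow> bool" where
  "orthogonal_projection P \<longleftrightarrow> linear_op P \<and>
     (\<forall>f\<in>ell2. P (P f) = P f) \<and>
     (\<forall>f\<in>ell2. \<forall>g\<in>ell2. ell2_inner (P f) g = ell2_inner f (P g))"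

text \<open>Projection-valued measures (resolutions of the identity) on the measurable space \<open>M\<close>;
  only the space and the sigma-algebra of \<open>M\<close> are used.\<close>

definition projection_valued_measure :: "'a measure \<Rightarrow> ('a set \<Rightarrow> seq_op) \<Rightarrow> bool" where
  "projection_valued_measure M E \<longleftrightarrow>
     (\<forall>A\<in>sets M. orthogonal_projection (E A)) \<and>
     (\<forall>f\<in>ell2. E {} f = (\<lambda>k. 0)) \<and>
     (\<forall>f\<in>ell2. E (space M) f = f) \<and>
     (\<forall>A\<in>sets M. \<forall>B\<in>sets M. \<forall>f\<in>ell2. E (A \<inter> B) f = E A (E B f)) \<and>
     (\<forall>A :: nat \<Rightarrow> 'a set. range A \<subseteq> sets M \<longrightarrow> disjoint_family A \<longrightarrow>
        (\<forall>f\<in>ell2. \<forall>g\<in>ell2.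
           (\<lambda>i. ell2_inner g (E (A i) f)) sums ell2_inner g (E (\<Union>i. A i) f)))"

text \<open>The scalar measure \<open>B \<mapsto> \<langle>f, E(B) f\<rangle>\<close>. The inner product is real and nonnegative because
  \<open>E(B)\<close> is an orthogonal projection.\<close>

definition scalar_measure ::
    "'a measure \<Rightarrow> ('a set \<Rightarrow> seq_op) \<Rightarrow> (int \<Rightarrow> complex) \<Rightarrow> 'a measure" where
  "scalar_measure M E f =
     measure_of (space M) (sets M) (\<lambda>B. ennreal (Re (ell2_inner f (E B f))))"

text \<open>The unit circle is parametrised by the angle in \<open>[0, 2\<pi>)\<close>, so that the spectral
  resolution of a unitary operator reads \<open>U = \<integral> exp(i x) dE(x)\<close>, and absolute continuity
  refers to Lebesgue measure in the angle. The operator identity is read weakly; the diagonal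
  matrix elements suffice by polarisation.\<close>

definition angle_space :: "real measure" where
  "angle_space = restrict_space lborel {0..<2 * pi}"

definition spectral_resolution :: "seq_op \<Rightarrow> (real set \<Rightarrow> seq_op) \<Rightarrow> bool" where
  "spectral_resolution U E \<longleftrightarrow>
     projection_valued_measure angle_space E \<and>
     (\<forall>f\<in>ell2. ell2_inner f (U f) = (LINT x|scalar_measure angle_space E f. cis x))"

text \<open>By the spectral theorem a unitary operator has exactly one spectral resolution on the Borel
  sets of \<open>[0, 2\<pi>)\<close>; stating its existence keeps the definition from being vacuous.\<close>

definition purely_absolutely_continuous :: "seq_op \<Rightarrow> bool" where
  "purely_absolutely_continuous U \<longleftrightarrow>
     (\<exists>E. spectral_resolution U E \<and>
          (\<forall>f\<in>ell2. absolutely_continuous angle_space (scalar_measure angle_space E f)))"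

definition scattering_matrix :: "real \<Rightarrow> real \<Rightarrow> real \<Rightarrow> real \<Rightarrow> real \<Rightarrow> complex^2^2" where
  "scattering_matrix r t \<theta> \<alpha> \<gamma> = vector
     [vector [cis (- \<theta>) * (of_real r * cis (- \<alpha>)), cis (- \<theta>) * (\<i> * of_real t * cis \<gamma>)],
      vector [cis (- \<theta>) * (\<i> * of_real t * cis (- \<gamma>)), cis (- \<theta>) * (of_real r * cis \<alpha>)]]"

text \<open>The operator acting on \<open>span {\<phi>\<^sub>m, \<phi>\<^sub>m\<^sub>+\<^sub>1}\<close>, for every \<open>m\<close> with the same parity as \<open>p\<close>,
  by the matrix \<open>S m\<close> in the ordered basis \<open>(\<phi>\<^sub>m, \<phi>\<^sub>m\<^sub>+\<^sub>1)\<close>: the coordinate column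
  \<open>(f m, f (m+1))\<close> is multiplied by \<open>S m\<close> from the left. A site \<open>j\<close> is the first one of its
  block iff it has the parity of \<open>p\<close>.\<close>

definition block_op :: "int \<Rightarrow> (int \<Rightarrow> complex^2^2) \<Rightarrow> seq_op" where
  "block_op p S f = (\<lambda>j. if even (j - p)
     then (S j *v vector [f j, f (j + 1)]) $ 1
     else (S (j - 1) *v vector [f (j - 1), f j]) $ 2)"

definition U_even ::
    "real \<Rightarrow> real \<Rightarrow> (int \<Rightarrow> real) \<Rightarrow> (int \<Rightarrow> real) \<Rightarrow> (int \<Rightarrow> real) \<Rightarrow> seq_op" where
  "U_even r t \<theta> \<alpha> \<gamma> = block_op 0 (\<lambda>k. scattering_matrix r t (\<theta> k) (\<alpha> k) (\<gamma> k))"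

definition U_odd ::
    "real \<Rightarrow> real \<Rightarrow> (int \<Rightarrow> real) \<Rightarrow> (int \<Rightarrow> real) \<Rightarrow> (int \<Rightarrow> real) \<Rightarrow> seq_op" where
  "U_odd r t \<theta> \<alpha> \<gamma> = block_op 1 (\<lambda>k. scattering_matrix r t (\<theta> k) (\<alpha> k) (\<gamma> k))"

definition M_op ::
    "real \<Rightarrow> real \<Rightarrow> (int \<Rightarrow> real) \<Rightarrow> (int \<Rightarrow> real) \<Rightarrow> (int \<Rightarrow> real) \<Rightarrow> seq_op" where
  "M_op r t \<theta> \<alpha> \<gamma> = U_odd r t \<theta> \<alpha> \<gamma> \<circ> U_even r t \<theta> \<alpha> \<gamma>"

end

theory Submission
  imports Defs "HOL-Probability.Helly_Selection"
begin

text \<open>The magnetic shift \<open>T \<phi>\<^sub>j = \<tau>\<^sub>j \<phi>\<^sub>j\<^sub>+\<^sub>2\<^sub>N\<close> with suitable phases \<open>\<tau>\<^sub>j\<close> absorbs both the linear part of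
  \<open>\<alpha>\<close> and the arbitrary \<open>\<gamma>\<close> and commutes with \<open>U\<close>. The pair \<open>(\<phi>\<^sub>j, U\<^sub>o \<phi>\<^sub>j)\<close> obeys a
  \<open>2 \<times> 2\<close> transfer recursion with entries in \<open>\<complex>[U, U\<^sup>-\<^sup>1]\<close> and constant unimodular determinant, so
  Cayley-Hamilton over one period gives \<open>(T\<^sup>2 - D(U) T + \<delta>) \<phi>\<^sub>j = 0\<close> with a Laurent
  polynomial \<open>D\<close> and \<open>|\<delta>| = 1\<close>. Hence the joint spectrum of \<open>(U, T)\<close> lies on the curve
  \<open>z\<^sup>2 - D(\<lambda>) z + \<delta> = 0\<close>. For \<open>z = cis y\<close> and \<open>\<delta> = cis (2 h)\<close> this forces
  \<open>cos (y - h) = g(\<lambda>)\<close> with \<open>g\<close> smooth, so a null set of \<open>\<lambda>\<close> meets only a null set of \<open>z\<close>. As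
  the spectral measure of \<open>T\<close> at \<open>\<phi>\<^sub>j\<close> is normalised Lebesgue measure, the spectral projection of
  \<open>U\<close> onto a null set annihilates every \<open>\<phi>\<^sub>j\<close>. No flat band has to be excluded separately.

  The spectral theorem comes from Helly's selection theorem: the spectral measure of a vector is
  the weak limit of its Fejer densities.\<close>

section \<open>Complex Hilbert spaces\<close>

text \<open>The curve is used in one direction only: \<lambda> is the independent variable, z the
  dependent one. A differentiable map sends null sets to null sets whatever its critical points,
  whereas preimages of null sets may be large. So even a constant D does no harm: it confines z to
  at most two points, which have measure zero for T.

  No joint spectral measure of U and T is built. Products of the two families of projections replace
  it: if z^2 - D(l) z + \<delta> has no zero on B x F with B, F compact, then E_U(B) E_T(F)
  annihilates the vector. The set of all z attached to a compact B is again compact, hence Borel,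
  which is not evident for a Borel B; inner regularity then carries the result from compact null
  sets to Borel ones.

  The parity of a site decides which of the two factors of U couples it to the next site. Either way
  the step of the recursion divides by a transmission entry, nonzero since t > 0, and has
  determinant -S12/S21, of modulus one since both transmission entries have the same modulus. The
  shift goes by 2N because N may be odd and only even shifts respect the blocks.\<close>

class complex_hilbert = real_inner + complete_space +
  fixes scaleC :: "complex \<Rightarrow> 'a \<Rightarrow> 'a"  (infixr \<open>*\<^sub>C\<close> 75)
    and cinner :: "'a \<Rightarrow> 'a \<Rightarrow> complex"
  assumes scaleC_add_right: "c *\<^sub>C (x + y) = c *\<^sub>C x + c *\<^sub>C y"
    and scaleC_add_left: "(c + d) *\<^sub>C x = c *\<^sub>C x + d *\<^sub>C x"
    and scaleC_scaleC: "c *\<^sub>C (d *\<^sub>C x) = (c * d) *\<^sub>C x"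
    and scaleR_scaleC: "s *\<^sub>R x = of_real s *\<^sub>C x"
    and cinner_commute: "cinner x y = cnj (cinner y x)"
    and cinner_add_right: "cinner x (y + z) = cinner x y + cinner x z"
    and cinner_scaleC_right: "cinner x (c *\<^sub>C y) = c * cinner x y"
    and inner_cinner: "inner x y = Re (cinner x y)"

lemma scaleC_one [simp]: "1 *\<^sub>C x = (x :: 'a::complex_hilbert)"
  using scaleR_scaleC[of 1 x] by simp

lemma scaleC_zero_left [simp]: "0 *\<^sub>C x = (0 :: 'a::complex_hilbert)"
  using scaleR_scaleC[of 0 x] by simp

lemma scaleC_zero_right [simp]: "c *\<^sub>C (0 :: 'a::complex_hilbert) = 0"
  using scaleC_add_right[of c 0 0] by simp

lemma minus_scaleC: "- x = (-1) *\<^sub>C (x :: 'a::complex_hilbert)"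
  using scaleR_scaleC[of "-1" x] by simp

lemma scaleC_diff_right: "c *\<^sub>C (x - y) = c *\<^sub>C x - c *\<^sub>C (y :: 'a::complex_hilbert)"
  using scaleC_add_right[of c "x - y" y] by (simp add: algebra_simps)

lemma scaleC_diff_left: "(c - d) *\<^sub>C x = c *\<^sub>C x - d *\<^sub>C (x :: 'a::complex_hilbert)"
  using scaleC_add_left[of "c - d" d x] by (simp add: algebra_simps)

lemma cinner_add_left: "cinner (x + y) z = cinner x z + cinner y (z :: 'a::complex_hilbert)"
  by (metis cinner_add_right cinner_commute complex_cnj_add)

lemma cinner_scaleC_left: "cinner (c *\<^sub>C x) y = cnj c * cinner x (y :: 'a::complex_hilbert)"
  by (metis cinner_scaleC_right cinner_commute complex_cnj_mult)

lemma cinner_zero_right [simp]: "cinner x (0 :: 'a::complex_hilbert) = 0"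
  using cinner_scaleC_right[of x 0 0] by simp

lemma cinner_zero_left [simp]: "cinner (0 :: 'a::complex_hilbert) x = 0"
  using cinner_scaleC_left[of 0 0 x] by simp

lemma cinner_diff_right: "cinner x (y - z) = cinner x y - cinner x (z :: 'a::complex_hilbert)"
  using cinner_add_right[of x "y - z" z] by (simp add: algebra_simps)

lemma cinner_diff_left: "cinner (x - y) z = cinner x z - cinner y (z :: 'a::complex_hilbert)"
  using cinner_add_left[of "x - y" y z] by (simp add: algebra_simps)

lemma cinner_sum_right: "cinner x (\<Sum>i\<in>A. f i) = (\<Sum>i\<in>A. cinner x (f i :: 'a::complex_hilbert))"
  by (induction A rule: infinite_finite_induct) (simp_all add: cinner_add_right)

lemma cinner_sum_left: "cinner (\<Sum>i\<in>A. f i) x = (\<Sum>i\<in>A. cinner (f i :: 'a::complex_hilbert) x)"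
  by (induction A rule: infinite_finite_induct) (simp_all add: cinner_add_left)

lemma cinner_self: "cinner x x = of_real ((norm (x :: 'a::complex_hilbert))\<^sup>2)"
proof -
  have "cinner x x = cnj (cinner x x)" by (rule cinner_commute)
  hence "cinner x x \<in> \<real>" by (simp add: Reals_cnj_iff)
  moreover have "Re (cinner x x) = (norm x)\<^sup>2"
    by (simp add: inner_cinner[symmetric] power2_norm_eq_inner)
  ultimately show ?thesis by (metis of_real_Re)
qed

lemma norm_scaleC: "norm (c *\<^sub>C (x :: 'a::complex_hilbert)) = cmod c * norm x"
proof -
  have "complex_of_real ((norm (c *\<^sub>C x))\<^sup>2) = cnj c * c * of_real ((norm x)\<^sup>2)"
    unfolding cinner_self[symmetric] cinner_scaleC_left cinner_scaleC_right by simp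
  also have "\<dots> = complex_of_real ((cmod c * norm x)\<^sup>2)"
    using complex_norm_square[of c] by (simp add: power_mult_distrib mult.commute)
  finally have "(norm (c *\<^sub>C x))\<^sup>2 = (cmod c * norm x)\<^sup>2" using of_real_eq_iff by blast
  thus ?thesis by (simp add: power2_eq_iff_nonneg)
qed

text \<open>Both components are real inner products, so limits of \<open>cinner\<close> reduce to
  limits of \<open>inner\<close>.\<close>

lemma cinner_complex:
  "cinner x y = Complex (inner x y) (inner (\<i> *\<^sub>C x) (y :: 'a::complex_hilbert))"
  by (simp add: inner_cinner cinner_scaleC_left complex_eq_iff)

lemma tendsto_cinner [tendsto_intros]:
  fixes f g :: "'b \<Rightarrow> 'a::complex_hilbert"
  assumes "(f \<longlongrightarrow> x) F" and "(g \<longlongrightarrow> y) F"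
  shows "((\<lambda>n. cinner (f n) (g n)) \<longlongrightarrow> cinner x y) F"
proof -
  have "norm (\<i> *\<^sub>C f n - \<i> *\<^sub>C x) = norm (f n - x)" for n
    by (simp add: scaleC_diff_right[symmetric] norm_scaleC)
  hence "((\<lambda>n. \<i> *\<^sub>C f n) \<longlongrightarrow> \<i> *\<^sub>C x) F"
    using assms(1) by (simp add: tendsto_iff dist_norm)
  thus ?thesis unfolding cinner_complex using assms
    by (intro tendsto_Complex tendsto_inner)
qed

lemma cinner_polarization:
  fixes x y :: "'a::complex_hilbert"
  shows "4 * cinner x y = of_real ((norm (x + y))\<^sup>2) - of_real ((norm (x - y))\<^sup>2)
    - \<i> * of_real ((norm (x + \<i> *\<^sub>C y))\<^sup>2) + \<i> * of_real ((norm (x - \<i> *\<^sub>C y))\<^sup>2)"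
  unfolding cinner_self[symmetric]
  by (simp add: cinner_add_left cinner_add_right cinner_diff_left cinner_diff_right
      cinner_scaleC_left cinner_scaleC_right algebra_simps)

section \<open>The spectral measure of a vector\<close>

text \<open>The inverse is carried along explicitly: negative powers of U are powers of V, and by
  \<open>V_unitary_pair\<close> every result about U is available for V as well.\<close>

locale unitary_pair =
  fixes U V :: "'a::complex_hilbert \<Rightarrow> 'a"
  assumes U_add: "U (x + y) = U x + U y"
    and U_scaleC: "U (c *\<^sub>C x) = c *\<^sub>C U x"
    and U_isometry: "cinner (U x) (U y) = cinner x y"
    and UV [simp]: "U (V x) = x"
    and VU [simp]: "V (U x) = x"
begin

lemma V_unitary_pair: "unitary_pair V U"
proof
  show "V (x + y) = V x + V y" for x y by (metis U_add UV VU)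
  show "V (c *\<^sub>C x) = c *\<^sub>C V x" for c x by (metis U_scaleC UV VU)
  show "cinner (V x) (V y) = cinner x y" for x y by (metis U_isometry UV)
qed simp_all

lemma V_add: "V (x + y) = V x + V y"
  by (metis U_add UV VU)

lemma V_scaleC: "V (c *\<^sub>C x) = c *\<^sub>C V x"
  by (metis U_scaleC UV VU)

lemma U_norm: "norm (U x) = norm x"
  using U_isometry[of x x] by (simp add: norm_eq_sqrt_inner inner_cinner)

lemma U_pow_isometry: "cinner ((U ^^ n) x) ((U ^^ n) y) = cinner x y"
  by (induction n) (simp_all add: U_isometry)

lemma U_pow_scaleC: "(U ^^ n) (c *\<^sub>C x) = c *\<^sub>C (U ^^ n) x"
  by (induction n) (simp_all add: U_scaleC)

lemma U_pow_add: "(U ^^ n) (x + y) = (U ^^ n) x + (U ^^ n) y"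
  by (induction n) (simp_all add: U_add)

text \<open>The Gram matrix of the orbit of a vector is Toeplitz, so a single sequence of moments
  describes it.\<close>

lemma U_pow_cinner_shift: "cinner ((U ^^ k) x) ((U ^^ (k + n)) y) = cinner x ((U ^^ n) y)"
  using U_pow_isometry[of k x "(U ^^ n) y"] by (simp add: funpow_add)

end

lemma cis_has_vector_derivative:
  "((\<lambda>x. cis (a * x)) has_vector_derivative (\<i> * of_real a) * cis (a * x)) (at x within S)"
proof -
  have "((\<lambda>x. exp (\<i> * of_real a * of_real x)) has_vector_derivative
     (\<i> * of_real a) * exp (\<i> * of_real a * of_real x)) (at x within S)"
    by (rule has_vector_derivative_real_field) (auto intro!: derivative_eq_intros)
  thus ?thesis by (simp add: cis_conv_exp mult.assoc)
qed

lemma integral_cis_period: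
  "integrable lborel (\<lambda>x. indicator {0..2*pi} x *\<^sub>R cis (of_int m * x))"
  "(LINT x|lborel. indicator {0..2*pi} x *\<^sub>R cis (of_int m * x)) = (if m = 0 then 2 * pi else 0)"
proof -
  show "integrable lborel (\<lambda>x. indicator {0..2*pi} x *\<^sub>R cis (of_int m * x))"
    by (rule borel_integrable_compact) (auto intro!: continuous_intros)
  show "(LINT x|lborel. indicator {0..2*pi} x *\<^sub>R cis (of_int m * x)) = (if m = 0 then 2 * pi else 0)"
  proof (cases "m = 0")
    case True
    thus ?thesis by (simp add: scaleR_conv_of_real)
  next
    case False
    have d: "((\<lambda>x. cis (of_int m * x) / (\<i> * of_int m)) has_vector_derivative cis (of_int m * x))
        (at x within {0..2*pi})" for x :: real
      using has_vector_derivative_divide[OF cis_has_vector_derivative[of "of_int m" x "{0..2*pi}"],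
          of "\<i> * of_int m"] False by simp
    have "(LINT x|lborel. indicator {0..2*pi} x *\<^sub>R cis (of_int m * x))
      = cis (of_int m * (2*pi)) / (\<i> * of_int m) - cis (of_int m * 0) / (\<i> * of_int m)"
      by (rule integral_FTC_Icc[of 0 "2*pi" "\<lambda>x. cis (of_int m * x) / (\<i> * of_int m)"])
         (auto intro!: continuous_intros d)
    also have "cis (of_int m * (2*pi)) = 1"
      using cis_multiple_2pi[of "of_int m"] by (simp add: mult_ac)
    finally show ?thesis using False by simp
  qed
qed

context unitary_pair
begin

text \<open>The Fejer mean of the Fourier series with coefficients
  \<open>cinner f ((U ^^ n) f)\<close>, written as a squared norm so that its positivity is visible.
  The minus sign in the exponent pairs \<open>U ^^ n\<close> with
  \<open>cis (n * x)\<close>.\<close>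

definition fejer_density :: "'a \<Rightarrow> nat \<Rightarrow> real \<Rightarrow> real" where
  "fejer_density f N x = indicator {0..2*pi} x *
     ((norm (\<Sum>k<N. cis (- (real k * x)) *\<^sub>C (U ^^ k) f))\<^sup>2 / (2 * pi * real N))"

lemma fejer_density_cis:
  "fejer_density f N x *\<^sub>R cis (real n * x) =
     (\<Sum>k<N. \<Sum>l<N. (indicator {0..2*pi} x *\<^sub>R cis (of_int (int n + int k - int l) * x)) *
        (cinner ((U ^^ k) f) ((U ^^ l) f) / (2 * pi * real N)))"
proof -
  have c: "cis (real n * x) * (cis (real k * x) * cis (- (real l * x)))
    = cis (of_int (int n + int k - int l) * x)" for k l :: nat
    by (simp add: cis_mult algebra_simps)
  have "of_real ((norm (\<Sum>k<N. cis (- (real k * x)) *\<^sub>C (U ^^ k) f))\<^sup>2) =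
     (\<Sum>k<N. \<Sum>l<N. cis (real k * x) * cis (- (real l * x)) * cinner ((U ^^ k) f) ((U ^^ l) f))"
    unfolding cinner_self[symmetric] cinner_sum_left
    by (intro sum.cong refl)
       (simp add: cinner_sum_right cinner_scaleC_left cinner_scaleC_right cis_cnj mult_ac sum_distrib_left)
  hence "fejer_density f N x *\<^sub>R cis (real n * x) = 
    indicator {0..2*pi} x *\<^sub>R ((\<Sum>k<N. \<Sum>l<N. (cis (real n * x) * (cis (real k * x) * cis (- (real l * x)))) * cinner ((U ^^ k) f) ((U ^^ l) f))
       / (2 * pi * real N))"
    by (simp add: fejer_density_def scaleR_conv_of_real sum_distrib_left mult_ac)
  thus ?thesis unfolding c
    by (simp add: scaleR_conv_of_real sum_distrib_left sum_divide_distrib mult_ac)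
qed

text \<open>Orthogonality of the exponentials leaves the pairs l = k + n. There are N - n of them in
  truncated subtraction, so the moments of order n >= N vanish.\<close>

lemma fejer_density_moment:
  assumes "N > 0"
  shows "integrable lborel (\<lambda>x. fejer_density f N x *\<^sub>R cis (real n * x))"
    and "(LINT x|lborel. fejer_density f N x *\<^sub>R cis (real n * x)) =
      of_real (real (N - n) / real N) * cinner f ((U ^^ n) f)"
proof -
  note i = integral_cis_period
  show "integrable lborel (\<lambda>x. fejer_density f N x *\<^sub>R cis (real n * x))"
    unfolding fejer_density_cis
    by (intro Bochner_Integration.integrable_sum integrable_mult_left i)
  have "(LINT x|lborel. fejer_density f N x *\<^sub>R cis (real n * x)) =
    (\<Sum>k<N. \<Sum>l<N. (if int n + int k - int l = 0 then 2 * pi else 0) *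
        (cinner ((U ^^ k) f) ((U ^^ l) f) / (2 * pi * real N)))"
    unfolding fejer_density_cis
    by (subst Bochner_Integration.integral_sum integral_mult_left_zero i(2);
        (intro Bochner_Integration.integrable_sum integrable_mult_left i sum.cong refl)?)+
  also have "\<dots> = (\<Sum>k<N. \<Sum>l<N. if l = k + n then cinner f ((U ^^ n) f) / real N else 0)"
    by (intro sum.cong refl) (auto simp: U_pow_cinner_shift)
  also have "\<dots> = (\<Sum>k<N. if k + n < N then cinner f ((U ^^ n) f) / real N else 0)"
    by (intro sum.cong refl) simp
  also have "\<dots> = (\<Sum>k | k < N \<and> k + n < N. cinner f ((U ^^ n) f) / real N)"
    by (simp add: sum.inter_filter[symmetric])
  also have "{k. k < N \<and> k + n < N} = {..<N - n}" by auto
  finally show "(LINT x|lborel. fejer_density f N x *\<^sub>R cis (real n * x)) =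
      of_real (real (N - n) / real N) * cinner f ((U ^^ n) f)"
    by simp
qed


lemma fejer_density_nonneg [simp]: "fejer_density f N x \<ge> 0"
  by (simp add: fejer_density_def)

lemma fejer_density_measurable [measurable]: "fejer_density f N \<in> borel_measurable borel"
proof (cases "N = 0")
  case True
  thus ?thesis by (simp add: fejer_density_def[abs_def])
next
  case False
  hence "integrable lborel (\<lambda>x. fejer_density f N x *\<^sub>R cis (real 0 * x))"
    by (intro fejer_density_moment) simp
  from borel_measurable_integrable[OF integrable_Re[OF this]] show ?thesis by simp
qed

definition fejer_measure :: "'a \<Rightarrow> nat \<Rightarrow> real measure" where
  "fejer_measure f N = density lborel (\<lambda>x. ennreal (fejer_density f N x))"

lemma sets_fejer_measure [simp, measurable_cong]: "sets (fejer_measure f N) = sets borel"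
  by (simp add: fejer_measure_def)

lemma space_fejer_measure [simp]: "space (fejer_measure f N) = UNIV"
  by (simp add: fejer_measure_def)

lemma integral_fejer_measure:
  assumes "N > 0"
  shows "(LINT x|fejer_measure f N. cis (real n * x)) =
    of_real (real (N - n) / real N) * cinner f ((U ^^ n) f)"
  unfolding fejer_measure_def
  by (subst integral_density)
     (auto simp: fejer_density_moment(2)[OF assms]
       intro!: borel_measurable_continuous_onI continuous_intros)

lemma emeasure_fejer_measure:
  assumes "N > 0" and "norm f = 1"
  shows "emeasure (fejer_measure f N) UNIV = 1"
proof -
  have i: "integrable lborel (fejer_density f N)"
    using integrable_Re[OF fejer_density_moment(1)[OF assms(1), of f 0]] by simp
  have "of_real (LINT x|lborel. fejer_density f N x) = (LINT x|lborel. fejer_density f N x *\<^sub>R cis (real 0 * x))"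
    by (simp add: scaleR_conv_of_real)
  also have "\<dots> = 1"
    using assms unfolding fejer_density_moment(2)[OF assms(1)] by (simp add: cinner_self)
  finally have e: "(LINT x|lborel. fejer_density f N x) = 1" by (metis of_real_eq_1_iff)
  show ?thesis unfolding fejer_measure_def
    using i by (simp add: emeasure_density nn_integral_eq_integral e)
qed

text \<open>All densities live on one compact interval. \<open>Suc N\<close> skips N = 0, where the
  density is zero and has no mass; the left end -1 puts the point 0 inside a half-open
  interval.\<close>

lemma fejer_measure_tight:
  assumes "norm f = 1"
  shows "tight (\<lambda>N. fejer_measure f (Suc N))"
proof -
  have p: "prob_space (fejer_measure f (Suc N))" for N
    by (rule prob_spaceI) (simp add: emeasure_fejer_measure[OF _ assms])
  have "measure (fejer_measure f (Suc N)) {-1<..2*pi} = 1" for N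
  proof -
    have "emeasure (fejer_measure f (Suc N)) {-1<..2*pi} = emeasure (fejer_measure f (Suc N)) UNIV"
      unfolding fejer_measure_def
      by (simp add: emeasure_density)
         (intro nn_integral_cong, auto simp: fejer_density_def indicator_def)
    thus ?thesis by (simp add: measure_def emeasure_fejer_measure[OF _ assms])
  qed
  moreover have "(-1 :: real) < 2 * pi" using pi_gt_zero by linarith
  ultimately have "\<exists>a b. a < b \<and> (\<forall>N. 1 - e < measure (fejer_measure f (Suc N)) {a<..b})" if "e > 0" for e
    using that by (intro exI[of _ "-1"] exI[of _ "2*pi"]) simp
  moreover have "real_distribution (fejer_measure f (Suc N))" for N
    using p[of N] by (simp add: real_distribution_def real_distribution_axioms_def)
  ultimately show ?thesis unfolding tight_def by blast
qed

text \<open>Helly's theorem speaks of probability measures, hence the unit vector. The moments are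
  integrals of bounded continuous functions, so they survive the weak limit. The limit measure may
  charge both 0 and 2 pi; only its image under \<open>cis\<close> is canonical.\<close>

lemma herglotz_unit:
  assumes "norm f = 1"
  shows "\<exists>M. real_distribution M \<and> (\<forall>n. (LINT x|M. cis (real n * x)) = cinner f ((U ^^ n) f))"
proof -
  let ?m = "\<lambda>N. fejer_measure f (Suc N)"
  from tight_imp_convergent_subsubsequence[OF fejer_measure_tight[OF assms], of id]
  obtain r M where r: "strict_mono (r :: nat \<Rightarrow> nat)" and M: "real_distribution M"
    and w: "weak_conv_m (?m \<circ> r) M" by (auto simp: strict_mono_def)
  have rd: "real_distribution ((?m \<circ> r) N)" for N
    using fejer_measure_tight[OF assms] by (simp add: tight_def)
  have "(LINT x|M. cis (real n * x)) = cinner f ((U ^^ n) f)" for n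
  proof (rule LIMSEQ_unique)
    show "(\<lambda>N. LINT x|(?m \<circ> r) N. cis (real n * x)) \<longlonglongrightarrow> (LINT x|M. cis (real n * x))"
      by (rule weak_conv_imp_integral_bdd_continuous_conv[OF rd M w, of _ 1]) 
         (auto simp: cis_conv_exp intro!: continuous_intros)
    have "(\<lambda>N. real (Suc N - n) / real (Suc N)) \<longlonglongrightarrow> 1"
    proof (rule Lim_transform_eventually)
      show "(\<lambda>N. 1 - real n / real (Suc N)) \<longlonglongrightarrow> 1"
        using tendsto_diff[OF tendsto_const[of 1] LIMSEQ_Suc[OF lim_const_over_n[of "real n"]]]
        by simp
      show "\<forall>\<^sub>F N in sequentially. 1 - real n / real (Suc N) = real (Suc N - n) / real (Suc N)"
        using eventually_ge_at_top[of n] by eventually_elim (simp add: of_nat_diff field_simps)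
    qed
    hence "(\<lambda>N. of_real (real (Suc (r N) - n) / real (Suc (r N))) * cinner f ((U ^^ n) f))
       \<longlonglongrightarrow> of_real 1 * cinner f ((U ^^ n) f)"
      by (intro tendsto_intros) (rule LIMSEQ_subseq_LIMSEQ[OF _ r, unfolded o_def])
    thus "(\<lambda>N. LINT x|(?m \<circ> r) N. cis (real n * x)) \<longlonglongrightarrow> cinner f ((U ^^ n) f)"
      by (simp add: integral_fejer_measure)
  qed
  thus ?thesis using M by blast
qed

text \<open>The circle is not made a space of its own: M is a Borel measure on the plane that is
  carried by the circle. Moments of negative order are the conjugates of the listed ones.\<close>

definition circle_moments :: "complex measure \<Rightarrow> 'a \<Rightarrow> bool" where
  "circle_moments M f \<longleftrightarrow> sets M = sets borel \<and> finite_measure M \<and> (AE z in M. cmod z = 1) \<and>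
     (\<forall>n. (LINT z|M. z ^ n) = cinner f ((U ^^ n) f))"

text \<open>A nonzero vector is normalised and the measure rescaled by the squared norm; the zero
  vector receives the null measure.\<close>

lemma herglotz: "\<exists>M. circle_moments M f"
proof (cases "f = 0")
  case True
  have "(U ^^ n) 0 = 0" for n using U_pow_scaleC[of n 0 0] by simp
  moreover have n: "AE z in null_measure (borel :: complex measure). P z" for P
    by (rule AE_I'[of UNIV]) (auto simp: null_sets_def)
  moreover have "finite_measure (null_measure (borel :: complex measure))"
    by (rule finite_measureI) simp
  moreover have "(LINT z|null_measure borel. z ^ n) = (0 :: complex)" for n :: nat
    by (rule integral_eq_zero_AE) (rule n)
  ultimately have "circle_moments (null_measure borel) f"
    using True by (auto simp: circle_moments_def)
  thus ?thesis ..
next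
  case False
  define u where "u = (1 / norm f) *\<^sub>R f"
  have u: "norm u = 1" using False by (simp add: u_def)
  have f: "f = complex_of_real (norm f) *\<^sub>C u" using False by (simp add: u_def scaleR_scaleC scaleC_scaleC)
  obtain M where M: "real_distribution M"
    and m: "\<And>n. (LINT x|M. cis (real n * x)) = cinner u ((U ^^ n) u)"
    using herglotz_unit[OF u] by blast
  interpret M: real_distribution M by (rule M)
  have cis_m [measurable]: "cis \<in> borel_measurable borel"
    by (intro borel_measurable_continuous_onI continuous_intros)
  define K where "K = density (distr M borel cis) (\<lambda>_. ennreal ((norm f)\<^sup>2))"
  have sp: "space K = UNIV" by (simp add: K_def)
  have "circle_moments K f" unfolding circle_moments_def
  proof (intro conjI allI)
    show "sets K = sets borel" by (simp add: K_def)
    show "finite_measure K"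
      by (rule finite_measureI)
         (simp add: K_def emeasure_density_const emeasure_distr ennreal_mult_eq_top_iff M.emeasure_space_1[unfolded M.space_eq_univ])
    show "AE z in K. cmod z = 1"
    proof (rule AE_I')
      have "{z. cmod z \<noteq> 1} \<in> sets borel" by measurable
      thus "{z. cmod z \<noteq> 1} \<in> null_sets K" by (simp add: null_sets_def K_def emeasure_density_const emeasure_distr)
    qed (auto simp: sp)
    fix n
    have "(LINT z|K. z ^ n) = (norm f)\<^sup>2 *\<^sub>R (LINT z|distr M borel cis. z ^ n)"
      unfolding K_def by (subst integral_density) auto
    also have "(LINT z|distr M borel cis. z ^ n) = (LINT x|M. cis (real n * x))"
      by (subst integral_distr) (auto simp: Complex.DeMoivre)
    also have "(norm f)\<^sup>2 *\<^sub>R \<dots> = cinner f ((U ^^ n) f)"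
      by (subst (2 3) f) (simp add: m cinner_scaleC_left cinner_scaleC_right U_pow_scaleC
            scaleR_conv_of_real power2_eq_square)
    finally show "(LINT z|K. z ^ n) = cinner f ((U ^^ n) f)" .
  qed
  thus ?thesis ..
qed

end

section \<open>Trigonometric polynomials of a unitary operator\<close>

definition circle_measure :: "complex measure \<Rightarrow> bool" where
  "circle_measure M \<longleftrightarrow> sets M = sets borel \<and> finite_measure M \<and> (AE z in M. cmod z = 1)"

lemma circle_measure_space: "circle_measure M \<Longrightarrow> space M = UNIV"
  using sets_eq_imp_space_eq[of M borel] by (simp add: circle_measure_def)

lemma circle_measure_integrable:
  fixes h :: "complex \<Rightarrow> 'b::{banach, second_countable_topology}"
  assumes M: "circle_measure M" and "h \<in> borel_measurable borel"
    and K: "\<And>z. cmod z = 1 \<Longrightarrow> norm (h z) \<le> K"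
  shows "integrable M h"
proof (rule finite_measure.integrable_const_bound)
  show "finite_measure M" using M by (simp add: circle_measure_def)
  show "AE z in M. norm (h z) \<le> K" using M K by (auto simp: circle_measure_def elim!: AE_mp)
  show "h \<in> borel_measurable M" using assms by (simp add: circle_measure_def cong: measurable_cong_sets)
qed

text \<open>The squared distance in L2(M) between p and the indicator of B.\<close>

definition l2_error :: "complex measure \<Rightarrow> complex set \<Rightarrow> (complex \<Rightarrow> complex) \<Rightarrow> real" where
  "l2_error M B p = (LINT z|M. (cmod (indicator B z - p z))\<^sup>2)"

lemma l2_error_nonneg [simp]: "l2_error M B p \<ge> 0"
  by (simp add: l2_error_def)

context unitary_pair
begin

lemma V_pow_add: "(V ^^ n) (x + y) = (V ^^ n) x + (V ^^ n) y"
  by (rule unitary_pair.U_pow_add[OF V_unitary_pair])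

lemma V_pow_scaleC: "(V ^^ n) (c *\<^sub>C x) = c *\<^sub>C (V ^^ n) x"
  by (rule unitary_pair.U_pow_scaleC[OF V_unitary_pair])

lemma U_pow_V_pow: "(U ^^ n) ((V ^^ m) x) = (V ^^ m) ((U ^^ n) x)"
proof -
  have "(U ^^ n) (V y) = V ((U ^^ n) y)" for y by (induction n) simp_all
  thus ?thesis by (induction m) simp_all
qed

lemma V_pow_U_pow_cancel: "(V ^^ n) ((U ^^ n) x) = x"
proof (induction n)
  case (Suc n)
  have "(V ^^ Suc n) ((U ^^ Suc n) x) = (V ^^ n) (V (U ((U ^^ n) x)))"
    by (subst funpow_Suc_right) simp
  thus ?case using Suc by simp
qed simp

lemma U_pow_V_pow_cancel: "(U ^^ n) ((V ^^ n) x) = x"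
  by (simp add: U_pow_V_pow V_pow_U_pow_cancel)

lemma cinner_V_pow: "cinner ((V ^^ n) x) y = cinner x ((U ^^ n) y)"
  using U_pow_isometry[of n "(V ^^ n) x" y] by (simp add: U_pow_V_pow_cancel)

lemma cinner_U_pow: "cinner ((U ^^ n) x) y = cinner x ((V ^^ n) y)"
  using U_pow_isometry[of n x "(V ^^ n) y"] by (simp add: U_pow_V_pow_cancel)

lemma U_diff: "U (x - y) = U x - U y"
  using U_add[of "x - y" y] by (simp add: algebra_simps)

lemma U_pow_norm: "norm ((U ^^ n) x) = norm x"
  by (induction n) (simp_all add: U_norm)

lemma V_pow_norm: "norm ((V ^^ n) x) = norm x"
  by (rule unitary_pair.U_pow_norm[OF V_unitary_pair])

text \<open>\<open>trig p P\<close>: \<open>p\<close> is a trigonometric polynomial and \<open>P\<close> is the operator \<open>p(U)\<close>.\<close>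

inductive trig :: "(complex \<Rightarrow> complex) \<Rightarrow> ('a \<Rightarrow> 'a) \<Rightarrow> bool" where
  trig_monom: "trig (\<lambda>z. c * (cnj z ^ m * z ^ n)) (\<lambda>x. c *\<^sub>C (V ^^ m) ((U ^^ n) x))"
| trig_add: "trig p P \<Longrightarrow> trig q Q \<Longrightarrow> trig (\<lambda>z. p z + q z) (\<lambda>x. P x + Q x)"

lemma trig_const: "trig (\<lambda>z. c) (\<lambda>x. c *\<^sub>C x)"
  using trig_monom[of c 0 0] by simp

lemma trig_U: "trig (\<lambda>z. z) U"
  using trig_monom[of 1 0 1] by (simp add: eta_contract_eq)

lemma trig_V: "trig cnj V"
  using trig_monom[of 1 1 0] by (simp add: eta_contract_eq)

lemma trig_additive: "trig p P \<Longrightarrow> P (x + y) = P x + P y"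
  by (induction rule: trig.induct)
     (simp_all add: V_pow_add U_pow_add scaleC_add_right algebra_simps)

lemma trig_scaleC: "trig p P \<Longrightarrow> P (c *\<^sub>C x) = c *\<^sub>C P x"
  by (induction rule: trig.induct)
     (simp_all add: V_pow_scaleC U_pow_scaleC scaleC_scaleC scaleC_add_right mult.commute)

lemma trig_diff_right: "trig p P \<Longrightarrow> P (x - y) = P x - P y"
  using trig_additive[of p P "x - y" y] by (simp add: algebra_simps)

lemma trig_mult:
  assumes "trig p P" and "trig q Q"
  shows "trig (\<lambda>z. p z * q z) (\<lambda>x. P (Q x))"
  using assms
proof (induction rule: trig.induct)
  case (trig_monom c m n)
  from trig_monom show ?case
  proof (induction rule: trig.induct)
    case (trig_monom d k l)
    have "trig (\<lambda>z. (c * d) * (cnj z ^ (m + k) * z ^ (n + l)))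
       (\<lambda>x. (c * d) *\<^sub>C (V ^^ (m + k)) ((U ^^ (n + l)) x))"
      by (rule trig.trig_monom)
    thus ?case
      by (simp add: power_add funpow_add U_pow_V_pow V_pow_scaleC U_pow_scaleC scaleC_scaleC mult_ac)
  next
    case (trig_add p P q Q)
    from trig.trig_add[OF trig_add.IH] show ?case
      by (simp add: algebra_simps U_pow_add V_pow_add scaleC_add_right)
  qed
next
  case (trig_add p1 P1 p2 P2)
  from trig.trig_add[OF trig_add.IH(1)[OF trig_add.prems] trig_add.IH(2)[OF trig_add.prems]]
  show ?case by (simp add: algebra_simps)
qed

lemma trig_cmult: "trig p P \<Longrightarrow> trig (\<lambda>z. c * p z) (\<lambda>x. c *\<^sub>C P x)"
  by (rule trig_mult[OF trig_const])

lemma trig_diff: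
  assumes "trig p P" and "trig q Q"
  shows "trig (\<lambda>z. p z - q z) (\<lambda>x. P x - Q x)"
proof -
  have *: "u - v = u + (-1) *\<^sub>C v" for u v :: 'a
    unfolding minus_scaleC[symmetric] by simp
  show ?thesis unfolding * using trig_add[OF assms(1) trig_cmult[OF assms(2), of "-1"]] by simp
qed

lemma trig_adjoint:
  assumes "trig p P"
  obtains Q where "trig (\<lambda>z. cnj (p z)) Q" and "\<And>x y. cinner (P x) y = cinner x (Q y)"
proof -
  from assms have "\<exists>Q. trig (\<lambda>z. cnj (p z)) Q \<and> (\<forall>x y. cinner (P x) y = cinner x (Q y))"
  proof (induction rule: trig.induct)
    case (trig_monom c m n)
    have "trig (\<lambda>z. cnj c * (cnj z ^ n * z ^ m)) (\<lambda>x. cnj c *\<^sub>C (V ^^ n) ((U ^^ m) x))"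
      by (rule trig.trig_monom)
    thus ?case
      by (intro exI[of _ "\<lambda>x. cnj c *\<^sub>C (V ^^ n) ((U ^^ m) x)"])
         (simp add: cinner_scaleC_left cinner_scaleC_right cinner_V_pow cinner_U_pow mult_ac)
  next
    case (trig_add p P q Q)
    then obtain P' Q' where "trig (\<lambda>z. cnj (p z)) P'" "\<And>x y. cinner (P x) y = cinner x (P' y)"
      "trig (\<lambda>z. cnj (q z)) Q'" "\<And>x y. cinner (Q x) y = cinner x (Q' y)" by blast
    thus ?case using trig.trig_add[of "\<lambda>z. cnj (p z)" P' "\<lambda>z. cnj (q z)" Q']
      by (intro exI[of _ "\<lambda>x. P' x + Q' x"]) (simp add: cinner_add_left cinner_add_right)
  qed
  thus ?thesis using that by blast
qed

text \<open>The crude bound by the sum of the moduli of the coefficients serves the function and the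
  operator at once. The sharp comparison comes from \<open>trig_norm\<close>.\<close>

lemma trig_bounded:
  assumes "trig p P"
  obtains K where "K \<ge> 0" and "\<And>z. cmod z = 1 \<Longrightarrow> cmod (p z) \<le> K" and "\<And>x. norm (P x) \<le> K * norm x"
proof -
  from assms have "\<exists>K\<ge>0. (\<forall>z. cmod z = 1 \<longrightarrow> cmod (p z) \<le> K) \<and> (\<forall>x. norm (P x) \<le> K * norm x)"
  proof (induction rule: trig.induct)
    case (trig_monom c m n)
    show ?case
      by (rule exI[of _ "cmod c"]) (auto simp: norm_mult norm_power norm_scaleC V_pow_norm U_pow_norm)
  next
    case (trig_add p P q Q)
    then obtain K L where KL: "K \<ge> 0" "L \<ge> 0"
       "\<And>z. cmod z = 1 \<Longrightarrow> cmod (p z) \<le> K" "\<And>x. norm (P x) \<le> K * norm x"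
       "\<And>z. cmod z = 1 \<Longrightarrow> cmod (q z) \<le> L" "\<And>x. norm (Q x) \<le> L * norm x" by metis
    have "norm (P x + Q x) \<le> (K + L) * norm x" for x
      using norm_triangle_ineq[of "P x" "Q x"] KL(4,6)[of x] by (simp add: algebra_simps)
    moreover have "cmod (p z + q z) \<le> K + L" if "cmod z = 1" for z
      using norm_triangle_ineq[of "p z" "q z"] KL(3,5)[OF that] by simp
    ultimately show ?case using KL(1,2) by (intro exI[of _ "K + L"]) auto
  qed
  thus ?thesis using that by blast
qed

lemma trig_continuous: "trig p P \<Longrightarrow> continuous_on UNIV p"
  by (induction rule: trig.induct) (auto intro!: continuous_intros)

lemma trig_measurable: "trig p P \<Longrightarrow> p \<in> borel_measurable borel"
  by (intro borel_measurable_continuous_onI trig_continuous)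

lemma trig_integrable:
  assumes "circle_measure M" and "trig p P"
  shows "integrable M p"
  using trig_bounded[OF assms(2)] circle_measure_integrable[OF assms(1) trig_measurable[OF assms(2)]]
  by metis

lemma circle_moments_circle_measure: "circle_moments M f \<Longrightarrow> circle_measure M"
  by (simp add: circle_moments_def circle_measure_def)

text \<open>On the circle \<open>cnj z ^ m * z ^ n\<close> is a power of z if m <= n, and the
  conjugate of a power otherwise; both cases reduce to the prescribed moments.\<close>

lemma trig_integral:
  assumes M: "circle_moments M f" and "trig p P"
  shows "(LINT z|M. p z) = cinner f (P f)"
  using assms(2)
proof (induction rule: trig.induct)
  case (trig_monom c m n)
  have ae: "AE z in M. cmod z = 1" using M by (simp add: circle_moments_def)
  have meas: "(\<lambda>z. cnj z ^ m * z ^ n) \<in> borel_measurable M" "(\<lambda>z. z ^ k) \<in> borel_measurable M"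
     "(\<lambda>z. cnj (z ^ k)) \<in> borel_measurable M" for k
    using M by (auto simp: circle_moments_def cong: measurable_cong_sets
        intro!: borel_measurable_continuous_onI continuous_intros)
  have unit: "cnj z ^ k * z ^ k = 1" if "cmod z = 1" for z k
    using that by (simp add: power_mult_distrib[symmetric] mult.commute complex_norm_square[symmetric])
  have "(LINT z|M. cnj z ^ m * z ^ n) = cinner f ((V ^^ m) ((U ^^ n) f))"
  proof (cases "m \<le> n")
    case True
    then obtain k where n: "n = m + k" using le_Suc_ex by blast
    have "(LINT z|M. cnj z ^ m * z ^ n) = (LINT z|M. z ^ k)"
    proof (rule integral_cong_AE[OF meas(1,2)])
      show "AE z in M. cnj z ^ m * z ^ n = z ^ k"
        using ae by eventually_elim (simp add: n power_add mult.assoc[symmetric] unit)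
    qed
    thus ?thesis using M by (simp add: n circle_moments_def funpow_add V_pow_U_pow_cancel)
  next
    case False
    then obtain k where m: "m = n + k" using le_Suc_ex nat_le_linear by blast
    have "(LINT z|M. cnj z ^ m * z ^ n) = (LINT z|M. cnj (z ^ k))"
    proof (rule integral_cong_AE[OF meas(1,3)])
      show "AE z in M. cnj z ^ m * z ^ n = cnj (z ^ k)"
      proof (use ae in eventually_elim)
        fix z assume z: "cmod z = 1"
        have "cnj z ^ m * z ^ n = cnj z ^ k * (cnj z ^ n * z ^ n)" by (simp add: m power_add mult_ac)
        thus "cnj z ^ m * z ^ n = cnj (z ^ k)" using unit[OF z] by simp
      qed
    qed
    also have "\<dots> = cnj (LINT z|M. z ^ k)" by (rule Bochner_Integration.integral_cnj)
    also have "\<dots> = cinner ((U ^^ k) f) f" using M by (simp add: circle_moments_def cinner_commute[of "(U ^^ k) f"])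
    also have "\<dots> = cinner f ((V ^^ (k + n)) ((U ^^ n) f))"
      by (simp add: cinner_U_pow funpow_add V_pow_U_pow_cancel)
    finally show ?thesis by (simp add: m add.commute)
  qed
  thus ?case by (simp add: cinner_scaleC_right)
next
  case (trig_add p P q Q)
  thus ?case
    using trig_integrable[OF circle_moments_circle_measure[OF M]] by (simp add: cinner_add_right)
qed

text \<open>The isometry behind the functional calculus: if Q is the adjoint of P, then
  \<open>Q (P f)\<close> belongs to the polynomial \<open>cnj (p z) * p z\<close>, whose integral is
  known.\<close>

lemma trig_norm:
  assumes M: "circle_moments M f" and P: "trig p P"
  shows "(norm (P f))\<^sup>2 = (LINT z|M. (cmod (p z))\<^sup>2)"
proof -
  obtain Q where Q: "trig (\<lambda>z. cnj (p z)) Q" "\<And>x y. cinner (P x) y = cinner x (Q y)"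
    using trig_adjoint[OF P] by metis
  have "complex_of_real ((norm (P f))\<^sup>2) = cinner f (Q (P f))"
    by (simp only: cinner_self[symmetric] Q(2))
  also have "\<dots> = (LINT z|M. cnj (p z) * p z)"
    by (rule trig_integral[OF M trig_mult[OF Q(1) P], symmetric])
  also have "\<dots> = (LINT z|M. of_real ((cmod (p z))\<^sup>2))"
    by (intro Bochner_Integration.integral_cong refl) (simp only: complex_norm_square mult.commute)
  also have "\<dots> = of_real (LINT z|M. (cmod (p z))\<^sup>2)" by (rule integral_complex_of_real)
  finally show ?thesis using of_real_eq_iff by blast
qed

section \<open>Approximation of indicators by trigonometric polynomials in L2\<close>

lemma real_polynomial_trig:
  fixes g :: "complex \<Rightarrow> real"
  assumes "real_polynomial_function g"
  shows "\<exists>P. trig (\<lambda>z. of_real (g z)) P"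
  using assms
proof (induction rule: real_polynomial_function.induct)
  case (linear g)
  then interpret bounded_linear g .
  \<comment> \<open>A real-linear functional on the plane is twice the real part of c z, with c =
    (g(1) - i g(i)) / 2.\<close>
  define c where "c = Complex (g 1 / 2) (- g \<i> / 2)"
  have "complex_of_real (g z) = c * z + cnj c * cnj z" for z
  proof -
    have "z = Re z *\<^sub>R 1 + Im z *\<^sub>R \<i>" by (simp add: complex_eq_iff)
    from arg_cong[OF this, of g] have "g z = Re z * g 1 + Im z * g \<i>"
      by (simp only: add scaleR real_scaleR_def)
    thus ?thesis unfolding c_def by (simp add: complex_eq_iff)
  qed
  thus ?case using trig_add[OF trig_cmult[OF trig_U, of c] trig_cmult[OF trig_V, of "cnj c"]] by auto
next
  case (const c)
  show ?case using trig_const by blast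
next
  case (add f g)
  thus ?case using trig_add by fastforce
next
  case (mult f g)
  thus ?case using trig_mult by fastforce
qed

lemma continuous_trig_approx:
  fixes h :: "complex \<Rightarrow> real"
  assumes "continuous_on UNIV h" and "e > 0"
  obtains p P where "trig p P" and "\<And>z. cmod z = 1 \<Longrightarrow> cmod (of_real (h z) - p z) < e"
proof -
  have "continuous_on (sphere 0 1) h" using assms(1) continuous_on_subset by blast
  then obtain g where g: "real_polynomial_function g" "\<And>z. z \<in> sphere 0 1 \<Longrightarrow> \<bar>h z - g z\<bar> < e"
    using Stone_Weierstrass_real_polynomial_function[OF compact_sphere _ assms(2)] by metis
  obtain P where "trig (\<lambda>z. of_real (g z)) P" using real_polynomial_trig[OF g(1)] by blast
  moreover have "cmod (of_real (h z) - of_real (g z)) < e" if "cmod z = 1" for z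
    using g(2)[of z] that by (simp flip: of_real_diff)
  ultimately show ?thesis using that by blast
qed

lemma l2_error_integrable:
  assumes "circle_measure M" and "trig p P" and "B \<in> sets borel"
  shows "integrable M (\<lambda>z. (cmod (indicator B z - p z))\<^sup>2)"
proof -
  obtain K where K: "K \<ge> 0" "\<And>z. cmod z = 1 \<Longrightarrow> cmod (p z) \<le> K" using trig_bounded[OF assms(2)] by metis
  note [measurable] = trig_measurable[OF assms(2)] assms(3)
  show ?thesis
  proof (rule circle_measure_integrable[OF assms(1), of _ "(1 + K)\<^sup>2"])
    show "(\<lambda>z. (cmod (indicator B z - p z))\<^sup>2) \<in> borel_measurable borel" by measurable
    fix z :: complex assume z: "cmod z = 1"
    have "cmod (indicator B z - p z) \<le> cmod (indicator B z) + cmod (p z)" by (rule norm_triangle_ineq4)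
    also have "\<dots> \<le> 1 + K" using K(2)[OF z] by (auto simp: indicator_def)
    finally show "norm ((cmod (indicator B z - p z))\<^sup>2) \<le> (1 + K)\<^sup>2" by (simp add: power_mono)
  qed
qed

end

text \<open>The tent functions \<open>max 0 (1 - n * infdist z C)\<close> tend pointwise to the
  indicator of the closed set C, and dominated convergence applies. The family of measures is finite
  because later one polynomial has to serve several vectors.\<close>

lemma compact_indicator_approx:
  assumes "finite \<M>" and "\<And>M. M \<in> \<M> \<Longrightarrow> circle_measure M" and C: "compact C" and "e > 0"
  obtains h :: "complex \<Rightarrow> real" where "continuous_on UNIV h" and "\<And>z. 0 \<le> h z \<and> h z \<le> 1"
    and "\<And>M. M \<in> \<M> \<Longrightarrow> (LINT z|M. (indicator C z - h z)\<^sup>2) < e"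
proof (cases "C = {}")
  \<comment> \<open>\<open>infdist\<close> to the empty set is 0, so the tent functions would be
    constantly 1.\<close>
  case True
  show ?thesis by (rule that[of "\<lambda>_. 0"]) (use True assms(4) in auto)
next
  case False
  define h where "h n z = max 0 (1 - real n * infdist z C)" for n z
  have cont: "continuous_on UNIV (h n)" for n unfolding h_def by (intro continuous_intros)
  have [measurable]: "h n \<in> borel_measurable borel" for n
    by (intro borel_measurable_continuous_onI cont)
  have [measurable]: "C \<in> sets borel" using C by (simp add: borel_closed compact_imp_closed)
  have bd: "0 \<le> h n z" "h n z \<le> 1" for n z by (auto simp: h_def infdist_nonneg)
  have lim: "(\<lambda>n. h n z) \<longlonglongrightarrow> indicator C z" for z
  proof (cases "z \<in> C")
    case True
    thus ?thesis by (simp add: h_def)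
  next
    case zC: False
    hence d: "infdist z C > 0"
      using in_closed_iff_infdist_zero[OF compact_imp_closed[OF C] False] infdist_nonneg[of z C]
      by force
    have "\<forall>\<^sub>F n in sequentially. h n z = 0"
    proof -
      obtain k :: nat where k: "1 / infdist z C < real k" using reals_Archimedean2 by blast
      show ?thesis
      proof (rule eventually_sequentiallyI[of k])
        fix n assume "k \<le> n"
        hence "1 / infdist z C < real n" using k by linarith
        thus "h n z = 0" using d by (simp add: h_def field_simps)
      qed
    qed
    thus ?thesis using zC by (simp add: tendsto_eventually)
  qed
  have "\<forall>\<^sub>F n in sequentially. (LINT z|M. (indicator C z - h n z)\<^sup>2) < e" if "M \<in> \<M>" for M
  proof -
    have cm: "circle_measure M" using assms(2) that .
    have [measurable_cong]: "sets M = sets borel" using cm by (simp add: circle_measure_def)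
    have "(\<lambda>n. LINT z|M. (indicator C z - h n z)\<^sup>2) \<longlonglongrightarrow> (LINT z|M. (0::real))"
    proof (rule integral_dominated_convergence[where w="\<lambda>_. 1"])
      show "integrable M (\<lambda>_. 1::real)"
        by (rule circle_measure_integrable[OF cm, of _ 1]) auto
      show "AE z in M. (\<lambda>n. (indicator C z - h n z)\<^sup>2) \<longlonglongrightarrow> 0"
      proof (intro AE_I2)
        fix z
        have "(\<lambda>n. (indicator C z - h n z)\<^sup>2) \<longlonglongrightarrow> (indicator C z - indicator C z)\<^sup>2"
          by (intro tendsto_intros lim)
        thus "(\<lambda>n. (indicator C z - h n z)\<^sup>2) \<longlonglongrightarrow> 0" by simp
      qed
      show "AE z in M. norm ((indicator C z - h n z)\<^sup>2) \<le> 1" for n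
      proof (intro AE_I2)
        fix z
        have "\<bar>indicator C z - h n z\<bar> \<le> 1" using bd[of n z] by (auto simp: indicator_def)
        thus "norm ((indicator C z - h n z)\<^sup>2) \<le> 1" by (simp add: abs_square_le_1)
      qed
    qed measurable
    thus ?thesis using assms(4) by (intro order_tendstoD(2)) simp_all
  qed
  hence "\<forall>\<^sub>F n in sequentially. \<forall>M\<in>\<M>. (LINT z|M. (indicator C z - h n z)\<^sup>2) < e"
    using assms(1) by (simp add: eventually_ball_finite_distrib)
  then obtain n where "\<forall>M\<in>\<M>. (LINT z|M. (indicator C z - h n z)\<^sup>2) < e"
    using eventually_sequentially by auto
  thus ?thesis using cont bd by (intro that[of "h n"]) auto
qed

lemma borel_compact_approx:
  assumes "finite \<M>" and "\<And>M. M \<in> \<M> \<Longrightarrow> circle_measure M" and B: "B \<in> sets borel" and "e > 0"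
  obtains C where "compact C" and "C \<subseteq> B" and "\<And>M. M \<in> \<M> \<Longrightarrow> measure M (B - C) < e"
proof -
  have "\<exists>C. compact C \<and> C \<subseteq> B \<and> measure M (B - C) < e" if "M \<in> \<M>" for M
  proof -
    have cm: "circle_measure M" using assms(2) that .
    then interpret finite_measure M by (simp add: circle_measure_def)
    have s: "sets M = sets borel" using cm by (simp add: circle_measure_def)
    have "emeasure M B = (SUP C \<in> {C. C \<subseteq> B \<and> compact C}. emeasure M C)"
      using B by (intro inner_regular s) auto
    show ?thesis
    \<comment> \<open>\<open>ennreal\<close> cuts negative numbers off at 0; the case in which
      \<open>measure M B - e\<close> is negative is served by the empty set.\<close>
    proof (cases "measure M B < e")
      case True
      thus ?thesis by (intro exI[of _ "{}"]) auto
    next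
      case False
      hence "ennreal (measure M B - e) < emeasure M B"
        using assms(4) by (simp add: emeasure_eq_measure ennreal_less_iff)
      then obtain C where C: "C \<subseteq> B" "compact C" "ennreal (measure M B - e) < emeasure M C"
        unfolding \<open>emeasure M B = _\<close> less_SUP_iff by blast
      have sC: "C \<in> sets M" "B \<in> sets M" using C B by (auto simp: s borel_closed compact_imp_closed)
      have "measure M B - e < measure M C"
        using C(3) False by (simp add: emeasure_eq_measure ennreal_less_iff)
      thus ?thesis using C sC by (intro exI[of _ C]) (simp add: finite_measure_Diff)
    qed
  qed
  then obtain C where C: "\<And>M. M \<in> \<M> \<Longrightarrow> compact (C M) \<and> C M \<subseteq> B \<and> measure M (B - C M) < e" by metis
  show ?thesis
  proof (rule that[of "\<Union>M\<in>\<M>. C M"])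
    show cc: "compact (\<Union>M\<in>\<M>. C M)" using assms(1) C by (intro compact_UN) auto
    show "(\<Union>M\<in>\<M>. C M) \<subseteq> B" using C by blast
    fix M assume M: "M \<in> \<M>"
    then interpret finite_measure M using assms(2) by (simp add: circle_measure_def)
    have s: "sets M = sets borel" using assms(2)[OF M] by (simp add: circle_measure_def)
    have "measure M (B - (\<Union>M\<in>\<M>. C M)) \<le> measure M (B - C M)"
      using M C[OF M] B by (intro finite_measure_mono) (auto simp: s borel_closed compact_imp_closed)
    thus "measure M (B - (\<Union>M\<in>\<M>. C M)) < e" using C[OF M] by linarith
  qed
qed

lemma cmod_square_sum3: "(cmod (a + b + c))\<^sup>2 \<le> 3 * ((cmod a)\<^sup>2 + (cmod b)\<^sup>2 + (cmod c)\<^sup>2)"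
proof -
  have "cmod (a + b + c) \<le> cmod a + cmod b + cmod c"
    using norm_triangle_ineq[of "a + b" c] norm_triangle_ineq[of a b] by linarith
  hence "(cmod (a + b + c))\<^sup>2 \<le> (cmod a + cmod b + cmod c)\<^sup>2" by (intro power_mono) auto
  also have "\<dots> \<le> 3 * ((cmod a)\<^sup>2 + (cmod b)\<^sup>2 + (cmod c)\<^sup>2)"
    using sum_squares_ge_zero[of "cmod a - cmod b" "cmod b - cmod c"] zero_le_power2[of "cmod a - cmod c"]
    by (simp add: power2_eq_square algebra_simps)
  finally show ?thesis .
qed

lemma norm_square_add_le:
  fixes a b :: "'a::real_normed_vector"
  shows "(norm (a + b))\<^sup>2 \<le> 2 * ((norm a)\<^sup>2 + (norm b)\<^sup>2)"
proof -
  have "(norm (a + b))\<^sup>2 \<le> (norm a + norm b)\<^sup>2" by (intro power_mono norm_triangle_ineq) auto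
  also have "\<dots> \<le> 2 * ((norm a)\<^sup>2 + (norm b)\<^sup>2)"
    using sum_squares_bound[of "norm a" "norm b"] by (simp add: power2_sum)
  finally show ?thesis .
qed

context unitary_pair
begin

text \<open>Three approximations in a row: B by a compact set, its indicator by a continuous
  function, and that function uniformly on the circle by a polynomial.\<close>

lemma trig_dense:
  assumes "finite \<M>" and "\<And>M. M \<in> \<M> \<Longrightarrow> circle_measure M" and B: "B \<in> sets borel" and "e > 0"
  shows "\<exists>p P. trig p P \<and> (\<forall>M\<in>\<M>. l2_error M B p < e)"
proof -
  define m where "m = Max (insert 1 ((\<lambda>M. measure M UNIV) ` \<M>))"
  have m: "m \<ge> 1" "\<And>M. M \<in> \<M> \<Longrightarrow> measure M UNIV \<le> m" unfolding m_def using assms(1) by auto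
  \<comment> \<open>Each approximation contributes at most d, and the factor 3 of
    \<open>cmod_square_sum3\<close> makes the total 9 d = e. Below, s is fixed so that the uniform
    error s contributes s^2 m = d; the 1 in m permits the division.\<close>
  define d where "d = e / 9"
  have d: "d > 0" using assms(4) by (simp add: d_def)
  obtain C where C: "compact C" "C \<subseteq> B" "\<And>M. M \<in> \<M> \<Longrightarrow> measure M (B - C) < d"
    using borel_compact_approx[OF assms(1,2,3) d] by metis
  obtain h :: "complex \<Rightarrow> real" where h: "continuous_on UNIV h" "\<And>z. 0 \<le> h z \<and> h z \<le> 1"
    "\<And>M. M \<in> \<M> \<Longrightarrow> (LINT z|M. (indicator C z - h z)\<^sup>2) < d"
    using compact_indicator_approx[OF assms(1,2) C(1) d] by metis
  define s where "s = sqrt (d / m)"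
  have s: "s > 0" "s\<^sup>2 * m = d" using d m(1) by (auto simp: s_def)
  obtain p P where p: "trig p P" "\<And>z. cmod z = 1 \<Longrightarrow> cmod (of_real (h z) - p z) < s"
    using continuous_trig_approx[OF h(1) s(1)] by metis
  have [measurable]: "C \<in> sets borel" using C by (simp add: borel_closed compact_imp_closed)
  have [measurable]: "h \<in> borel_measurable borel" by (intro borel_measurable_continuous_onI h)
  note [measurable] = B
  have "l2_error M B p < e" if "M \<in> \<M>" for M
  proof -
    have cm: "circle_measure M" using assms(2) that .
    then interpret finite_measure M by (simp add: circle_measure_def)
    have sM [measurable_cong]: "sets M = sets borel" using cm by (simp add: circle_measure_def)
    have i1: "integrable M (\<lambda>z. indicator (B - C) z :: real)"
      by (rule circle_measure_integrable[OF cm, of _ 1]) (auto simp: indicator_def)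
    have "\<bar>indicator C z - h z\<bar> \<le> 1" for z using h(2)[of z] by (auto simp: indicator_def)
    hence i2: "integrable M (\<lambda>z. (indicator C z - h z)\<^sup>2)"
      by (intro circle_measure_integrable[OF cm, of _ 1]) (auto simp: abs_square_le_1)
    have i3: "integrable M (\<lambda>z. s\<^sup>2)" by simp
    have "l2_error M B p \<le> (LINT z|M. 3 * (indicator (B - C) z + (indicator C z - h z)\<^sup>2 + s\<^sup>2))"
      unfolding l2_error_def
    proof (rule integral_mono_AE[OF l2_error_integrable[OF cm p(1) B]])
      show "integrable M (\<lambda>z. 3 * (indicator (B - C) z + (indicator C z - h z)\<^sup>2 + s\<^sup>2))"
        using i1 i2 i3 by (intro integrable_mult_right Bochner_Integration.integrable_add)
      have "AE z in M. cmod z = 1" using cm by (simp add: circle_measure_def)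
      thus "AE z in M. (cmod (indicator B z - p z))\<^sup>2 \<le> 3 * (indicator (B - C) z + (indicator C z - h z)\<^sup>2 + s\<^sup>2)"
      proof eventually_elim
        fix z :: complex assume z: "cmod z = 1"
        have "indicator B z - p z = indicator (B - C) z + of_real (indicator C z - h z) + (of_real (h z) - p z)"
          using C(2) by (auto simp: indicator_def)
        hence "(cmod (indicator B z - p z))\<^sup>2 \<le> 3 * ((cmod (indicator (B - C) z))\<^sup>2 
           + (cmod (of_real (indicator C z - h z)))\<^sup>2 + (cmod (of_real (h z) - p z))\<^sup>2)"
          using cmod_square_sum3 by metis
        moreover have "(cmod (indicator (B - C) z))\<^sup>2 = indicator (B - C) z" by (simp add: indicator_def)
        moreover have "(cmod (of_real (indicator C z - h z)))\<^sup>2 = (indicator C z - h z)\<^sup>2"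
          by (simp only: norm_of_real power2_abs)
        moreover have "(cmod (of_real (h z) - p z))\<^sup>2 \<le> s\<^sup>2"
          using p(2)[OF z] by (intro power_mono) auto
        moreover have "x \<le> 3 * (a' + b' + c')" if "x \<le> 3 * (a + b + c)" "a = a'" "b = b'" "c \<le> c'"
          for x a b c a' b' c' :: real using that by simp
        ultimately show "(cmod (indicator B z - p z))\<^sup>2 \<le> 3 * (indicator (B - C) z + (indicator C z - h z)\<^sup>2 + s\<^sup>2)"
          by blast
      qed
    qed
    also have "\<dots> = 3 * (measure M (B - C) + (LINT z|M. (indicator C z - h z)\<^sup>2) + s\<^sup>2 * measure M UNIV)"
      using i1 i2 i3 by (simp add: circle_measure_space[OF cm])
    also have "\<dots> < 3 * (d + d + s\<^sup>2 * m)"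
      using C(3)[OF that] h(3)[OF that] m(2)[OF that] s(1)
      by (intro mult_strict_left_mono add_less_le_mono add_strict_mono mult_left_mono) auto
    also have "\<dots> = e" unfolding s(2) by (simp add: d_def)
    finally show ?thesis .
  qed
  thus ?thesis using p(1) by blast
qed

end

section \<open>Spectral projections\<close>

lemma tendsto_norm_square_zero:
  fixes x :: "nat \<Rightarrow> 'a::real_normed_vector"
  assumes "\<And>n. (norm (x n - y))\<^sup>2 \<le> e n" and "e \<longlonglongrightarrow> 0"
  shows "x \<longlonglongrightarrow> y"
proof -
  have "(\<lambda>n. (norm (x n - y))\<^sup>2) \<longlonglongrightarrow> 0"
    by (rule real_tendsto_sandwich[OF _ _ tendsto_const assms(2)])
       (use assms(1) in \<open>auto intro!: always_eventually\<close>)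
  from tendsto_real_sqrt[OF this] have "(\<lambda>n. norm (x n - y)) \<longlonglongrightarrow> 0" by simp
  thus ?thesis using LIM_zero_iff tendsto_norm_zero_iff by blast
qed

text \<open>The pointwise bound |w| <= d + |w|^2 / d takes the place of the Cauchy-Schwarz
  inequality.\<close>

lemma l2_error_L1:
  assumes M: "circle_measure M" and B: "B \<in> sets borel" and p: "p \<in> borel_measurable borel"
    and K: "\<And>z. cmod z = 1 \<Longrightarrow> cmod (p z) \<le> K" and "d > 0"
  shows "cmod (of_real (measure M B) - (LINT z|M. p z)) \<le> d * measure M UNIV + l2_error M B p / d"
proof -
  note [measurable] = B p
  interpret finite_measure M using M by (simp add: circle_measure_def)
  have [measurable_cong]: "sets M = sets borel" using M by (simp add: circle_measure_def)
  define w where "w z = indicator B z - p z" for z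
  have wK: "cmod (w z) \<le> 1 + K" if "cmod z = 1" for z
    using norm_triangle_ineq4[of "indicator B z" "p z"] K[OF that]
    by (auto simp: w_def indicator_def)
  have [measurable]: "w \<in> borel_measurable borel" unfolding w_def by measurable
  have ip: "integrable M p" by (rule circle_measure_integrable[OF M p K])
  have iB: "integrable M (indicator B :: complex \<Rightarrow> complex)"
    by (rule circle_measure_integrable[OF M, of _ 1]) (auto simp: indicator_def)
  have iw: "integrable M w" by (rule circle_measure_integrable[OF M _ wK]) auto
  have iw2: "integrable M (\<lambda>z. (cmod (w z))\<^sup>2)"
    by (rule circle_measure_integrable[OF M, of _ "(1 + K)\<^sup>2"]) (auto intro!: power_mono wK)
  have "(LINT z|M. w z) = of_real (measure M B) - (LINT z|M. p z)"
  proof -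
    have "(LINT z|M. indicator B z :: complex) = (LINT z|M. of_real (indicator B z))"
      by (intro Bochner_Integration.integral_cong) (auto simp: indicator_def)
    thus ?thesis unfolding w_def using iB ip circle_measure_space[OF M] by simp
  qed
  hence "cmod (of_real (measure M B) - (LINT z|M. p z)) \<le> (LINT z|M. cmod (w z))"
    using integral_norm_bound[of M w] by simp
  also have "\<dots> \<le> (LINT z|M. d + (cmod (w z))\<^sup>2 / d)"
  proof (rule integral_mono)
    show "integrable M (\<lambda>z. cmod (w z))" using iw by simp
    show "integrable M (\<lambda>z. d + (cmod (w z))\<^sup>2 / d)" using iw2 by simp
    fix z
    have "0 \<le> (cmod (w z) - d)\<^sup>2 + cmod (w z) * d" using \<open>d > 0\<close> by simp
    also have "\<dots> = d\<^sup>2 + (cmod (w z))\<^sup>2 - cmod (w z) * d" by (simp add: power2_eq_square algebra_simps)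
    finally show "cmod (w z) \<le> d + (cmod (w z))\<^sup>2 / d" using \<open>d > 0\<close>
      by (simp add: field_simps power2_eq_square)
  qed
  also have "\<dots> = d * measure M UNIV + l2_error M B p / d"
    using iw2 by (simp add: circle_measure_space[OF M] l2_error_def w_def mult.commute)
  finally show ?thesis .
qed

lemma l2_error_tendsto:
  assumes M: "circle_measure M" and B: "B \<in> sets borel"
    and p: "\<And>n. p n \<in> borel_measurable borel" "\<And>n. \<exists>K. \<forall>z. cmod z = 1 \<longrightarrow> cmod (p n z) \<le> K"
    and lim: "(\<lambda>n. l2_error M B (p n)) \<longlonglongrightarrow> 0"
  shows "(\<lambda>n. LINT z|M. p n z) \<longlonglongrightarrow> of_real (measure M B)"
proof (rule LIMSEQ_I)
  fix e :: real assume e: "e > 0"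
  define d where "d = e / (2 * (measure M UNIV + 1))"
  have mp: "measure M UNIV + 1 > 0" by (simp add: add_nonneg_pos)
  hence d: "d > 0" using e by (simp add: d_def)
  have "d * measure M UNIV \<le> d * (measure M UNIV + 1)" using d by simp
  also have "\<dots> = e / 2" using mp by (simp add: d_def field_simps)
  finally have dM: "d * measure M UNIV \<le> e / 2" .
  from lim have "\<forall>\<^sub>F n in sequentially. l2_error M B (p n) < e / 2 * d"
    using d e by (intro order_tendstoD(2)) auto
  then obtain n0 where n0: "\<And>n. n \<ge> n0 \<Longrightarrow> l2_error M B (p n) < e / 2 * d"
    by (auto simp: eventually_sequentially)
  have "cmod ((LINT z|M. p n z) - of_real (measure M B)) < e" if "n \<ge> n0" for n
  proof -
    obtain K where "\<And>z. cmod z = 1 \<Longrightarrow> cmod (p n z) \<le> K" using p(2) by blast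
    from l2_error_L1[OF M B p(1) this d]
    have "cmod (of_real (measure M B) - (LINT z|M. p n z)) \<le> d * measure M UNIV + l2_error M B (p n) / d" .
    also have "l2_error M B (p n) / d < e / 2" using n0[OF that] d by (simp add: field_simps)
    finally show ?thesis using dM by (simp add: norm_minus_commute)
  qed
  thus "\<exists>n0. \<forall>n\<ge>n0. norm ((LINT z|M. p n z) - of_real (measure M B)) < e" by blast
qed

context unitary_pair
begin

text \<open>Any choice yields the same values on Borel sets, by
  \<open>circle_moments_unique\<close>.\<close>

definition spectral_measure :: "'a \<Rightarrow> complex measure" where
  "spectral_measure f = (SOME M. circle_moments M f)"

lemma spectral_measure_moments: "circle_moments (spectral_measure f) f"
  unfolding spectral_measure_def by (rule someI_ex[OF herglotz])

lemma spectral_measure_circle: "circle_measure (spectral_measure f)"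
  by (rule circle_moments_circle_measure[OF spectral_measure_moments])

lemma sets_spectral_measure [simp, measurable_cong]: "sets (spectral_measure f) = sets borel"
  using spectral_measure_circle by (simp add: circle_measure_def)

lemma space_spectral_measure [simp]: "space (spectral_measure f) = UNIV"
  by (rule circle_measure_space[OF spectral_measure_circle])

lemma finite_spectral_measure: "finite_measure (spectral_measure f)"
  using spectral_measure_circle by (simp add: circle_measure_def)

text \<open>Polynomials close to the indicator in L2 give vectors close to each other; this produces
  the Cauchy sequences that define the projections.\<close>

lemma trig_diff_error:
  assumes p: "trig p P" and q: "trig q Q" and B: "B \<in> sets borel"
  shows "(norm (P f - Q f))\<^sup>2 \<le> 2 * (l2_error (spectral_measure f) B p + l2_error (spectral_measure f) B q)"
proof -
  note i = l2_error_integrable[OF spectral_measure_circle _ B]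
  have "(norm (P f - Q f))\<^sup>2 = (LINT z|spectral_measure f. (cmod (p z - q z))\<^sup>2)"
    by (rule trig_norm[OF spectral_measure_moments trig_diff[OF p q]])
  also have "\<dots> \<le> (LINT z|spectral_measure f. 2 * ((cmod (indicator B z - p z))\<^sup>2 + (cmod (indicator B z - q z))\<^sup>2))"
  proof (rule integral_mono)
    obtain K where K: "\<And>z. cmod z = 1 \<Longrightarrow> cmod (p z - q z) \<le> K" using trig_bounded[OF trig_diff[OF p q]] by metis
    have [measurable]: "p \<in> borel_measurable borel" "q \<in> borel_measurable borel"
      using p q trig_measurable by auto
    show "integrable (spectral_measure f) (\<lambda>z. (cmod (p z - q z))\<^sup>2)"
      by (rule circle_measure_integrable[OF spectral_measure_circle, of _ "K\<^sup>2"]) (auto intro!: power_mono K)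
    show "integrable (spectral_measure f) (\<lambda>z. 2 * ((cmod (indicator B z - p z))\<^sup>2 + (cmod (indicator B z - q z))\<^sup>2))"
      using i[OF p] i[OF q] by simp
    fix z
    show "(cmod (p z - q z))\<^sup>2 \<le> 2 * ((cmod (indicator B z - p z))\<^sup>2 + (cmod (indicator B z - q z))\<^sup>2)"
      using norm_square_add_le[of "p z - indicator B z" "indicator B z - q z"]
      by (simp add: norm_minus_commute)
  qed
  also have "\<dots> = 2 * (l2_error (spectral_measure f) B p + l2_error (spectral_measure f) B q)"
    using i[OF p] i[OF q] by (simp add: l2_error_def)
  finally show ?thesis .
qed

text \<open>One sequence for finitely many vectors: identities that relate projections of different
  vectors then follow from the same identities for polynomials of U.\<close>

lemma trig_seq:
  assumes "finite F" and B: "B \<in> sets borel"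
  obtains p P where "\<And>n. trig (p n) (P n)" and "\<And>f. f \<in> F \<Longrightarrow> (\<lambda>n. l2_error (spectral_measure f) B (p n)) \<longlonglongrightarrow> 0"
proof -
  have "\<exists>p P. trig p P \<and> (\<forall>f\<in>F. l2_error (spectral_measure f) B p < 1 / real (Suc n))" for n
  proof -
    have "\<exists>p P. trig p P \<and> (\<forall>M\<in>spectral_measure ` F. l2_error M B p < 1 / real (Suc n))"
      by (rule trig_dense) (use assms spectral_measure_circle in auto)
    thus ?thesis by auto
  qed
  then obtain p P where p: "\<And>n. trig (p n) (P n)"
      "\<And>n f. f \<in> F \<Longrightarrow> l2_error (spectral_measure f) B (p n) < 1 / real (Suc n)" by metis
  have "(\<lambda>n. l2_error (spectral_measure f) B (p n)) \<longlonglongrightarrow> 0" if "f \<in> F" for f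
    by (rule real_tendsto_sandwich[OF _ _ tendsto_const LIMSEQ_Suc[OF lim_const_over_n[of 1]]])
       (use p(2)[OF that] in \<open>auto intro!: always_eventually less_imp_le\<close>)
  thus ?thesis using p(1) that by blast
qed

text \<open>\<open>spectral_proj B f\<close> is the limit of \<open>p(U) f\<close> as the trigonometric polynomials \<open>p\<close> tend to the
  indicator of \<open>B\<close> in \<open>L\<^sup>2\<close> of the spectral measure of \<open>f\<close>. The exact identity holds without the
  factor 2; the slack saves the continuity of the \<open>L\<^sup>2\<close> norm.\<close>

definition spectral_proj :: "complex set \<Rightarrow> 'a \<Rightarrow> 'a" where
  "spectral_proj B f = (THE g. \<forall>p P. trig p P \<longrightarrow> (norm (g - P f))\<^sup>2 \<le> 2 * l2_error (spectral_measure f) B p)"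

text \<open>The inequality in the definition has exactly one solution. The limit of a Cauchy
  sequence \<open>Q n f\<close> satisfies it, and any other solution is also a limit of that
  sequence.\<close>

lemma spectral_proj_error:
  assumes B: "B \<in> sets borel" and p: "trig p P"
  shows "(norm (spectral_proj B f - P f))\<^sup>2 \<le> 2 * l2_error (spectral_measure f) B p"
proof -
  let ?Q = "\<lambda>g. \<forall>p P. trig p P \<longrightarrow> (norm (g - P f))\<^sup>2 \<le> 2 * l2_error (spectral_measure f) B p"
  obtain q Q where q: "\<And>n. trig (q n) (Q n)" and lim: "(\<lambda>n. l2_error (spectral_measure f) B (q n)) \<longlonglongrightarrow> 0"
    using trig_seq[of "{f}" B] B by auto
  have "Cauchy (\<lambda>n. Q n f)"
  proof (rule metric_CauchyI)
    fix e :: real assume e: "e > 0"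
    have "\<forall>\<^sub>F n in sequentially. l2_error (spectral_measure f) B (q n) < e\<^sup>2 / 4"
      using lim e by (intro order_tendstoD(2)) auto
    then obtain n0 where n0: "\<And>n. n \<ge> n0 \<Longrightarrow> l2_error (spectral_measure f) B (q n) < e\<^sup>2 / 4"
      by (auto simp: eventually_sequentially)
    have "dist (Q m f) (Q n f) < e" if "m \<ge> n0" "n \<ge> n0" for m n
    proof -
      have "(dist (Q m f) (Q n f))\<^sup>2 < e\<^sup>2"
        using trig_diff_error[OF q[of m] q[of n] B, of f] n0[OF that(1)] n0[OF that(2)]
        by (simp add: dist_norm)
      thus ?thesis using e by (simp add: power_less_imp_less_base)
    qed
    thus "\<exists>n0. \<forall>m\<ge>n0. \<forall>n\<ge>n0. dist (Q m f) (Q n f) < e" by blast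
  qed
  then obtain g where g: "(\<lambda>n. Q n f) \<longlonglongrightarrow> g" using Cauchy_convergent convergent_def by blast
  have "?Q g"
  proof (intro allI impI)
    fix p P assume p: "trig p P"
    show "(norm (g - P f))\<^sup>2 \<le> 2 * l2_error (spectral_measure f) B p"
    proof (rule LIMSEQ_le)
      show "(\<lambda>n. (norm (Q n f - P f))\<^sup>2) \<longlonglongrightarrow> (norm (g - P f))\<^sup>2" by (intro tendsto_intros g)
      have "(\<lambda>n. 2 * (l2_error (spectral_measure f) B (q n) + l2_error (spectral_measure f) B p))
          \<longlonglongrightarrow> 2 * (0 + l2_error (spectral_measure f) B p)"
        by (intro tendsto_intros lim)
      thus "(\<lambda>n. 2 * (l2_error (spectral_measure f) B (q n) + l2_error (spectral_measure f) B p))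
          \<longlonglongrightarrow> 2 * l2_error (spectral_measure f) B p" by simp
      show "\<exists>N. \<forall>n\<ge>N. (norm (Q n f - P f))\<^sup>2 \<le> 2 * (l2_error (spectral_measure f) B (q n) + l2_error (spectral_measure f) B p)"
        using trig_diff_error[OF q p B] by blast
    qed
  qed
  moreover have "g' = g" if "?Q g'" for g'
  proof (rule LIMSEQ_unique[OF _ g])
    show "(\<lambda>n. Q n f) \<longlonglongrightarrow> g'"
    proof (rule tendsto_norm_square_zero)
      show "(norm (Q n f - g'))\<^sup>2 \<le> 2 * l2_error (spectral_measure f) B (q n)" for n
        using that q by (metis norm_minus_commute)
      show "(\<lambda>n. 2 * l2_error (spectral_measure f) B (q n)) \<longlonglongrightarrow> 0"
        using tendsto_mult[OF tendsto_const[of 2] lim] by simp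
    qed
  qed
  ultimately have "?Q (spectral_proj B f)" unfolding spectral_proj_def by (rule theI[where P = ?Q])
  thus ?thesis using p by blast
qed

lemma spectral_proj_tendsto:
  assumes B: "B \<in> sets borel" and p: "\<And>n. trig (p n) (P n)"
    and lim: "(\<lambda>n. l2_error (spectral_measure f) B (p n)) \<longlonglongrightarrow> 0"
  shows "(\<lambda>n. P n f) \<longlonglongrightarrow> spectral_proj B f"
proof (rule tendsto_norm_square_zero)
  show "(norm (P n f - spectral_proj B f))\<^sup>2 \<le> 2 * l2_error (spectral_measure f) B (p n)" for n
    using spectral_proj_error[OF B p] by (simp add: norm_minus_commute)
  show "(\<lambda>n. 2 * l2_error (spectral_measure f) B (p n)) \<longlonglongrightarrow> 0"
    using tendsto_mult[OF tendsto_const[of 2] lim] by simp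
qed

lemma spectral_proj_seq:
  assumes "finite F" and B: "B \<in> sets borel"
  shows "\<exists>p P. (\<forall>n. trig (p n) (P n)) \<and> (\<forall>f\<in>F. (\<lambda>n. P n f) \<longlonglongrightarrow> spectral_proj B f) \<and>
    (\<forall>f\<in>F. (\<lambda>n. l2_error (spectral_measure f) B (p n)) \<longlonglongrightarrow> 0)"
proof -
  obtain p P where "\<And>n. trig (p n) (P n)"
      and "\<And>f. f \<in> F \<Longrightarrow> (\<lambda>n. l2_error (spectral_measure f) B (p n)) \<longlonglongrightarrow> 0"
    using trig_seq[OF assms] by blast
  thus ?thesis using spectral_proj_tendsto[OF B] by (intro exI[of _ p] exI[of _ P]) blast
qed

text \<open>Each projected vector is defined through its own spectral measure, so additivity
  requires one sequence that approximates the indicator for f, g and f + g simultaneously.\<close>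

lemma spectral_proj_add:
  assumes B: "B \<in> sets borel"
  shows "spectral_proj B (f + g) = spectral_proj B f + spectral_proj B g"
proof -
  obtain p P where p: "\<And>n. trig (p n) (P n)" and
    l: "\<And>h. h \<in> {f, g, f + g} \<Longrightarrow> (\<lambda>n. P n h) \<longlonglongrightarrow> spectral_proj B h"
    using spectral_proj_seq[OF finite.insertI[OF finite.insertI[OF finite.insertI[OF finite.emptyI]]] B, of "f + g" "g" "f"]
    by blast
  have "(\<lambda>n. P n f + P n g) \<longlonglongrightarrow> spectral_proj B f + spectral_proj B g" by (intro tendsto_add l) auto
  hence "(\<lambda>n. P n (f + g)) \<longlonglongrightarrow> spectral_proj B f + spectral_proj B g" by (simp add: trig_additive[OF p])
  thus ?thesis using l[of "f + g"] LIMSEQ_unique by blast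
qed

lemma trig_commute:
  assumes W: "\<And>x y. W (x - y) = W x - W y" "\<And>c x. W (c *\<^sub>C x) = c *\<^sub>C W x"
    and WU: "\<And>x. W (U x) = U (W x)" and "trig p P"
  shows "W (P x) = P (W x)"
proof -
  have WV: "W (V x) = V (W x)" for x by (metis UV VU WU)
  have WUn: "W ((U ^^ n) x) = (U ^^ n) (W x)" and WVn: "W ((V ^^ n) x) = (V ^^ n) (W x)" for n x
    by (induction n) (simp_all add: WU WV)
  have Wadd: "W (x + y) = W x + W y" for x y
    using W(1)[of "x + y" y] by (simp add: algebra_simps)
  show ?thesis
    using assms(4) by (induction rule: trig.induct) (simp_all add: WUn WVn W Wadd)
qed

text \<open>W is any bounded linear operator commuting with U. It will be a scalar, U itself, the
  shift T, a polynomial of U, or a spectral projection of the other operator.\<close>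

lemma spectral_proj_commute:
  assumes B: "B \<in> sets borel"
    and W: "\<And>x y. W (x - y) = W x - W y" "\<And>c x. W (c *\<^sub>C x) = c *\<^sub>C W x" "\<And>x. norm (W x) \<le> K * norm x"
    and WU: "\<And>x. W (U x) = U (W x)"
  shows "W (spectral_proj B f) = spectral_proj B (W f)"
proof -
  note WP = trig_commute[OF W(1,2) WU]
  obtain p P where p: "\<And>n. trig (p n) (P n)" and
    l: "\<And>h. h \<in> {f, W f} \<Longrightarrow> (\<lambda>n. P n h) \<longlonglongrightarrow> spectral_proj B h"
    using spectral_proj_seq[OF finite.insertI[OF finite.insertI[OF finite.emptyI]] B, of "W f" "f"]
    by blast
  have "(\<lambda>n. W (P n f)) \<longlonglongrightarrow> W (spectral_proj B f)"
  proof (rule tendsto_norm_square_zero)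
    show "(norm (W (P n f) - W (spectral_proj B f)))\<^sup>2 \<le> (K * norm (P n f - spectral_proj B f))\<^sup>2" for n
      using W(3)[of "P n f - spectral_proj B f"] by (intro power_mono) (auto simp: W(1))
    have "(\<lambda>n. norm (P n f - spectral_proj B f)) \<longlonglongrightarrow> 0"
      using l[of f] by (simp add: tendsto_norm_zero_iff LIM_zero_iff)
    from tendsto_power[OF tendsto_mult[OF tendsto_const[of K] this], of 2]
    show "(\<lambda>n. (K * norm (P n f - spectral_proj B f))\<^sup>2) \<longlonglongrightarrow> 0" by simp
  qed
  hence "(\<lambda>n. P n (W f)) \<longlonglongrightarrow> W (spectral_proj B f)" by (simp add: WP[OF p])
  thus ?thesis using l[of "W f"] LIMSEQ_unique by blast
qed

lemma spectral_proj_scaleC: "B \<in> sets borel \<Longrightarrow> spectral_proj B (c *\<^sub>C f) = c *\<^sub>C spectral_proj B f"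
  using spectral_proj_commute[of B "\<lambda>x. c *\<^sub>C x" "cmod c" f]
  by (simp add: scaleC_diff_right scaleC_scaleC mult.commute norm_scaleC U_scaleC)

lemma spectral_proj_diff: "B \<in> sets borel \<Longrightarrow> spectral_proj B (f - g) = spectral_proj B f - spectral_proj B g"
  using spectral_proj_add[of B "f - g" g] by (simp add: algebra_simps)

lemma spectral_proj_zero [simp]: "B \<in> sets borel \<Longrightarrow> spectral_proj B 0 = 0"
  using spectral_proj_diff[of B 0 0] by simp

text \<open>The indicator is real, so the conjugate polynomials approximate it equally well, and
  they belong to the adjoint operators.\<close>

lemma spectral_proj_self_adjoint:
  assumes B: "B \<in> sets borel"
  shows "cinner (spectral_proj B f) g = cinner f (spectral_proj B g)"
proof -
  obtain p P where p: "\<And>n. trig (p n) (P n)" and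
    l: "\<And>h. h \<in> {f, g} \<Longrightarrow> (\<lambda>n. P n h) \<longlonglongrightarrow> spectral_proj B h" and
    e: "\<And>h. h \<in> {f, g} \<Longrightarrow> (\<lambda>n. l2_error (spectral_measure h) B (p n)) \<longlonglongrightarrow> 0"
    using spectral_proj_seq[OF finite.insertI[OF finite.insertI[OF finite.emptyI]] B, of "g" "f"]
    by blast
  have "\<exists>Q. trig (\<lambda>z. cnj (p n z)) Q \<and> (\<forall>x y. cinner (P n x) y = cinner x (Q y))" for n
    by (rule trig_adjoint[OF p[of n]]) blast
  then obtain Q where Q: "\<And>n. trig (\<lambda>z. cnj (p n z)) (Q n)" "\<And>n x y. cinner (P n x) y = cinner x (Q n y)"
    by metis
  have "cmod (indicator B z - cnj (p n z)) = cmod (indicator B z - p n z)" for n z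
  proof -
    have "indicator B z - cnj (p n z) = cnj (indicator B z - p n z)" by (simp add: indicator_def)
    thus ?thesis by (simp only: complex_mod_cnj)
  qed
  hence "(\<lambda>n. l2_error (spectral_measure g) B (\<lambda>z. cnj (p n z))) \<longlonglongrightarrow> 0"
    using e[of g] by (simp add: l2_error_def)
  from spectral_proj_tendsto[OF B Q(1) this] have "(\<lambda>n. Q n g) \<longlonglongrightarrow> spectral_proj B g" .
  hence "(\<lambda>n. cinner f (Q n g)) \<longlonglongrightarrow> cinner f (spectral_proj B g)" by (intro tendsto_intros)
  moreover have "(\<lambda>n. cinner (P n f) g) \<longlonglongrightarrow> cinner (spectral_proj B f) g" by (intro tendsto_intros l) auto
  ultimately show ?thesis unfolding Q(2) using LIMSEQ_unique by blast
qed

lemma cinner_spectral_proj: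
  assumes B: "B \<in> sets borel"
  shows "cinner f (spectral_proj B f) = of_real (measure (spectral_measure f) B)"
proof -
  obtain p P where p: "\<And>n. trig (p n) (P n)" and
    l: "\<And>h. h \<in> {f} \<Longrightarrow> (\<lambda>n. P n h) \<longlonglongrightarrow> spectral_proj B h" and
    e: "\<And>h. h \<in> {f} \<Longrightarrow> (\<lambda>n. l2_error (spectral_measure h) B (p n)) \<longlonglongrightarrow> 0"
    using spectral_proj_seq[OF finite.insertI[OF finite.emptyI] B, of "f"]
    by blast
  have b: "\<exists>K. \<forall>z. cmod z = 1 \<longrightarrow> cmod (p n z) \<le> K" for n using trig_bounded[OF p] by metis
  have "(\<lambda>n. LINT z|spectral_measure f. p n z) \<longlonglongrightarrow> of_real (measure (spectral_measure f) B)"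
    by (rule l2_error_tendsto[OF spectral_measure_circle B trig_measurable[OF p] b e]) simp
  moreover have "(\<lambda>n. cinner f (P n f)) \<longlonglongrightarrow> cinner f (spectral_proj B f)" by (intro tendsto_intros l) auto
  ultimately show ?thesis unfolding trig_integral[OF spectral_measure_moments p] using LIMSEQ_unique by blast
qed

text \<open>A common sequence of polynomials approximates the indicator for both measures, and its
  integrals are fixed by the moments. This later identifies the spectral measure of the
  shift.\<close>

lemma circle_moments_unique:
  assumes M: "circle_moments M f" and B: "B \<in> sets borel"
  shows "measure M B = measure (spectral_measure f) B"
proof -
  have cM: "circle_measure M" by (rule circle_moments_circle_measure[OF M])
  have "\<exists>p P. trig p P \<and> (\<forall>N\<in>{M, spectral_measure f}. l2_error N B p < 1 / real (Suc n))" for n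
    by (rule trig_dense) (use B cM spectral_measure_circle in auto)
  then obtain p P where p: "\<And>n. trig (p n) (P n)"
      "\<And>n N. N \<in> {M, spectral_measure f} \<Longrightarrow> l2_error N B (p n) < 1 / real (Suc n)" by metis
  have e: "(\<lambda>n. l2_error N B (p n)) \<longlonglongrightarrow> 0" if "N \<in> {M, spectral_measure f}" for N
    by (rule real_tendsto_sandwich[OF _ _ tendsto_const LIMSEQ_Suc[OF lim_const_over_n[of 1]]])
       (use p(2)[OF that] in \<open>auto intro!: always_eventually less_imp_le\<close>)
  have b: "\<exists>K. \<forall>z. cmod z = 1 \<longrightarrow> cmod (p n z) \<le> K" for n using trig_bounded[OF p(1)] by metis
  have "(\<lambda>n. LINT z|M. p n z) \<longlonglongrightarrow> of_real (measure M B)"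
    by (rule l2_error_tendsto[OF cM B trig_measurable[OF p(1)] b e]) simp
  moreover have "(\<lambda>n. LINT z|spectral_measure f. p n z) \<longlonglongrightarrow> of_real (measure (spectral_measure f) B)"
    by (rule l2_error_tendsto[OF spectral_measure_circle B trig_measurable[OF p(1)] b e]) simp
  ultimately have "complex_of_real (measure M B) = of_real (measure (spectral_measure f) B)"
    unfolding trig_integral[OF M p(1)] trig_integral[OF spectral_measure_moments p(1)] by (rule LIMSEQ_unique)
  thus ?thesis using of_real_eq_iff by blast
qed

text \<open>Rests on the splitting 1_A 1_B - p q = 1_B (1_A - p) + p (1_B - q).\<close>

lemma l2_error_mult:
  assumes A: "A \<in> sets borel" and B: "B \<in> sets borel" and p: "trig p P" and q: "trig q Q"
    and K: "\<And>z. cmod z = 1 \<Longrightarrow> cmod (p z) \<le> K"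
  shows "l2_error (spectral_measure f) (A \<inter> B) (\<lambda>z. p z * q z) \<le>
     2 * (l2_error (spectral_measure f) A p + K\<^sup>2 * l2_error (spectral_measure f) B q)"
proof -
  note i = l2_error_integrable[OF spectral_measure_circle]
  have "l2_error (spectral_measure f) (A \<inter> B) (\<lambda>z. p z * q z) \<le>
     (LINT z|spectral_measure f. 2 * ((cmod (indicator A z - p z))\<^sup>2 + K\<^sup>2 * (cmod (indicator B z - q z))\<^sup>2))"
    unfolding l2_error_def
  proof (rule integral_mono_AE)
    show "integrable (spectral_measure f) (\<lambda>z. (cmod (indicator (A \<inter> B) z - p z * q z))\<^sup>2)"
      by (rule i[OF trig_mult[OF p q]]) (use A B in auto)
    show "integrable (spectral_measure f) (\<lambda>z. 2 * ((cmod (indicator A z - p z))\<^sup>2 + K\<^sup>2 * (cmod (indicator B z - q z))\<^sup>2))"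
      using i[OF p A] i[OF q B] by simp
    have "AE z in spectral_measure f. cmod z = 1" using spectral_measure_circle by (simp add: circle_measure_def)
    thus "AE z in spectral_measure f. (cmod (indicator (A \<inter> B) z - p z * q z))\<^sup>2 \<le>
        2 * ((cmod (indicator A z - p z))\<^sup>2 + K\<^sup>2 * (cmod (indicator B z - q z))\<^sup>2)"
    proof eventually_elim
      fix z :: complex assume z: "cmod z = 1"
      have "indicator (A \<inter> B) z - p z * q z = indicator B z * (indicator A z - p z) + p z * (indicator B z - q z)"
        by (simp add: indicator_def algebra_simps)
      hence "(cmod (indicator (A \<inter> B) z - p z * q z))\<^sup>2 \<le>
          2 * ((cmod (indicator B z * (indicator A z - p z)))\<^sup>2 + (cmod (p z * (indicator B z - q z)))\<^sup>2)"
        by (simp only: norm_square_add_le)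
      also have "\<dots> \<le> 2 * ((cmod (indicator A z - p z))\<^sup>2 + (K * cmod (indicator B z - q z))\<^sup>2)"
        using K[OF z]
        by (intro mult_left_mono add_mono power_mono)
           (auto simp: norm_mult indicator_def intro!: mult_right_mono)
      finally show "(cmod (indicator (A \<inter> B) z - p z * q z))\<^sup>2 \<le>
        2 * ((cmod (indicator A z - p z))\<^sup>2 + K\<^sup>2 * (cmod (indicator B z - q z))\<^sup>2)"
        by (simp add: power_mult_distrib)
    qed
  qed
  also have "\<dots> = 2 * (l2_error (spectral_measure f) A p + K\<^sup>2 * l2_error (spectral_measure f) B q)"
    using i[OF p A] i[OF q B] by (simp add: l2_error_def)
  finally show ?thesis .
qed

text \<open>The order of choices matters: p is chosen first, for the spectral measures of both f and
  \<open>spectral_proj B f\<close>; q is chosen afterwards, with an error that compensates the bound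
  K of p.\<close>

lemma spectral_proj_mult:
  assumes A: "A \<in> sets borel" and B: "B \<in> sets borel"
  shows "spectral_proj A (spectral_proj B f) = spectral_proj (A \<inter> B) f"
proof -
  define g where "g = spectral_proj B f"
  have AB: "A \<inter> B \<in> sets borel" using A B by auto
  have *: "(norm (spectral_proj A g - spectral_proj (A \<inter> B) f))\<^sup>2 \<le> e" if e: "e > 0" for e
  proof -
    \<comment> \<open>The two triangle inequalities at the end give 2 (2 d + 2 (2 d + 8 d)) = 44
      d.\<close>
    define d where "d = e / 44"
    have d: "d > 0" using e by (simp add: d_def)
    obtain p P where p: "trig p P" and ep: "\<And>M. M \<in> {spectral_measure f, spectral_measure g} \<Longrightarrow> l2_error M A p < d"
      using trig_dense[of "{spectral_measure f, spectral_measure g}" A d] A d spectral_measure_circle by auto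
    obtain K where K: "K \<ge> 0" "\<And>z. cmod z = 1 \<Longrightarrow> cmod (p z) \<le> K" "\<And>x. norm (P x) \<le> K * norm x"
      using trig_bounded[OF p] by metis
    obtain q Q where q: "trig q Q" and eq: "\<And>M. M \<in> {spectral_measure f} \<Longrightarrow> l2_error M B q < d / (K\<^sup>2 + 1)"
      using trig_dense[of "{spectral_measure f}" B "d / (K\<^sup>2 + 1)"] B d spectral_measure_circle
      by (auto simp: add_nonneg_pos)
    have Kd: "K\<^sup>2 * l2_error (spectral_measure f) B q \<le> d"
    proof -
      have "K\<^sup>2 * l2_error (spectral_measure f) B q \<le> (K\<^sup>2 + 1) * l2_error (spectral_measure f) B q"
        by (intro mult_right_mono) auto
      also have "\<dots> \<le> (K\<^sup>2 + 1) * (d / (K\<^sup>2 + 1))"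
        using eq[of "spectral_measure f"] by (intro mult_left_mono) (auto simp: add_nonneg_nonneg)
      also have "\<dots> = d" by (simp add: add_nonneg_eq_0_iff)
      finally show ?thesis .
    qed
    have "(norm (spectral_proj A g - P g))\<^sup>2 \<le> 2 * d"
      using spectral_proj_error[OF A p, of g] ep[of "spectral_measure g"] by simp
    moreover have "(norm (P g - P (Q f)))\<^sup>2 \<le> 2 * d"
    proof -
      have "norm (P g - P (Q f)) \<le> K * norm (g - Q f)"
        using K(3)[of "g - Q f"] by (simp add: trig_diff_right[OF p])
      hence "(norm (P g - P (Q f)))\<^sup>2 \<le> K\<^sup>2 * (norm (g - Q f))\<^sup>2"
        using power_mono[of "norm (P g - P (Q f))" "K * norm (g - Q f)" 2] by (simp add: power_mult_distrib)
      also have "\<dots> \<le> K\<^sup>2 * (2 * l2_error (spectral_measure f) B q)"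
        unfolding g_def by (intro mult_left_mono spectral_proj_error[OF B q]) auto
      finally show ?thesis using Kd by simp
    qed
    moreover have "(norm (P (Q f) - spectral_proj (A \<inter> B) f))\<^sup>2 \<le> 8 * d"
    proof -
      have "(norm (spectral_proj (A \<inter> B) f - P (Q f)))\<^sup>2 \<le> 2 * l2_error (spectral_measure f) (A \<inter> B) (\<lambda>z. p z * q z)"
        by (rule spectral_proj_error[OF AB trig_mult[OF p q]])
      also have "\<dots> \<le> 2 * (2 * (l2_error (spectral_measure f) A p + K\<^sup>2 * l2_error (spectral_measure f) B q))"
        by (intro mult_left_mono l2_error_mult[OF A B p q K(2)]) auto
      also have "\<dots> \<le> 8 * d" using Kd ep[of "spectral_measure f"] by simp
      finally show ?thesis by (simp add: norm_minus_commute)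
    qed
    moreover have "(norm (spectral_proj A g - spectral_proj (A \<inter> B) f))\<^sup>2 \<le>
        2 * ((norm (spectral_proj A g - P g))\<^sup>2 + (norm (P g - spectral_proj (A \<inter> B) f))\<^sup>2)"
      using norm_square_add_le[of "spectral_proj A g - P g" "P g - spectral_proj (A \<inter> B) f"] by simp
    moreover have "(norm (P g - spectral_proj (A \<inter> B) f))\<^sup>2 \<le>
        2 * ((norm (P g - P (Q f)))\<^sup>2 + (norm (P (Q f) - spectral_proj (A \<inter> B) f))\<^sup>2)"
      using norm_square_add_le[of "P g - P (Q f)" "P (Q f) - spectral_proj (A \<inter> B) f"] by simp
    moreover have "x \<le> e" if "a \<le> 2 * d" "b \<le> 2 * d" "c \<le> 8 * d" "x \<le> 2 * (a + y)" "y \<le> 2 * (b + c)"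
      for a b c x y :: real using that unfolding d_def by argo
    ultimately show ?thesis by blast
  qed
  have "(norm (spectral_proj A g - spectral_proj (A \<inter> B) f))\<^sup>2 \<le> 0" by (rule field_le_epsilon) (use * in simp)
  thus ?thesis by (simp add: g_def)
qed

lemma norm_spectral_proj:
  assumes "B \<in> sets borel"
  shows "(norm (spectral_proj B f))\<^sup>2 = measure (spectral_measure f) B"
proof -
  have "complex_of_real ((norm (spectral_proj B f))\<^sup>2) = cinner (spectral_proj B f) (spectral_proj B f)"
    by (simp only: cinner_self)
  also have "\<dots> = cinner f (spectral_proj B f)"
    by (simp add: spectral_proj_self_adjoint[OF assms] spectral_proj_mult assms)
  finally have "complex_of_real ((norm (spectral_proj B f))\<^sup>2) = cinner f (spectral_proj B f)" .
  thus ?thesis unfolding cinner_spectral_proj[OF assms] using of_real_eq_iff by blast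
qed

lemma spectral_proj_U: "B \<in> sets borel \<Longrightarrow> spectral_proj B (U x) = U (spectral_proj B x)"
  by (rule spectral_proj_commute[of B U 1, symmetric])
     (auto simp: U_diff U_scaleC U_norm)

lemma measure_spectral_measure_UNIV: "measure (spectral_measure f) UNIV = (norm f)\<^sup>2"
proof -
  have "\<forall>n. (LINT z|spectral_measure f. z ^ n) = cinner f ((U ^^ n) f)"
    using spectral_measure_moments[of f] unfolding circle_moments_def by blast
  from spec[OF this, of 0] have "cinner f f = (LINT z|spectral_measure f. z ^ 0)" by simp
  also have "\<dots> = of_real (measure (spectral_measure f) UNIV)" by (simp add: scaleR_conv_of_real)
  finally show ?thesis unfolding cinner_self using of_real_eq_iff by metis
qed

lemma spectral_proj_UNIV: "spectral_proj UNIV f = f"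
proof -
  have "(norm (spectral_proj UNIV f - 1 *\<^sub>C f))\<^sup>2 \<le> 2 * l2_error (spectral_measure f) UNIV (\<lambda>_. 1)"
    by (rule spectral_proj_error[OF _ trig_const]) simp
  thus ?thesis by (simp add: l2_error_def)
qed

section \<open>Norm bounds on spectral subspaces\<close>

lemma AE_spectral_measure_spectral_proj:
  assumes B: "B \<in> sets borel" and h: "spectral_proj B h = h"
  shows "AE z in spectral_measure h. z \<in> B \<and> cmod z = 1"
proof -
  interpret finite_measure "spectral_measure h" by (rule finite_spectral_measure)
  have "spectral_proj (- B) h = spectral_proj (- B \<inter> B) h" using spectral_proj_mult[of "- B" B h] B h by simp
  hence "norm (spectral_proj (- B) h) = 0" using norm_spectral_proj[of "{}" h] by simp
  hence "measure (spectral_measure h) (- B) = 0" using norm_spectral_proj[of "- B" h] B by simp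
  hence "AE z in spectral_measure h. z \<in> B"
    using B by (intro AE_I'[of "- B"]) (auto simp: null_sets_def emeasure_eq_measure)
  moreover have "AE z in spectral_measure h. cmod z = 1" using spectral_measure_circle by (simp add: circle_measure_def)
  ultimately show ?thesis by eventually_elim simp
qed

lemma trig_norm_square_integrable:
  assumes p: "trig p P"
  shows "integrable (spectral_measure h) (\<lambda>z. (cmod (p z))\<^sup>2)"
proof -
  obtain K where K: "\<And>z. cmod z = 1 \<Longrightarrow> cmod (p z) \<le> K" using trig_bounded[OF p] by metis
  have [measurable]: "p \<in> borel_measurable borel" using p trig_measurable by auto
  show ?thesis
    by (rule circle_measure_integrable[OF spectral_measure_circle, of _ "K\<^sup>2"]) (auto intro!: power_mono K)
qed

text \<open>The spectral measure of a vector in the range of the projection is carried by B, so only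
  the values of p on B count. This localises the crude bound of \<open>trig_bounded\<close>.\<close>

lemma trig_norm_spectral_proj_le:
  assumes B: "B \<in> sets borel" and p: "trig p P" and h: "spectral_proj B h = h"
    and c: "\<And>z. z \<in> B \<Longrightarrow> cmod z = 1 \<Longrightarrow> cmod (p z) \<le> c" and "c \<ge> 0"
  shows "norm (P h) \<le> c * norm h"
proof -
  interpret finite_measure "spectral_measure h" by (rule finite_spectral_measure)
  have "(norm (P h))\<^sup>2 = (LINT z|spectral_measure h. (cmod (p z))\<^sup>2)" by (rule trig_norm[OF spectral_measure_moments p])
  also have "\<dots> \<le> (LINT z|spectral_measure h. c\<^sup>2)"
  proof (rule integral_mono_AE[OF trig_norm_square_integrable[OF p]])
    show "AE z in spectral_measure h. (cmod (p z))\<^sup>2 \<le> c\<^sup>2"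
      using AE_spectral_measure_spectral_proj[OF B h] by eventually_elim (intro power_mono c, auto)
  qed simp
  also have "\<dots> = (c * norm h)\<^sup>2"
    using measure_spectral_measure_UNIV[of h] by (simp add: power_mult_distrib)
  finally show ?thesis by (rule power2_le_imp_le) (use \<open>c \<ge> 0\<close> in simp)
qed

lemma trig_norm_spectral_proj_ge:
  assumes B: "B \<in> sets borel" and p: "trig p P" and h: "spectral_proj B h = h"
    and c: "\<And>z. z \<in> B \<Longrightarrow> cmod z = 1 \<Longrightarrow> c \<le> cmod (p z)" and "c \<ge> 0"
  shows "c * norm h \<le> norm (P h)"
proof -
  interpret finite_measure "spectral_measure h" by (rule finite_spectral_measure)
  have "(c * norm h)\<^sup>2 = (LINT z|spectral_measure h. c\<^sup>2)"
    using measure_spectral_measure_UNIV[of h] by (simp add: power_mult_distrib)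
  also have "\<dots> \<le> (LINT z|spectral_measure h. (cmod (p z))\<^sup>2)"
  proof (rule integral_mono_AE[OF _ trig_norm_square_integrable[OF p]])
    show "AE z in spectral_measure h. c\<^sup>2 \<le> (cmod (p z))\<^sup>2"
      using AE_spectral_measure_spectral_proj[OF B h] by eventually_elim (intro power_mono c, auto simp: \<open>c \<ge> 0\<close>)
  qed simp
  also have "\<dots> = (norm (P h))\<^sup>2" by (rule trig_norm[OF spectral_measure_moments p, symmetric])
  finally show ?thesis by (rule power2_le_imp_le) simp
qed

lemma norm_spectral_proj_le:
  assumes "B \<in> sets borel"
  shows "norm (spectral_proj B f) \<le> norm f"
proof -
  interpret finite_measure "spectral_measure f" by (rule finite_spectral_measure)
  have "(norm (spectral_proj B f))\<^sup>2 \<le> (norm f)\<^sup>2"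
    using measure_spectral_measure_UNIV[of f] norm_spectral_proj[OF assms, of f] finite_measure_mono[of B UNIV] assms
    by simp
  thus ?thesis by (rule power2_le_imp_le) simp
qed

end

section \<open>Unitary operators tied to a second one by a quadratic relation\<close>

lemma (in unitary_pair) trig_cis_differentiable:
  "trig p P \<Longrightarrow> (\<lambda>x. p (cis x)) differentiable at x"
proof (induction rule: trig.induct)
  case (trig_monom c m n)
  have "(\<lambda>x. c * (cis (- (real m * x)) * cis (real n * x))) differentiable at x"
    using cis_has_vector_derivative[of "- real m" x UNIV] cis_has_vector_derivative[of "real n" x UNIV]
    by (auto intro!: derivative_intros differentiableI_vector)
  thus ?case by (simp add: cis_cnj Complex.DeMoivre)
next
  case (trig_add p P q Q)
  thus ?case by (intro differentiable_add)
qed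

text \<open>Away from |g| = 1 the solutions y are differentiable functions of x, and such functions
  map null sets to null sets. Where |g| >= 1, a solution forces cos (y - h) to be 1 or -1, which
  leaves countably many y.\<close>

lemma negligible_quadratic_phase:
  fixes d :: "real \<Rightarrow> complex"
  assumes d: "\<And>x. d differentiable at x" and X: "negligible X" and \<delta>: "cmod \<delta> = 1"
  shows "negligible {y :: real. \<exists>x\<in>X. (cis y)\<^sup>2 - d x * cis y + \<delta> = 0}"
proof -
  \<comment> \<open>Half the argument of \<delta>: multiplication by \<open>cis (- y - h)\<close>
    makes the first and the last term of the quadratic conjugate to each other, so its real part is
    2 cos (y - h) - 2 g x.\<close>
  define h where "h = Arg \<delta> / 2"
  have \<delta>h: "\<delta> = cis (2 * h)" using \<delta> by (simp add: h_def cis_Arg_unique rcis_cmod_Arg[of \<delta>, unfolded rcis_def \<delta>, simplified])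
  define g where "g x = Re (d x * cis (- h)) / 2" for x
  have g: "(\<lambda>x. g x) differentiable at x" for x
  proof -
    have "(\<lambda>x. d x * cis (- h)) differentiable at x" using d by simp
    from differentiable_compose[of Re "\<lambda>x. d x * cis (- h)", OF bounded_linear_imp_differentiable[OF bounded_linear_Re] this]
    have "(\<lambda>x. Re (d x * cis (- h))) differentiable at x" .
    thus ?thesis unfolding g_def by (intro derivative_intros) auto
  qed
  define X1 where "X1 = {x\<in>X. \<bar>g x\<bar> < 1}"
  have X1: "negligible X1" using X negligible_subset[of X X1] by (auto simp: X1_def)
  have a: "(\<lambda>x. h + s * arccos (g x) + c) differentiable_on X1" for s c
    unfolding differentiable_on_def
  proof
    fix x assume "x \<in> X1"
    hence gx: "-1 < g x" "g x < 1" by (auto simp: X1_def)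
    have "arccos differentiable at (g x)"
      using DERIV_arccos[OF gx] real_differentiable_def by blast
    from differentiable_compose[OF this g]
    have "(\<lambda>x. h + s * arccos (g x) + c) differentiable at x"
      by (intro derivative_intros) auto
    thus "(\<lambda>x. h + s * arccos (g x) + c) differentiable at x within X1"
      by (rule differentiable_at_withinI)
  qed
  \<comment> \<open>The branches of the inverse cosine, indexed by the sign s and the period n. The
    restriction to \<open>X1\<close> keeps \<open>arccos\<close> away from its endpoints, where it
    has no derivative.\<close>
  define N where "N s n = (\<lambda>x. h + s * arccos (g x) + of_int n * (2 * pi)) ` X1" for s :: real and n :: int
  have N: "negligible (N s n)" for s n
    unfolding N_def by (rule negligible_differentiable_image_negligible[OF order_refl X1 a])
  have neg: "negligible ((\<Union>n. N 1 n) \<union> (\<Union>n. N (-1) n) \<union> (\<Union>n::int. {h + of_int n * pi}))"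
    by (intro negligible_Un negligible_countable_Union) (auto intro: N)
  have mem: "y \<in> (\<Union>n. N 1 n) \<union> (\<Union>n. N (-1) n) \<union> (\<Union>n::int. {h + of_int n * pi})"
    if x: "x \<in> X" and eq: "(cis y)\<^sup>2 - d x * cis y + \<delta> = 0" for x y
  proof -
    have "cis (- y - h) * ((cis y)\<^sup>2 - d x * cis y + \<delta>) = cis (y - h) - d x * cis (- h) + cis (h - y)"
      by (simp add: \<delta>h power2_eq_square algebra_simps cis_mult)
    hence "Re (cis (y - h) - d x * cis (- h) + cis (h - y)) = 0" using eq by simp
    hence c: "cos (y - h) = g x"
      using cos_minus[of "y - h"] by (simp add: g_def)
    show ?thesis
    proof (cases "\<bar>g x\<bar> < 1")
      case True
      hence "cos (arccos (g x)) = g x" by (simp add: cos_arccos)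
      hence "cos (y - h) = cos (arccos (g x))" using c by simp
      then obtain r where r: "r \<in> \<int>" "y - h = arccos (g x) + 2 * r * pi \<or> y - h = - arccos (g x) + 2 * r * pi"
        unfolding cos_eq by blast
      from r(1) obtain n where n: "r = of_int n" by (auto elim: Ints_cases)
      from r(2) have "y = h + 1 * arccos (g x) + of_int n * (2 * pi) \<or> y = h + (-1) * arccos (g x) + of_int n * (2 * pi)"
        by (auto simp: n algebra_simps)
      thus ?thesis using x True by (auto simp: N_def X1_def)
    next
      case False
      have "\<bar>cos (y - h)\<bar> \<le> 1" by (rule abs_cos_le_one)
      hence "\<bar>cos (y - h)\<bar> = 1" using False c by simp
      hence "(cos (y - h))\<^sup>2 = 1" by (metis power2_abs one_power2)
      hence "sin (y - h) = 0" using sin_squared_eq[of "y - h"] by simp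
      then obtain n :: int where "y - h = of_int n * pi" using sin_zero_iff_int2 by blast
      hence "y = h + of_int n * pi" by simp
      thus ?thesis by blast
    qed
  qed
  show ?thesis by (rule negligible_subset[OF neg]) (use mem in blast)
qed

locale commuting_unitaries = unitary_pair U V + T: unitary_pair T W
  for U V T W :: "'a::complex_hilbert \<Rightarrow> 'a" +
  assumes TU: "T (U x) = U (T x)"
begin

lemma spectral_proj_T: "B \<in> sets borel \<Longrightarrow> T (spectral_proj B x) = spectral_proj B (T x)"
  by (rule spectral_proj_commute[of B T 1]) (auto simp: T.U_diff T.U_scaleC T.U_norm TU)

lemma spectral_proj_trig:
  assumes B: "B \<in> sets borel" and P: "trig p P"
  shows "P (spectral_proj B x) = spectral_proj B (P x)"
proof -
  obtain K where K: "\<And>x. norm (P x) \<le> K * norm x" using trig_bounded[OF P] by metis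
  have "P (U x) = U (P x)" for x
    by (rule trig_commute[OF U_diff U_scaleC _ P, symmetric]) simp
  thus ?thesis
    by (intro spectral_proj_commute[OF B, where K = K] trig_diff_right[OF P] trig_scaleC[OF P] K)
qed

lemma trig_T: "trig p P \<Longrightarrow> T (P x) = P (T x)"
  by (rule trig_commute) (auto simp: T.U_diff T.U_scaleC TU)

lemma T_spectral_proj_trig:
  assumes B: "B \<in> sets borel" and P: "trig p P"
  shows "P (T.spectral_proj B x) = T.spectral_proj B (P x)"
proof -
  obtain K where K: "\<And>x. norm (P x) \<le> K * norm x" using trig_bounded[OF P] by metis
  show ?thesis
    using trig_T[OF P]
    by (intro T.spectral_proj_commute[OF B, where K = K] trig_diff_right[OF P] trig_scaleC[OF P] K) simp
qed

lemma T_spectral_proj_spectral_proj: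
  assumes A: "A \<in> sets borel" and B: "B \<in> sets borel"
  shows "spectral_proj A (T.spectral_proj B x) = T.spectral_proj B (spectral_proj A x)"
  by (rule T.spectral_proj_commute[OF B, where K = 1])
     (auto simp: spectral_proj_diff[OF A] spectral_proj_scaleC[OF A] norm_spectral_proj_le[OF A] spectral_proj_T[OF A])

end

text \<open>The relation is assumed on a single vector only; commutation carries it to the
  projections of that vector. \<open>moments\<close> says that the orbit under T is orthonormal, so
  the spectral measure of T there is normalised arc length.\<close>

locale quadratic_relation = commuting_unitaries U V T W
  for U V T W :: "'a::complex_hilbert \<Rightarrow> 'a" +
  fixes D D_op \<delta> \<phi>
  assumes D: "trig D D_op" and \<delta>: "cmod \<delta> = 1"
    and relation: "T (T \<phi>) - D_op (T \<phi>) + \<delta> *\<^sub>C \<phi> = 0"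
    and moments: "\<And>n. cinner \<phi> ((T ^^ n) \<phi>) = (if n = 0 then 1 else 0)"
begin

text \<open>Two competing bounds for the projected vector h. On F the quadratic with D frozen at
  \<mu> has modulus at least c, so applied to T it has norm at least c |h| on h. On A the freezing
  costs at most (c / 2) |T h| = (c / 2) |h|. Hence h = 0.\<close>

lemma local_vanishing:
  assumes F: "compact F" "F \<subseteq> sphere 0 1" and nz: "\<And>z. z \<in> F \<Longrightarrow> z\<^sup>2 - D \<mu> * z + \<delta> \<noteq> 0"
  shows "\<exists>A. open A \<and> \<mu> \<in> A \<and> spectral_proj A (T.spectral_proj F \<phi>) = 0"
proof -
  have contD: "continuous_on UNIV D" by (rule trig_continuous[OF D])
  have "\<exists>c>0. \<forall>z\<in>F. c \<le> cmod (z\<^sup>2 - D \<mu> * z + \<delta>)"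
  proof (cases "F = {}")
    case False
    have "continuous_on F (\<lambda>z. cmod (z\<^sup>2 - D \<mu> * z + \<delta>))" by (intro continuous_intros)
    from continuous_attains_inf[OF F(1) False this] show ?thesis using nz by (meson zero_less_norm_iff)
  qed (auto intro: exI[of _ 1])
  then obtain c where c: "c > 0" "\<And>z. z \<in> F \<Longrightarrow> c \<le> cmod (z\<^sup>2 - D \<mu> * z + \<delta>)" by blast
  define A where "A = {l. cmod (D l - D \<mu>) < c / 2}"
  have A: "open A" unfolding A_def
    by (intro open_Collect_less continuous_intros contD)
  have bA: "A \<in> sets borel" and bF: "F \<in> sets borel"
    using A F(1) by (auto simp: borel_closed compact_imp_closed)
  define h where "h = spectral_proj A (T.spectral_proj F \<phi>)"
  have hA: "spectral_proj A h = h" by (simp add: h_def spectral_proj_mult bA)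
  have hF: "T.spectral_proj F h = h" by (simp add: h_def T_spectral_proj_spectral_proj[OF bA bF] T.spectral_proj_mult bF)
  \<comment> \<open>Both projections commute with T and \<open>D_op\<close>, so h inherits the
    relation from \<open>\<phi>\<close>.\<close>
  have "T (T h) - D_op (T h) + \<delta> *\<^sub>C h = spectral_proj A (T.spectral_proj F (T (T \<phi>) - D_op (T \<phi>) + \<delta> *\<^sub>C \<phi>))"
    unfolding h_def
    by (simp add: spectral_proj_add[OF bA] T.spectral_proj_add[OF bF] spectral_proj_diff[OF bA] T.spectral_proj_diff[OF bF]
         spectral_proj_scaleC[OF bA] T.spectral_proj_scaleC[OF bF] spectral_proj_T[OF bA] T.spectral_proj_U[OF bF, symmetric]
         spectral_proj_trig[OF bA D] T_spectral_proj_trig[OF bF D])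
  hence rel: "T (T h) - D_op (T h) + \<delta> *\<^sub>C h = 0" by (simp add: relation bA bF)
  have "T.trig (\<lambda>z. z * z - D \<mu> * z + \<delta>) (\<lambda>x. T (T x) - D \<mu> *\<^sub>C T x + \<delta> *\<^sub>C x)"
    by (intro T.trig_add T.trig_diff T.trig_mult[OF T.trig_U T.trig_U] T.trig_cmult T.trig_U T.trig_const)
  from T.trig_norm_spectral_proj_ge[OF bF this hF, of c] c
  have "c * norm h \<le> norm (T (T h) - D \<mu> *\<^sub>C T h + \<delta> *\<^sub>C h)" by (simp add: power2_eq_square)
  also have "T (T h) - D \<mu> *\<^sub>C T h + \<delta> *\<^sub>C h = D_op (T h) - D \<mu> *\<^sub>C T h"
    using rel by (simp add: algebra_simps eq_neg_iff_add_eq_0)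
  also have "norm \<dots> \<le> c / 2 * norm (T h)"
  proof (rule trig_norm_spectral_proj_le[OF bA trig_diff[OF D trig_cmult[OF trig_const[of 1]], simplified]])
    show "spectral_proj A (T h) = T h" using spectral_proj_T[OF bA, of h] hA by simp
  qed (use c(1) in \<open>auto simp: A_def\<close>)
  finally have "norm h \<le> 0" using c(1) by (simp add: T.U_norm)
  moreover have "\<mu> \<in> A" using c(1) by (simp add: A_def)
  ultimately show ?thesis using A by (auto simp: h_def)
qed

text \<open>Finitely many of the local neighbourhoods cover B, and the spectral measure of the
  projected vector is subadditive.\<close>

lemma compact_vanishing:
  assumes B: "compact B" and F: "compact F" "F \<subseteq> sphere 0 1"
    and nz: "\<And>l z. l \<in> B \<Longrightarrow> z \<in> F \<Longrightarrow> z\<^sup>2 - D l * z + \<delta> \<noteq> 0"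
  shows "spectral_proj B (T.spectral_proj F \<phi>) = 0"
proof -
  define g where "g = T.spectral_proj F \<phi>"
  interpret finite_measure "spectral_measure g" by (rule finite_spectral_measure)
  have "\<exists>A. open A \<and> l \<in> A \<and> spectral_proj A g = 0" if "l \<in> B" for l
    unfolding g_def by (rule local_vanishing[OF F nz[OF that]])
  then obtain A where A: "\<And>l. l \<in> B \<Longrightarrow> open (A l) \<and> l \<in> A l \<and> spectral_proj (A l) g = 0" by metis
  from compactE_image[OF B, of B A] A obtain C where C: "C \<subseteq> B" "finite C" "B \<subseteq> (\<Union>l\<in>C. A l)"
    by (metis UN_I subsetI)
  have "measure (spectral_measure g) B \<le> measure (spectral_measure g) (\<Union>l\<in>C. A l)"
    using C A by (intro finite_measure_mono) (auto intro!: borel_open)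
  also have "\<dots> \<le> (\<Sum>l\<in>C. measure (spectral_measure g) (A l))"
    using C A by (intro finite_measure_subadditive_finite) auto
  also have "\<dots> = 0"
  proof (rule sum.neutral, rule)
    fix l assume "l \<in> C"
    hence "open (A l)" "spectral_proj (A l) g = 0" using C A by auto
    thus "measure (spectral_measure g) (A l) = 0" using norm_spectral_proj[of "A l" g] by simp
  qed
  finally have "(norm (spectral_proj B g))\<^sup>2 \<le> 0"
    using norm_spectral_proj[of B g] B by (simp add: borel_closed compact_imp_closed)
  thus ?thesis by (simp add: g_def)
qed

text \<open>The image under \<open>cis\<close> of the uniform distribution on [0, 2 pi] has the
  moments of \<phi> under T, so uniqueness identifies it with the spectral measure.\<close>

lemma T_measure_null:
  assumes J: "J \<in> sets borel" and null: "negligible {y. cis y \<in> J}"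
  shows "measure (T.spectral_measure \<phi>) J = 0"
proof -
  have cis_m [measurable]: "cis \<in> borel_measurable borel"
    by (intro borel_measurable_continuous_onI continuous_intros)
  note [measurable] = J
  define L where "L = density lborel (\<lambda>x. ennreal (indicator {0..2*pi} x / (2 * pi)))"
  have sL [measurable_cong]: "sets L = sets borel" by (simp add: L_def)
  have spL: "space L = UNIV" by (simp add: L_def)
  define M where "M = distr L borel cis"
  have eL: "emeasure L UNIV = 1"
  proof -
    have "emeasure L UNIV = (\<integral>\<^sup>+x. ennreal (1 / (2*pi)) * indicator {0..2*pi} x \<partial>lborel)"
      unfolding L_def by (simp add: emeasure_density)
        (intro nn_integral_cong, simp add: indicator_def)
    also have "\<dots> = ennreal (1 / (2*pi)) * ennreal (2*pi)"
      by (subst nn_integral_cmult_indicator) auto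
    also have "\<dots> = 1" by (simp add: ennreal_mult[symmetric])
    finally show ?thesis .
  qed
  have "T.circle_moments M \<phi>" unfolding T.circle_moments_def
  proof (intro conjI allI)
    show "sets M = sets borel" by (simp add: M_def)
    show "finite_measure M"
      by (rule finite_measureI) (simp add: M_def emeasure_distr spL eL)
    show "AE z in M. cmod z = 1"
      unfolding M_def by (subst AE_distr_iff) auto
    fix n
    have "(LINT z|M. z ^ n) = (LINT x|L. cis (real n * x))"
      unfolding M_def by (subst integral_distr) (auto simp: Complex.DeMoivre)
    also have "\<dots> = (LINT x|lborel. (indicator {0..2*pi} x / (2 * pi)) *\<^sub>R cis (real n * x))"
      unfolding L_def by (subst integral_density) auto
    also have "\<dots> = (LINT x|lborel. (1 / (2 * pi)) *\<^sub>R (indicator {0..2*pi} x *\<^sub>R cis (of_int (int n) * x)))"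
      by (intro Bochner_Integration.integral_cong) auto
    also have "\<dots> = (if n = 0 then 1 else 0)"
      unfolding integral_scaleR_right integral_cis_period(2) by (simp add: scaleR_conv_of_real)
    finally show "(LINT z|M. z ^ n) = cinner \<phi> ((T ^^ n) \<phi>)" by (simp add: moments)
  qed
  hence "measure (T.spectral_measure \<phi>) J = measure M J" using T.circle_moments_unique J by metis
  also have "\<dots> = measure L (cis -` J)"
    unfolding M_def by (subst measure_distr) (auto simp: spL)
  also have "emeasure L (cis -` J) = 0"
  proof -
    have m: "cis -` J \<in> sets borel" using measurable_sets[OF cis_m J] by simp
    have "{y. cis y \<in> J} = cis -` J" by auto
    hence "emeasure lborel (cis -` J) = 0"
      using null m by (simp add: negligible_iff_emeasure0)
    hence "cis -` J \<in> null_sets lborel" using m by (simp add: null_sets_def)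
    hence "AE x in lborel. x \<notin> cis -` J" by (rule AE_not_in)
    hence "AE x in L. x \<notin> cis -` J" unfolding L_def by (subst AE_density) (auto elim: AE_mp)
    thus ?thesis using m by (subst (asm) AE_iff_null) (auto simp: sL spL vimage_def null_sets_def)
  qed
  hence "measure L (cis -` J) = 0" by (simp add: measure_def)
  finally show ?thesis .
qed

text \<open>J collects the z that the curve attaches to B; it is null for T. A compact F in the rest
  of the circle exhausts T's measure up to e. The part of \<phi> over F is annihilated by
  \<open>compact_vanishing\<close>, and the part over the complement of F has squared norm at most
  e.\<close>

lemma compact_null:
  assumes B: "compact B" "B \<subseteq> sphere 0 1" and null: "negligible {x. cis x \<in> B}"
  shows "spectral_proj B \<phi> = 0"
proof -
  have contD: "continuous_on A D" for A
    using trig_continuous[OF D] continuous_on_subset by blast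
  define J where "J = {z \<in> sphere 0 1. \<exists>l\<in>B. z\<^sup>2 - D l * z + \<delta> = 0}"
  \<comment> \<open>J is the projection of this compact piece of the curve, hence compact, and
    therefore measurable.\<close>
  define G where "G = {w \<in> B \<times> sphere 0 1. (snd w)\<^sup>2 - D (fst w) * snd w + \<delta> = 0}"
  have "compact G"
  proof -
    have cl: "closed (B \<times> sphere (0::complex) 1)" using B by (intro closed_Times compact_imp_closed) auto
    have "continuous_on (B \<times> sphere 0 1) (\<lambda>w. (snd w)\<^sup>2 - D (fst w) * snd w + \<delta>)"
      by (intro continuous_intros continuous_on_compose2[OF contD[of UNIV]]) auto
    from continuous_closed_preimage_constant[OF this cl, of 0]
    have "closed G" by (simp add: G_def)
    moreover have "compact (B \<times> sphere (0::complex) 1)" using B by (intro compact_Times) auto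
    ultimately have "compact ((B \<times> sphere 0 1) \<inter> G)" by (metis compact_Int_closed)
    moreover have "(B \<times> sphere 0 1) \<inter> G = G" by (auto simp: G_def)
    ultimately show ?thesis by simp
  qed
  hence "compact (snd ` G)" by (intro compact_continuous_image continuous_intros)
  moreover have "snd ` G = J" by (force simp: G_def J_def)
  ultimately have cJ: "compact J" by simp
  have bJ: "J \<in> sets borel" using cJ by (simp add: borel_closed compact_imp_closed)
  have "negligible {y. \<exists>x\<in>{x. cis x \<in> B}. (cis y)\<^sup>2 - D (cis x) * cis y + \<delta> = 0}"
    by (rule negligible_quadratic_phase[OF trig_cis_differentiable[OF D] null \<delta>])
  moreover have "{y. cis y \<in> J} \<subseteq> {y. \<exists>x\<in>{x. cis x \<in> B}. (cis y)\<^sup>2 - D (cis x) * cis y + \<delta> = 0}"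
  proof
    fix y assume "y \<in> {y. cis y \<in> J}"
    then obtain l where l: "l \<in> B" "(cis y)\<^sup>2 - D l * cis y + \<delta> = 0" by (auto simp: J_def)
    have "cis (Arg l) = l" using l(1) B(2) cis_Arg[of l] by (force simp: sgn_div_norm)
    thus "y \<in> {y. \<exists>x\<in>{x. cis x \<in> B}. (cis y)\<^sup>2 - D (cis x) * cis y + \<delta> = 0}"
      using l by (intro CollectI bexI[of _ "Arg l"]) auto
  qed
  ultimately have "negligible {y. cis y \<in> J}" by (rule negligible_subset)
  hence J0: "measure (T.spectral_measure \<phi>) J = 0" by (rule T_measure_null[OF bJ])
  interpret Tm: finite_measure "T.spectral_measure \<phi>" by (rule T.finite_spectral_measure)
  have bB: "B \<in> sets borel" using B by (simp add: borel_closed compact_imp_closed)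
  have sph: "sphere 0 1 \<in> sets (borel :: complex measure)" by (simp add: borel_closed)
  have "(norm (spectral_proj B \<phi>))\<^sup>2 \<le> e" if e: "e > 0" for e
  proof -
    obtain F where F: "compact F" "F \<subseteq> sphere 0 1 - J" "measure (T.spectral_measure \<phi>) (sphere 0 1 - J - F) < e"
      using borel_compact_approx[of "{T.spectral_measure \<phi>}" "sphere 0 1 - J" e] T.spectral_measure_circle bJ sph e
      by (auto simp: sets.Diff)
    have bF: "F \<in> sets borel" using F(1) by (simp add: borel_closed compact_imp_closed)
    have "measure (T.spectral_measure \<phi>) (- sphere 0 1) = 0"
    proof -
      have "AE z in T.spectral_measure \<phi>. z \<notin> - sphere 0 1" using T.spectral_measure_circle[of \<phi>] by (simp add: circle_measure_def)
      thus ?thesis using sph by (intro measure_eq_0_null_sets) (simp add: AE_iff_null_sets sets.compl_sets Compl_eq_Diff_UNIV)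
    qed
    moreover have "measure (T.spectral_measure \<phi>) (- F) \<le>
      measure (T.spectral_measure \<phi>) (- sphere 0 1 \<union> J \<union> (sphere 0 1 - J - F))"
      using bF bJ sph by (intro Tm.finite_measure_mono) (auto simp: Compl_eq_Diff_UNIV)
    moreover have "measure (T.spectral_measure \<phi>) (- sphere 0 1 \<union> J \<union> (sphere 0 1 - J - F)) \<le>
      measure (T.spectral_measure \<phi>) (- sphere 0 1) + measure (T.spectral_measure \<phi>) J + measure (T.spectral_measure \<phi>) (sphere 0 1 - J - F)"
      using bF bJ sph
      by (intro order_trans[OF measure_Un_le] add_right_mono measure_Un_le)
         (auto simp: Compl_eq_Diff_UNIV)
    ultimately have small: "measure (T.spectral_measure \<phi>) (- F) \<le> e" using J0 F(3) by linarith
    have v: "spectral_proj B (T.spectral_proj F \<phi>) = 0"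
      by (rule compact_vanishing[OF B(1) F(1)]) (use F(2) in \<open>auto simp: J_def\<close>)
    have bFc: "- F \<in> sets borel" using bF by auto
    have "T.spectral_proj F \<phi> + T.spectral_proj (- F) \<phi> = \<phi>"
    proof -
      have z: "T.spectral_proj F (T.spectral_proj (- F) \<phi>) = 0" "T.spectral_proj (- F) (T.spectral_proj F \<phi>) = 0"
        using T.norm_spectral_proj[of "{}" \<phi>] by (simp_all add: T.spectral_proj_mult bF bFc)
      \<comment> \<open>The remainder has no spectral mass on F nor on its complement; its total
        mass is its squared norm, so it is zero.\<close>
      define k where "k = \<phi> - T.spectral_proj F \<phi> - T.spectral_proj (- F) \<phi>"
      have "T.spectral_proj F k = 0" "T.spectral_proj (- F) k = 0"
        using z by (simp_all add: k_def T.spectral_proj_diff T.spectral_proj_mult bF bFc)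
      hence "measure (T.spectral_measure k) F = 0" "measure (T.spectral_measure k) (- F) = 0"
        using T.norm_spectral_proj[of F k] T.norm_spectral_proj[of "- F" k] bF bFc by simp_all
      moreover have "measure (T.spectral_measure k) (F \<union> - F) \<le> measure (T.spectral_measure k) F + measure (T.spectral_measure k) (- F)"
        using bF bFc by (intro measure_Un_le) auto
      ultimately have "(norm k)\<^sup>2 \<le> 0" unfolding T.measure_spectral_measure_UNIV[symmetric] by simp
      thus ?thesis by (simp add: k_def algebra_simps)
    qed
    hence "spectral_proj B \<phi> = spectral_proj B (T.spectral_proj F \<phi>) + spectral_proj B (T.spectral_proj (- F) \<phi>)"
      by (metis spectral_proj_add[OF bB])
    hence "norm (spectral_proj B \<phi>) \<le> norm (T.spectral_proj (- F) \<phi>)" using v norm_spectral_proj_le[OF bB] by simp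
    hence "(norm (spectral_proj B \<phi>))\<^sup>2 \<le> (norm (T.spectral_proj (- F) \<phi>))\<^sup>2" by (intro power_mono) auto
    thus ?thesis using small T.norm_spectral_proj[OF bFc, of \<phi>] by simp
  qed
  hence "(norm (spectral_proj B \<phi>))\<^sup>2 \<le> 0" using field_le_epsilon[of "(norm (spectral_proj B \<phi>))\<^sup>2" 0] by simp
  thus ?thesis by simp
qed

text \<open>Inner regularity of the spectral measure of U: compact subsets of a null set are null,
  and they carry almost all the mass of B on the circle.\<close>

lemma spectral_proj_null:
  assumes B: "B \<in> sets borel" and null: "negligible {x. cis x \<in> B}"
  shows "spectral_proj B \<phi> = 0"
proof -
  interpret finite_measure "spectral_measure \<phi>" by (rule finite_spectral_measure)
  have sph: "sphere 0 1 \<in> sets (borel :: complex measure)" by (simp add: borel_closed)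
  define B' where "B' = B \<inter> sphere 0 1"
  have B': "B' \<in> sets borel" using B sph by (auto simp: B'_def)
  have "measure (spectral_measure \<phi>) B' \<le> e" if e: "e > 0" for e
  proof -
    obtain C where C: "compact C" "C \<subseteq> B'" "measure (spectral_measure \<phi>) (B' - C) < e"
      using borel_compact_approx[of "{spectral_measure \<phi>}" B' e] spectral_measure_circle B' e by auto
    have bC: "C \<in> sets borel" using C(1) by (simp add: borel_closed compact_imp_closed)
    have "spectral_proj C \<phi> = 0"
    proof (rule compact_null[OF C(1)])
      show "C \<subseteq> sphere 0 1" using C(2) by (auto simp: B'_def)
      show "negligible {x. cis x \<in> C}"
        by (rule negligible_subset[OF null]) (use C(2) in \<open>auto simp: B'_def\<close>)
    qed
    hence "measure (spectral_measure \<phi>) C = 0" using norm_spectral_proj[OF bC, of \<phi>] by simp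
    thus ?thesis using C(2,3) bC B' finite_measure_Diff[of B' C] by simp
  qed
  hence "measure (spectral_measure \<phi>) B' \<le> 0" using field_le_epsilon[of "measure (spectral_measure \<phi>) B'" 0] by simp
  moreover have "measure (spectral_measure \<phi>) B = measure (spectral_measure \<phi>) B'"
  proof (rule measure_eq_AE)
    have "AE z in spectral_measure \<phi>. cmod z = 1" using spectral_measure_circle by (simp add: circle_measure_def)
    thus "AE z in spectral_measure \<phi>. z \<in> B \<longleftrightarrow> z \<in> B'" by eventually_elim (simp add: B'_def)
  qed (use B B' in auto)
  ultimately have "(norm (spectral_proj B \<phi>))\<^sup>2 \<le> 0" using norm_spectral_proj[OF B, of \<phi>] by simp
  thus ?thesis by simp
qed

end

section \<open>The sequence space as a Hilbert space\<close>

lemma ell2_zero: "(\<lambda>k. 0) \<in> ell2"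
  by (simp add: ell2_def)

lemma ell2_scale: "f \<in> ell2 \<Longrightarrow> (\<lambda>k. c * f k) \<in> ell2"
  by (simp add: ell2_def norm_mult power_mult_distrib summable_on_cmult_right)

lemma ell2_comparison:
  assumes "g summable_on UNIV" and "\<And>k. (cmod (f k))\<^sup>2 \<le> g k"
  shows "f \<in> ell2"
  unfolding ell2_def mem_Collect_eq
  by (rule summable_on_comparison_test[OF assms(1)]) (use assms(2) in auto)

lemma ell2_add:
  assumes "f \<in> ell2" and "g \<in> ell2"
  shows "(\<lambda>k. f k + g k) \<in> ell2"
proof (rule ell2_comparison)
  show "(\<lambda>k. 2 * ((cmod (f k))\<^sup>2 + (cmod (g k))\<^sup>2)) summable_on UNIV"
    using assms by (intro summable_on_cmult_right summable_on_add) (auto simp: ell2_def)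
qed (rule norm_square_add_le)

lemma ell2_product_summable:
  assumes "f \<in> ell2" and "g \<in> ell2"
  shows "(\<lambda>k. cnj (f k) * g k) summable_on UNIV"
proof (rule abs_summable_summable, rule summable_on_comparison_test)
  show "(\<lambda>k. (cmod (f k))\<^sup>2 + (cmod (g k))\<^sup>2) summable_on UNIV"
    using assms by (intro summable_on_add) (auto simp: ell2_def)
  show "cmod (cnj (f k) * g k) \<le> (cmod (f k))\<^sup>2 + (cmod (g k))\<^sup>2" for k
  proof -
    have "2 * (cmod (f k) * cmod (g k)) \<le> (cmod (f k))\<^sup>2 + (cmod (g k))\<^sup>2"
      using sum_squares_bound[of "cmod (f k)" "cmod (g k)"] by simp
    moreover have "0 \<le> cmod (f k) * cmod (g k)" by simp
    ultimately show ?thesis unfolding norm_mult complex_mod_cnj by linarith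
  qed
qed auto

lemma ell2_inner_self:
  assumes "f \<in> ell2"
  shows "ell2_inner f f = of_real (\<Sum>\<^sub>\<infinity>k. (cmod (f k))\<^sup>2)"
proof -
  have "cnj (f k) * f k = of_real ((cmod (f k))\<^sup>2)" for k
    by (simp add: mult.commute flip: complex_norm_square)
  moreover have "((\<lambda>k. complex_of_real ((cmod (f k))\<^sup>2)) has_sum of_real (\<Sum>\<^sub>\<infinity>k. (cmod (f k))\<^sup>2)) UNIV"
    using assms by (intro has_sum_of_real has_sum_infsum) (simp add: ell2_def)
  ultimately show ?thesis unfolding ell2_inner_def by (simp only: infsumI)
qed

text \<open>The carrier becomes a type so that it can instantiate the Hilbert space class;
  \<open>seq_operator\<close> leads back to functions on sequences.\<close>

typedef l2 = ell2
  morphisms coord Abs_l2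
  using ell2_zero by blast

setup_lifting type_definition_l2

lemma coord_ell2 [simp]: "coord x \<in> ell2"
  by (rule coord)

lemma l2_eqI: "(\<And>k. coord x k = coord y k) \<Longrightarrow> x = y"
  by (simp add: coord_inject[symmetric] fun_eq_iff)

lemma coord_Abs: "f \<in> ell2 \<Longrightarrow> coord (Abs_l2 f) = f"
  by (rule Abs_l2_inverse)

instantiation l2 :: real_vector
begin

lift_definition zero_l2 :: l2 is "\<lambda>k. 0" by (rule ell2_zero)
lift_definition plus_l2 :: "l2 \<Rightarrow> l2 \<Rightarrow> l2" is "\<lambda>f g k. f k + g k" by (rule ell2_add)
lift_definition uminus_l2 :: "l2 \<Rightarrow> l2" is "\<lambda>f k. - f k"
  using ell2_scale[of _ "-1"] by simp
lift_definition minus_l2 :: "l2 \<Rightarrow> l2 \<Rightarrow> l2" is "\<lambda>f g k. f k - g k"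
  using ell2_add[OF _ ell2_scale[of _ "-1"]] by simp
lift_definition scaleR_l2 :: "real \<Rightarrow> l2 \<Rightarrow> l2" is "\<lambda>s f k. of_real s * f k" by (rule ell2_scale)

instance
  by standard (transfer, simp add: algebra_simps fun_eq_iff)+

end

lift_definition l2_inner :: "l2 \<Rightarrow> l2 \<Rightarrow> complex" is ell2_inner .

lemma l2_inner_commute: "l2_inner x y = cnj (l2_inner y x)"
  by transfer (simp add: ell2_inner_def mult.commute flip: infsum_cnj)

lemma l2_inner_add_right: "l2_inner x (y + z) = l2_inner x y + l2_inner x z"
  by transfer (simp add: ell2_inner_def distrib_left infsum_add ell2_product_summable)

lemma l2_inner_add_left: "l2_inner (x + y) z = l2_inner x z + l2_inner y z"
  using l2_inner_add_right[of z x y] l2_inner_commute by (metis complex_cnj_add)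

lemma l2_inner_self: "l2_inner x x = of_real (\<Sum>\<^sub>\<infinity>k. (cmod (coord x k))\<^sup>2)"
  by transfer (rule ell2_inner_self)

lemma coord_summable: "(\<lambda>k. (cmod (coord x k))\<^sup>2) summable_on UNIV"
  using coord_ell2[of x] unfolding ell2_def by blast

instantiation l2 :: real_inner
begin

definition inner_l2 :: "l2 \<Rightarrow> l2 \<Rightarrow> real" where "inner_l2 x y = Re (l2_inner x y)"
definition norm_l2 :: "l2 \<Rightarrow> real" where "norm_l2 x = sqrt (inner x x)"
definition sgn_l2 :: "l2 \<Rightarrow> l2" where "sgn_l2 x = x /\<^sub>R norm x"
definition dist_l2 :: "l2 \<Rightarrow> l2 \<Rightarrow> real" where "dist_l2 x y = norm (x - y)"
definition uniformity_l2 :: "(l2 \<times> l2) filter" where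
  "uniformity_l2 = (INF e\<in>{0<..}. principal {(x, y). dist x y < e})"
definition open_l2 :: "l2 set \<Rightarrow> bool" where
  "open_l2 A \<longleftrightarrow> (\<forall>x\<in>A. \<forall>\<^sub>F (x', y) in uniformity. x' = x \<longrightarrow> y \<in> A)"

instance
proof
  fix x y z :: l2 and s :: real
  show "inner x y = inner y x"
    using l2_inner_commute[of x y] by (simp add: inner_l2_def)
  show "inner (x + y) z = inner x z + inner y z" by (simp add: inner_l2_def l2_inner_add_left)
  have "l2_inner (s *\<^sub>R x) y = of_real s * l2_inner x y"
    by transfer (simp add: ell2_inner_def mult.assoc infsum_cmult_right')
  thus "inner (s *\<^sub>R x) y = s * inner x y" by (simp add: inner_l2_def)
  have nn: "inner x x = (\<Sum>\<^sub>\<infinity>k. (cmod (coord x k))\<^sup>2)" by (simp add: inner_l2_def l2_inner_self)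
  show "0 \<le> inner x x" unfolding nn by (rule infsum_nonneg) simp
  show "inner x x = 0 \<longleftrightarrow> x = 0"
  proof
    assume "inner x x = 0"
    hence "(\<Sum>\<^sub>\<infinity>k. (cmod (coord x k))\<^sup>2) \<le> 0" by (simp add: nn)
    hence "(cmod (coord x k))\<^sup>2 = 0" for k
      using nonneg_infsum_le_0D[of "\<lambda>k. (cmod (coord x k))\<^sup>2" UNIV k] coord_summable by auto
    thus "x = 0" by (intro l2_eqI) (simp add: zero_l2.rep_eq)
  next
    assume "x = 0"
    thus "inner x x = 0" unfolding nn by (simp add: zero_l2.rep_eq)
  qed
qed (simp_all add: norm_l2_def sgn_l2_def dist_l2_def uniformity_l2_def open_l2_def)

end

lemma norm_l2_square: "(norm (x :: l2))\<^sup>2 = (\<Sum>\<^sub>\<infinity>k. (cmod (coord x k))\<^sup>2)"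
  unfolding power2_norm_eq_inner[of x] by (simp only: inner_l2_def l2_inner_self Re_complex_of_real)

lemma coord_sum_le: "finite S \<Longrightarrow> (\<Sum>k\<in>S. (cmod (coord x k))\<^sup>2) \<le> (norm x)\<^sup>2"
  unfolding norm_l2_square using coord_summable by (intro finite_sum_le_infsum) auto

lemma coord_norm_le: "cmod (coord x k) \<le> norm x"
  using coord_sum_le[of "{k}" x] by (simp add: abs_le_square_iff[symmetric])

instance l2 :: complete_space
proof
  fix X :: "nat \<Rightarrow> l2"
  assume X: "Cauchy X"
  have "Cauchy (\<lambda>n. coord (X n) k)" for k
  proof (rule metric_CauchyI)
    fix e :: real assume "e > 0"
    from metric_CauchyD[OF X this] obtain M
      where M: "\<And>m n. m \<ge> M \<Longrightarrow> n \<ge> M \<Longrightarrow> dist (X m) (X n) < e" by blast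
    have "dist (coord (X m) k) (coord (X n) k) \<le> dist (X m) (X n)" for m n
      using coord_norm_le[of "X m - X n" k] by (simp add: dist_norm minus_l2.rep_eq)
    thus "\<exists>M. \<forall>m\<ge>M. \<forall>n\<ge>M. dist (coord (X m) k) (coord (X n) k) < e"
      using M by (meson le_less_trans)
  qed
  hence "\<exists>a. (\<lambda>n. coord (X n) k) \<longlonglongrightarrow> a" for k
    using Cauchy_convergent convergent_def by blast
  then obtain a where a: "\<And>k. (\<lambda>n. coord (X n) k) \<longlonglongrightarrow> a k" by metis
  \<comment> \<open>Over finite index sets the limit in m is taken term by term. The bound does not
    depend on the set, so it passes to the infinite sum.\<close>
  have bound: "\<exists>M. \<forall>n\<ge>M. \<forall>S. finite S \<longrightarrow> (\<Sum>k\<in>S. (cmod (coord (X n) k - a k))\<^sup>2) \<le> e\<^sup>2" if "e > 0" for e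
  proof -
    from metric_CauchyD[OF X that] obtain M
      where M: "\<And>m n. m \<ge> M \<Longrightarrow> n \<ge> M \<Longrightarrow> dist (X m) (X n) < e" by blast
    have "(\<Sum>k\<in>S. (cmod (coord (X n) k - a k))\<^sup>2) \<le> e\<^sup>2" if n: "n \<ge> M" and S: "finite S" for n S
    proof (rule LIMSEQ_le_const2)
      show "(\<lambda>m. \<Sum>k\<in>S. (cmod (coord (X n) k - coord (X m) k))\<^sup>2) \<longlonglongrightarrow> (\<Sum>k\<in>S. (cmod (coord (X n) k - a k))\<^sup>2)"
        by (intro tendsto_intros a)
      have "(\<Sum>k\<in>S. (cmod (coord (X n) k - coord (X m) k))\<^sup>2) \<le> e\<^sup>2" if "m \<ge> M" for m
      proof -
        have "(\<Sum>k\<in>S. (cmod (coord (X n) k - coord (X m) k))\<^sup>2) \<le> (norm (X n - X m))\<^sup>2"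
          using coord_sum_le[OF S, of "X n - X m"] by (simp add: minus_l2.rep_eq)
        also have "\<dots> \<le> e\<^sup>2"
          using M[OF n that] by (intro power_mono) (auto simp: dist_norm)
        finally show ?thesis .
      qed
      thus "\<exists>M. \<forall>m\<ge>M. (\<Sum>k\<in>S. (cmod (coord (X n) k - coord (X m) k))\<^sup>2) \<le> e\<^sup>2" by blast
    qed
    thus ?thesis by blast
  qed
  have sm: "(\<lambda>k. coord (X n) k - a k) \<in> ell2"
    if "\<And>S. finite S \<Longrightarrow> (\<Sum>k\<in>S. (cmod (coord (X n) k - a k))\<^sup>2) \<le> b" for n b
    unfolding ell2_def mem_Collect_eq
    by (rule nonneg_bdd_above_summable_on) (auto intro!: bdd_aboveI that)
  obtain M where "\<And>S. finite S \<Longrightarrow> (\<Sum>k\<in>S. (cmod (coord (X M) k - a k))\<^sup>2) \<le> 1\<^sup>2"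
    using bound[of 1] by auto
  \<comment> \<open>The limit sequence is written as \<open>X M\<close> minus a square-summable
    difference.\<close>
  from sm[OF this] have "(\<lambda>k. coord (X M) k + (-1) * (coord (X M) k - a k)) \<in> ell2"
    by (intro ell2_add ell2_scale coord_ell2)
  hence A: "a \<in> ell2" by simp
  have "X \<longlonglongrightarrow> Abs_l2 a"
  proof (rule metric_LIMSEQ_I)
    fix e :: real assume e: "e > 0"
    then obtain M where M: "\<And>n S. n \<ge> M \<Longrightarrow> finite S \<Longrightarrow> (\<Sum>k\<in>S. (cmod (coord (X n) k - a k))\<^sup>2) \<le> (e/2)\<^sup>2"
      using bound[of "e/2"] by auto
    have "dist (X n) (Abs_l2 a) < e" if "n \<ge> M" for n
    proof -
      have "(norm (X n - Abs_l2 a))\<^sup>2 \<le> (e/2)\<^sup>2"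
        unfolding norm_l2_square using coord_summable[of "X n - Abs_l2 a"] M[OF that]
        by (intro infsum_le_finite_sums) (auto simp: minus_l2.rep_eq coord_Abs[OF A])
      hence "norm (X n - Abs_l2 a) \<le> e/2" by (rule power2_le_imp_le) (use e in simp)
      thus ?thesis using e by (simp add: dist_norm)
    qed
    thus "\<exists>M. \<forall>n\<ge>M. dist (X n) (Abs_l2 a) < e" by blast
  qed
  thus "convergent X" by (auto simp: convergent_def)
qed

instantiation l2 :: complex_hilbert
begin

lift_definition scaleC_l2 :: "complex \<Rightarrow> l2 \<Rightarrow> l2" is "\<lambda>c f k. c * f k" by (rule ell2_scale)
definition cinner_l2 :: "l2 \<Rightarrow> l2 \<Rightarrow> complex" where "cinner_l2 = l2_inner"

instance
proof
  fix c d :: complex and x y z :: l2 and s :: real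
  show "c *\<^sub>C (x + y) = c *\<^sub>C x + c *\<^sub>C y" by transfer (simp add: algebra_simps)
  show "(c + d) *\<^sub>C x = c *\<^sub>C x + d *\<^sub>C x" by transfer (simp add: algebra_simps)
  show "c *\<^sub>C (d *\<^sub>C x) = (c * d) *\<^sub>C x" by transfer (simp add: algebra_simps)
  show "s *\<^sub>R x = of_real s *\<^sub>C x" by transfer simp
  show "cinner x y = cnj (cinner y x)" unfolding cinner_l2_def by (rule l2_inner_commute)
  show "cinner x (y + z) = cinner x y + cinner x z" by (simp add: cinner_l2_def l2_inner_add_right)
  show "cinner x (c *\<^sub>C y) = c * cinner x y"
    unfolding cinner_l2_def
    by transfer (simp add: ell2_inner_def mult.left_commute infsum_cmult_right')
  show "inner x y = Re (cinner x y)" by (simp add: cinner_l2_def inner_l2_def)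
qed

end

lemma cinner_coord: "cinner x y = ell2_inner (coord x) (coord y)"
  by (simp add: cinner_l2_def l2_inner.rep_eq)

lift_definition ket :: "int \<Rightarrow> l2" is "\<lambda>j k. if k = j then 1 else 0"
proof -
  fix j :: int
  have "(\<lambda>k::int. if k = j then 1 else 0 :: complex) \<in> ell2 \<longleftrightarrow>
     (\<lambda>k. (cmod (if k = j then 1 else 0))\<^sup>2) summable_on {j}"
    unfolding ell2_def mem_Collect_eq by (rule summable_on_cong_neutral) auto
  thus "(\<lambda>k::int. if k = j then 1 else 0 :: complex) \<in> ell2" by simp
qed

lemma cinner_ket: "cinner (ket j) x = coord x j"
proof -
  have "cinner (ket j) x = (\<Sum>\<^sub>\<infinity>k. cnj (if k = j then 1 else 0) * coord x k)"
    by (simp add: cinner_coord ell2_inner_def ket.rep_eq)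
  also have "\<dots> = (\<Sum>\<^sub>\<infinity>k\<in>{j}. cnj (if k = j then 1 else 0) * coord x k)"
    by (rule infsum_cong_neutral) auto
  finally show ?thesis by simp
qed


section \<open>Spectral resolutions over the angle\<close>

text \<open>The discontinuities lie on the nonnegative real axis, where \<open>Arg2pi\<close>
  vanishes; cutting that ray out with an indicator leaves the function unchanged.\<close>

lemma Arg2pi_measurable [measurable]: "Arg2pi \<in> borel_measurable borel"
proof -
  let ?R = "\<real>\<^sub>\<ge>\<^sub>0 :: complex set"
  have [measurable]: "- ?R \<in> sets borel"
    by (intro borel_open) (simp add: open_Compl)
  have "continuous_on (- ?R) Arg2pi"
    by (intro continuous_at_imp_continuous_on ballI continuous_at_Arg2pi) auto
  hence "(\<lambda>z. indicator (- ?R) z *\<^sub>R Arg2pi z) \<in> borel_measurable borel"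
    by (intro borel_measurable_continuous_on_indicator) auto
  moreover have "(\<lambda>z. indicator (- ?R) z *\<^sub>R Arg2pi z) = Arg2pi"
  proof
    fix z show "indicator (- ?R) z *\<^sub>R Arg2pi z = Arg2pi z"
      using Arg2pi_eq_0[of z] by (auto simp: indicator_def complex_nonneg_Reals_iff complex_is_Real_iff)
  qed
  ultimately show ?thesis by (simp only:)
qed

lemma cis_Arg2pi: "cmod z = 1 \<Longrightarrow> cis (Arg2pi z) = z"
  by (simp add: complex_norm_eq_1_exp cis_conv_exp)

lemma space_angle: "space angle_space = {0..<2 * pi}"
  by (simp add: angle_space_def space_restrict_space)

lemma sets_angle: "B \<in> sets angle_space \<longleftrightarrow> B \<in> sets borel \<and> B \<subseteq> {0..<2 * pi}"
  by (auto simp: angle_space_def sets_restrict_space_iff)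

lemma Arg2pi_measurable_angle: "Arg2pi \<in> borel \<rightarrow>\<^sub>M angle_space"
  unfolding angle_space_def
  by (rule measurable_restrict_space2) (auto simp: Arg2pi_ge_0 Arg2pi_lt_2pi)

lemma Arg2pi_vimage_borel: "B \<in> sets angle_space \<Longrightarrow> Arg2pi -` B \<in> sets borel"
  using measurable_sets[OF Arg2pi_measurable_angle] by simp

text \<open>The set of angles is covered by the countably many translates of B by multiples of 2
  pi.\<close>

lemma negligible_Arg2pi_vimage:
  assumes "B \<in> null_sets angle_space"
  shows "negligible {x. cis x \<in> Arg2pi -` B}"
proof -
  have B: "B \<in> sets borel" "B \<subseteq> {0..<2 * pi}" using assms by (auto simp: null_sets_def sets_angle)
  have "emeasure lborel B = 0"
    using assms B(2) by (simp add: null_sets_def angle_space_def emeasure_restrict_space)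
  hence "negligible B" using B(1) by (simp add: negligible_iff_emeasure0)
  hence n: "negligible (\<Union>k::int. (+) (of_int k * (2 * pi)) ` B)"
    by (intro negligible_countable_Union) (auto intro!: negligible_translation)
  show ?thesis
  proof (rule negligible_subset[OF n], rule subsetI)
    fix x assume "x \<in> {x. cis x \<in> Arg2pi -` B}"
    hence b: "Arg2pi (cis x) \<in> B" by simp
    have "cis (Arg2pi (cis x)) = cis x" by (simp add: cis_Arg2pi)
    hence "sin x = sin (Arg2pi (cis x)) \<and> cos x = cos (Arg2pi (cis x))" by (simp add: complex_eq_iff)
    then obtain k :: int where "x = Arg2pi (cis x) + 2 * pi * of_int k"
      using sin_cos_eq_iff by blast
    hence "x = of_int k * (2 * pi) + Arg2pi (cis x)" by (metis add.commute mult.commute)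
    with b show "x \<in> (\<Union>k::int. (+) (of_int k * (2 * pi)) ` B)" by blast
  qed
qed

context unitary_pair
begin

text \<open>Expresses mixed matrix elements through four finite measures, whose countable additivity
  then passes to the projections.\<close>

lemma spectral_proj_polarization:
  assumes "B \<in> sets borel"
  shows "4 * cinner g (spectral_proj B f) = of_real (measure (spectral_measure (g + f)) B) - of_real (measure (spectral_measure (g - f)) B)
    - \<i> * of_real (measure (spectral_measure (g + \<i> *\<^sub>C f)) B) + \<i> * of_real (measure (spectral_measure (g - \<i> *\<^sub>C f)) B)"
proof -
  have "cinner g (spectral_proj B f) = cinner (spectral_proj B g) (spectral_proj B f)"
    by (simp add: spectral_proj_self_adjoint spectral_proj_mult assms)
  thus ?thesis
    using cinner_polarization[of "spectral_proj B g" "spectral_proj B f"]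
    by (simp only: norm_spectral_proj[OF assms, symmetric] spectral_proj_add[OF assms] spectral_proj_diff[OF assms] spectral_proj_scaleC[OF assms])
qed

lemma spectral_proj_sums:
  fixes A :: "nat \<Rightarrow> complex set"
  assumes A: "range A \<subseteq> sets borel" "disjoint_family A"
  shows "(\<lambda>i. cinner g (spectral_proj (A i) f)) sums cinner g (spectral_proj (\<Union>i. A i) f)"
proof -
  have s: "(\<lambda>i. complex_of_real (measure (spectral_measure h) (A i))) sums of_real (measure (spectral_measure h) (\<Union>i. A i))" for h
    by (intro sums_of_real finite_measure.finite_measure_UNION finite_spectral_measure) (use A in auto)
  have UA: "(\<Union>i. A i) \<in> sets borel" using A(1) by (intro sets.countable_UN) auto
  have "(\<lambda>i. 4 * cinner g (spectral_proj (A i) f)) sums (4 * cinner g (spectral_proj (\<Union>i. A i) f))"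
    using A(1) unfolding spectral_proj_polarization[OF UA]
    by (subst spectral_proj_polarization) (auto intro!: sums_add sums_diff sums_mult s)
  from sums_mult[OF this, of "1/4"] show ?thesis by simp
qed

lemma integral_spectral_measure_id: "(LINT z|spectral_measure f. z) = cinner f (U f)"
  by (rule trig_integral[OF spectral_measure_moments trig_U])

end

definition seq_operator :: "seq_op \<Rightarrow> (l2 \<Rightarrow> l2) \<Rightarrow> bool" where
  "seq_operator F G \<longleftrightarrow> (\<forall>x. F (coord x) = coord (G x))"

lemma seq_operator_ell2: "seq_operator F G \<Longrightarrow> f \<in> ell2 \<Longrightarrow> F f = coord (G (Abs_l2 f))"
  unfolding seq_operator_def by (metis coord_Abs)

lemma ell2_inner_Abs: "f \<in> ell2 \<Longrightarrow> g \<in> ell2 \<Longrightarrow> ell2_inner f g = cinner (Abs_l2 f) (Abs_l2 g)"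
  by (simp add: cinner_coord coord_Abs)

lemma Abs_l2_coord [simp]: "Abs_l2 (coord x) = x"
  by (rule coord_inverse)

lemma linear_op_seq_operator:
  assumes F: "seq_operator F G" and "\<And>x y. G (x + y) = G x + G y" and "\<And>c x. G (c *\<^sub>C x) = c *\<^sub>C G x"
  shows "linear_op F"
  unfolding linear_op_def
proof (intro conjI ballI allI)
  note e = seq_operator_ell2[OF F]
  fix f g :: "int \<Rightarrow> complex" and c assume f: "f \<in> ell2"
  show "F f \<in> ell2" by (simp add: e[OF f])
  have "Abs_l2 (\<lambda>k. c * f k) = c *\<^sub>C Abs_l2 f"
    by (rule l2_eqI) (simp add: scaleC_l2.rep_eq coord_Abs f ell2_scale)
  thus "F (\<lambda>k. c * f k) = (\<lambda>k. c * F f k)"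
    by (simp add: e[OF f] e[OF ell2_scale[OF f]] assms(3) scaleC_l2.rep_eq)
  assume g: "g \<in> ell2"
  have "Abs_l2 (\<lambda>k. f k + g k) = Abs_l2 f + Abs_l2 g"
    by (rule l2_eqI) (simp add: plus_l2.rep_eq coord_Abs f g ell2_add)
  thus "F (\<lambda>k. f k + g k) = (\<lambda>k. F f k + F g k)"
    by (simp add: e[OF f] e[OF g] e[OF ell2_add[OF f g]] assms(2) plus_l2.rep_eq)
qed

locale l2_unitary = unitary_pair U V for U V :: "l2 \<Rightarrow> l2" +
  fixes F :: seq_op
  assumes F: "seq_operator F U"
begin

lemma unitary_op_F: "unitary_op F"
  unfolding unitary_op_def
proof (intro conjI ballI)
  show "linear_op F" by (rule linear_op_seq_operator[OF F U_add U_scaleC])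
  note e = seq_operator_ell2[OF F]
  show "F ` ell2 = ell2"
  proof
    show "F ` ell2 \<subseteq> ell2" by (auto simp: e)
    show "ell2 \<subseteq> F ` ell2"
    proof
      fix f :: "int \<Rightarrow> complex" assume f: "f \<in> ell2"
      have "f = F (coord (V (Abs_l2 f)))" using F by (simp add: seq_operator_def coord_Abs f)
      thus "f \<in> F ` ell2" by (metis coord_ell2 image_eqI)
    qed
  qed
  fix f g :: "int \<Rightarrow> complex" assume "f \<in> ell2" "g \<in> ell2"
  thus "ell2_inner (F f) (F g) = ell2_inner f g"
    by (simp add: e ell2_inner_Abs U_isometry)
qed

text \<open>Transport from the circle to the angle. \<open>Arg2pi\<close> takes every complex number
  into [0, 2 pi), so the full angle space pulls back to the whole plane.\<close>

definition resolution :: "real set \<Rightarrow> seq_op" where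
  "resolution B f = coord (spectral_proj (Arg2pi -` B) (Abs_l2 f))"

lemma resolution_seq_operator: "seq_operator (resolution B) (spectral_proj (Arg2pi -` B))"
  by (simp add: seq_operator_def resolution_def)

lemma projection_valued_measure_resolution: "projection_valued_measure angle_space resolution"
  unfolding projection_valued_measure_def
proof (intro conjI ballI allI impI)
  note m = Arg2pi_vimage_borel
  fix f :: "int \<Rightarrow> complex" assume f: "f \<in> ell2"
  have "norm (spectral_proj {} (Abs_l2 f)) = 0" using norm_spectral_proj[of "{}" "Abs_l2 f"] by simp
  thus "resolution {} f = (\<lambda>k. 0)" by (simp add: resolution_def zero_l2.rep_eq)
  have "Arg2pi -` space angle_space = UNIV" by (auto simp: space_angle Arg2pi_ge_0 Arg2pi_lt_2pi)
  thus "resolution (space angle_space) f = f" by (simp add: resolution_def spectral_proj_UNIV coord_Abs f)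
  fix A B assume "A \<in> sets angle_space" "B \<in> sets angle_space"
  thus "resolution (A \<inter> B) f = resolution A (resolution B f)"
    by (simp add: resolution_def spectral_proj_mult m)
next
  note m = Arg2pi_vimage_borel
  fix f g :: "int \<Rightarrow> complex" and A :: "nat \<Rightarrow> real set"
  assume f: "f \<in> ell2" and g: "g \<in> ell2" and A: "range A \<subseteq> sets angle_space" "disjoint_family A"
  have "(\<lambda>i. cinner (Abs_l2 g) (spectral_proj (Arg2pi -` A i) (Abs_l2 f))) sums
      cinner (Abs_l2 g) (spectral_proj (\<Union>i. Arg2pi -` A i) (Abs_l2 f))"
    by (rule spectral_proj_sums) (use A m in \<open>auto simp: disjoint_family_on_def\<close>)
  moreover have "(\<Union>i. Arg2pi -` A i) = Arg2pi -` (\<Union>i. A i)" by auto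
  ultimately show "(\<lambda>i. ell2_inner g (resolution (A i) f)) sums ell2_inner g (resolution (\<Union>i. A i) f)"
    by (simp add: resolution_def ell2_inner_Abs g)
next
  fix A assume A: "A \<in> sets angle_space"
  note m = Arg2pi_vimage_borel[OF A]
  show "orthogonal_projection (resolution A)"
    unfolding orthogonal_projection_def
    using linear_op_seq_operator[OF resolution_seq_operator spectral_proj_add[OF m] spectral_proj_scaleC[OF m]]
    by (auto simp: resolution_def spectral_proj_mult[OF m m] ell2_inner_Abs spectral_proj_self_adjoint[OF m])
qed

text \<open>\<open>measure_of\<close> returns the prescribed values only for a set function known to
  be a measure; the push-forward supplies that measure. Integrals and null sets can then be handled
  on the circle.\<close>

lemma scalar_measure_resolution:
  assumes f: "f \<in> ell2"
  shows "scalar_measure angle_space resolution f = distr (spectral_measure (Abs_l2 f)) angle_space Arg2pi"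
    (is "_ = ?D")
proof -
  have meas: "Arg2pi \<in> spectral_measure (Abs_l2 f) \<rightarrow>\<^sub>M angle_space"
    using Arg2pi_measurable_angle by (simp cong: measurable_cong_sets)
  interpret finite_measure "spectral_measure (Abs_l2 f)" by (rule finite_spectral_measure)
  have "?D = measure_of (space ?D) (sets ?D) (emeasure ?D)" by (rule measure_of_of_measure[symmetric])
  also have "\<dots> = measure_of (space angle_space) (sets angle_space) (emeasure ?D)" by simp
  also have "\<dots> = measure_of (space angle_space) (sets angle_space)
      (\<lambda>B. ennreal (Re (ell2_inner f (resolution B f))))"
  proof (rule measure_of_eq)
    show "sets angle_space \<subseteq> Pow (space angle_space)" by (rule sets.space_closed)
    fix B assume "B \<in> sigma_sets (space angle_space) (sets angle_space)"
    hence B: "B \<in> sets angle_space" by (simp add: sets.sigma_sets_eq)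
    show "emeasure ?D B = ennreal (Re (ell2_inner f (resolution B f)))"
      using B by (simp add: emeasure_distr[OF meas B] emeasure_eq_measure resolution_def
          ell2_inner_Abs f cinner_spectral_proj Arg2pi_vimage_borel)
  qed
  finally show ?thesis by (simp add: scalar_measure_def)
qed

lemma spectral_resolution_F: "spectral_resolution F resolution"
  unfolding spectral_resolution_def
proof (intro conjI ballI projection_valued_measure_resolution)
  fix f :: "int \<Rightarrow> complex" assume f: "f \<in> ell2"
  let ?M = "spectral_measure (Abs_l2 f)"
  have meas: "Arg2pi \<in> ?M \<rightarrow>\<^sub>M angle_space"
    using Arg2pi_measurable_angle by (simp cong: measurable_cong_sets)
  have c: "cis \<in> borel_measurable borel"
    by (intro borel_measurable_continuous_onI continuous_intros)
  hence "cis \<in> borel_measurable angle_space"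
    unfolding angle_space_def by (intro measurable_restrict_space1) simp
  hence "(LINT x|scalar_measure angle_space resolution f. cis x) = (LINT z|?M. cis (Arg2pi z))"
    unfolding scalar_measure_resolution[OF f] by (rule integral_distr[OF meas])
  also have "\<dots> = (LINT z|?M. z)"
  proof (rule integral_cong_AE)
    show "AE z in ?M. cis (Arg2pi z) = z"
    proof -
      have "AE z in ?M. cmod z = 1" using spectral_measure_circle by (simp add: circle_measure_def)
      thus ?thesis by eventually_elim (rule cis_Arg2pi)
    qed
    show "(\<lambda>z. cis (Arg2pi z)) \<in> borel_measurable ?M"
      using measurable_compose[OF Arg2pi_measurable c] by (simp cong: measurable_cong_sets)
  qed (simp cong: measurable_cong_sets)
  also have "\<dots> = ell2_inner f (F f)"
    by (simp add: integral_spectral_measure_id seq_operator_ell2[OF F] ell2_inner_Abs f)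
  finally show "ell2_inner f (F f) = (LINT x|scalar_measure angle_space resolution f. cis x)" by simp
qed

text \<open>Basis vectors suffice: by self-adjointness the j-th coordinate of a projected vector is
  its inner product with the projection of \<open>ket j\<close>.\<close>

lemma purely_absolutely_continuousI:
  assumes null: "\<And>B j. B \<in> sets borel \<Longrightarrow> negligible {x. cis x \<in> B} \<Longrightarrow> spectral_proj B (ket j) = 0"
  shows "purely_absolutely_continuous F"
  unfolding purely_absolutely_continuous_def
proof (intro exI[of _ resolution] conjI ballI)
  show "spectral_resolution F resolution" by (rule spectral_resolution_F)
next
  fix f :: "int \<Rightarrow> complex" assume f: "f \<in> ell2"
  interpret finite_measure "spectral_measure (Abs_l2 f)" by (rule finite_spectral_measure)
  have meas: "Arg2pi \<in> spectral_measure (Abs_l2 f) \<rightarrow>\<^sub>M angle_space"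
    using Arg2pi_measurable_angle by (simp cong: measurable_cong_sets)
  show "absolutely_continuous angle_space (scalar_measure angle_space resolution f)"
    unfolding absolutely_continuous_def scalar_measure_resolution[OF f]
  proof
    fix B assume B: "B \<in> null_sets angle_space"
    hence sB: "B \<in> sets angle_space" by auto
    define A where "A = Arg2pi -` B"
    have A: "A \<in> sets borel" unfolding A_def by (rule Arg2pi_vimage_borel[OF sB])
    have "coord (spectral_proj A x) j = 0" for x j
    proof -
      have "coord (spectral_proj A x) j = cinner (spectral_proj A (ket j)) x"
        by (simp add: spectral_proj_self_adjoint[OF A] cinner_ket)
      thus ?thesis using null[OF A] negligible_Arg2pi_vimage[OF B] by (simp add: A_def)
    qed
    hence "spectral_proj A (Abs_l2 f) = 0" by (intro l2_eqI) (simp add: zero_l2.rep_eq)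
    hence "measure (spectral_measure (Abs_l2 f)) A = 0" using norm_spectral_proj[OF A, of "Abs_l2 f"] by simp
    thus "B \<in> null_sets (distr (spectral_measure (Abs_l2 f)) angle_space Arg2pi)"
      using sB by (simp add: null_sets_def emeasure_distr[OF meas] emeasure_eq_measure A_def)
  qed
qed

end

section \<open>Block operators and magnetic shifts\<close>

lemma ell2_bounded_mult:
  assumes f: "f \<in> ell2" and K: "\<And>k. cmod (c k) \<le> K"
  shows "(\<lambda>k. c k * f k) \<in> ell2"
proof (rule ell2_comparison)
  show "(\<lambda>k. K\<^sup>2 * (cmod (f k))\<^sup>2) summable_on UNIV"
    using f by (intro summable_on_cmult_right) (simp add: ell2_def)
  show "(cmod (c k * f k))\<^sup>2 \<le> K\<^sup>2 * (cmod (f k))\<^sup>2" for k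
    by (simp add: norm_mult power_mult_distrib K power_mono mult_right_mono)
qed

lemma ell2_reindex:
  assumes f: "f \<in> ell2" and b: "bij \<pi>"
  shows "(\<lambda>k. f (\<pi> k)) \<in> ell2"
  using f summable_on_reindex_bij_betw[OF b, of "\<lambda>k. (cmod (f k))\<^sup>2"] by (simp add: ell2_def)

section \<open>Unitary blocks\<close>

definition adjoint2 :: "complex^2^2 \<Rightarrow> complex^2^2" where
  "adjoint2 S = vector [vector [cnj (S $ 1 $ 1), cnj (S $ 2 $ 1)], vector [cnj (S $ 1 $ 2), cnj (S $ 2 $ 2)]]"

definition unitary2 :: "complex^2^2 \<Rightarrow> bool" where
  "unitary2 S \<longleftrightarrow> adjoint2 S ** S = mat 1 \<and> S ** adjoint2 S = mat 1"

lemma adjoint2_adjoint2 [simp]: "adjoint2 (adjoint2 S) = S"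
  by (simp add: adjoint2_def vec_eq_iff forall_2)

lemma unitary2_adjoint2: "unitary2 S \<Longrightarrow> unitary2 (adjoint2 S)"
  by (simp add: unitary2_def)

lemma unitary2_entry_le:
  assumes "unitary2 S"
  shows "cmod (S $ i $ j) \<le> 1"
proof -
  have "S ** adjoint2 S = mat 1" using assms by (simp add: unitary2_def)
  hence "S $ i $ 1 * cnj (S $ i $ 1) + S $ i $ 2 * cnj (S $ i $ 2) = 1"
    using exhaust_2[of i] by (auto simp: vec_eq_iff forall_2 matrix_matrix_mult_def sum_2 adjoint2_def mat_def)
  hence "complex_of_real ((cmod (S $ i $ 1))\<^sup>2 + (cmod (S $ i $ 2))\<^sup>2) = 1"
    by (simp only: complex_norm_square of_real_add)
  hence "(cmod (S $ i $ 1))\<^sup>2 + (cmod (S $ i $ 2))\<^sup>2 = 1" by (simp only: of_real_eq_1_iff)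
  hence "(cmod (S $ i $ j))\<^sup>2 \<le> 1"
    using exhaust_2[of j] zero_le_power2[of "cmod (S $ i $ 1)"] zero_le_power2[of "cmod (S $ i $ 2)"]
    by (elim disjE; simp only:; linarith)
  thus ?thesis by (simp add: abs_square_le_1)
qed

definition partner :: "int \<Rightarrow> int \<Rightarrow> int" where
  "partner q j = (if even (j - q) then j + 1 else j - 1)"

lemma partner_partner [simp]: "partner q (partner q j) = j"
  by (auto simp: partner_def)

lemma bij_partner: "bij (partner q)"
  by (rule bij_betw_byWitness[where f' = "partner q"]) auto

definition diag_entry :: "int \<Rightarrow> (int \<Rightarrow> complex^2^2) \<Rightarrow> int \<Rightarrow> complex" where
  "diag_entry q S j = (if even (j - q) then S j $ 1 $ 1 else S (j - 1) $ 2 $ 2)"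

definition offdiag_entry :: "int \<Rightarrow> (int \<Rightarrow> complex^2^2) \<Rightarrow> int \<Rightarrow> complex" where
  "offdiag_entry q S j = (if even (j - q) then S j $ 1 $ 2 else S (j - 1) $ 2 $ 1)"

text \<open>A block operator is a diagonal multiplication plus a weighted involution, so
  boundedness, adjoints and commutation can be checked site by site.\<close>

lemma block_op_eq:
  "block_op q S f j = diag_entry q S j * f j + offdiag_entry q S j * f (partner q j)"
  by (auto simp: block_op_def diag_entry_def offdiag_entry_def partner_def matrix_vector_mult_def sum_2 algebra_simps)

lemma diag_entry_adjoint2: "diag_entry q (\<lambda>j. adjoint2 (S j)) j = cnj (diag_entry q S j)"
  by (simp add: diag_entry_def adjoint2_def)

lemma offdiag_entry_adjoint2:
  "offdiag_entry q (\<lambda>j. adjoint2 (S j)) j = cnj (offdiag_entry q S (partner q j))"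
  by (auto simp: offdiag_entry_def adjoint2_def partner_def)

lemma block_op_ell2:
  assumes S: "\<And>j. unitary2 (S j)" and f: "f \<in> ell2"
  shows "block_op q S f \<in> ell2"
proof -
  have "(\<lambda>j. diag_entry q S j * f j + offdiag_entry q S j * f (partner q j)) \<in> ell2"
    using unitary2_entry_le[OF S]
    by (intro ell2_add ell2_bounded_mult[of _ _ 1] f ell2_reindex[OF f bij_partner])
       (auto simp: diag_entry_def offdiag_entry_def)
  thus ?thesis by (simp add: block_op_eq[abs_def])
qed

text \<open>The off-diagonal sum is reindexed by the involution \<open>partner q\<close>, which
  moves the conjugated weights to the other argument.\<close>

lemma block_op_adjoint:
  assumes S: "\<And>j. unitary2 (S j)" and f: "f \<in> ell2" and g: "g \<in> ell2"
  shows "ell2_inner (block_op q S f) g = ell2_inner f (block_op q (\<lambda>j. adjoint2 (S j)) g)"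
proof -
  let ?A = "diag_entry q S" and ?B = "offdiag_entry q S" and ?p = "partner q"
  have A: "cmod (?A j) \<le> 1" and B: "cmod (?B j) \<le> 1" for j
    using unitary2_entry_le[OF S] by (auto simp: diag_entry_def offdiag_entry_def)
  have A': "(\<lambda>j. cnj (?A j) * g j) \<in> ell2"
    by (rule ell2_bounded_mult[OF g, of _ 1]) (simp add: A)
  have B': "(\<lambda>j. cnj (?B j) * g j) \<in> ell2"
    by (rule ell2_bounded_mult[OF g, of _ 1]) (simp add: B)
  have sA: "(\<lambda>j. cnj (f j) * (cnj (?A j) * g j)) summable_on UNIV"
    by (rule ell2_product_summable[OF f A'])
  have sB: "(\<lambda>j. cnj (f (?p j)) * (cnj (?B j) * g j)) summable_on UNIV"
    by (rule ell2_product_summable[OF ell2_reindex[OF f bij_partner] B'])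
  have sB': "(\<lambda>j. cnj (f j) * (cnj (?B (?p j)) * g (?p j))) summable_on UNIV"
    by (rule ell2_product_summable[OF f ell2_reindex[OF B' bij_partner]])
  have "ell2_inner (block_op q S f) g =
     (\<Sum>\<^sub>\<infinity>j. cnj (f j) * (cnj (?A j) * g j) + cnj (f (?p j)) * (cnj (?B j) * g j))"
    unfolding ell2_inner_def block_op_eq by (intro infsum_cong) (simp add: algebra_simps)
  also have "\<dots> = (\<Sum>\<^sub>\<infinity>j. cnj (f j) * (cnj (?A j) * g j)) + (\<Sum>\<^sub>\<infinity>j. cnj (f (?p j)) * (cnj (?B j) * g j))"
    by (rule infsum_add[OF sA sB])
  also have "(\<Sum>\<^sub>\<infinity>j. cnj (f (?p j)) * (cnj (?B j) * g j)) = (\<Sum>\<^sub>\<infinity>j. cnj (f j) * (cnj (?B (?p j)) * g (?p j)))"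
    using infsum_reindex_bij_betw[OF bij_partner, of "\<lambda>j. cnj (f (?p j)) * (cnj (?B j) * g j)" q] by simp
  also have "(\<Sum>\<^sub>\<infinity>j. cnj (f j) * (cnj (?A j) * g j)) + \<dots> =
     (\<Sum>\<^sub>\<infinity>j. cnj (f j) * (cnj (?A j) * g j) + cnj (f j) * (cnj (?B (?p j)) * g (?p j)))"
    by (rule infsum_add[OF sA sB', symmetric])
  also have "\<dots> = ell2_inner f (block_op q (\<lambda>j. adjoint2 (S j)) g)"
    unfolding ell2_inner_def block_op_eq diag_entry_adjoint2 offdiag_entry_adjoint2
    by (intro infsum_cong) (simp add: algebra_simps)
  finally show ?thesis .
qed

lemma block_op_adjoint_cancel:
  assumes S: "\<And>j. unitary2 (S j)"
  shows "block_op q (\<lambda>j. adjoint2 (S j)) (block_op q S f) = f"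
proof
  fix j
  have m: "adjoint2 (S i) ** S i = mat 1" for i using S by (simp add: unitary2_def)
  have e: "cnj (S i $ 1 $ 1) * S i $ 1 $ 1 + cnj (S i $ 2 $ 1) * S i $ 2 $ 1 = 1"
     "cnj (S i $ 1 $ 1) * S i $ 1 $ 2 + cnj (S i $ 2 $ 1) * S i $ 2 $ 2 = 0"
     "cnj (S i $ 1 $ 2) * S i $ 1 $ 1 + cnj (S i $ 2 $ 2) * S i $ 2 $ 1 = 0"
     "cnj (S i $ 1 $ 2) * S i $ 1 $ 2 + cnj (S i $ 2 $ 2) * S i $ 2 $ 2 = 1" for i
    using m[of i] by (auto simp: vec_eq_iff forall_2 matrix_matrix_mult_def sum_2 adjoint2_def mat_def)
  have l: "a * (b * x + c * y) + d * (u * y + v * x) = x"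
    if "a * b + d * v = 1" "a * c + d * u = 0" for a b c d u v x y :: complex
  proof -
    have "a * (b * x + c * y) + d * (u * y + v * x) = (a * b + d * v) * x + (a * c + d * u) * y"
      by (simp add: algebra_simps)
    thus ?thesis using that by simp
  qed
  show "block_op q (\<lambda>j. adjoint2 (S j)) (block_op q S f) j = f j"
    unfolding block_op_eq diag_entry_adjoint2 offdiag_entry_adjoint2 partner_partner
  proof (rule l)
    show "cnj (diag_entry q S j) * diag_entry q S j +
        cnj (offdiag_entry q S (partner q j)) * offdiag_entry q S (partner q j) = 1"
      using e[of j] e[of "j - 1"]
      by (auto simp: diag_entry_def offdiag_entry_def partner_def add.commute)
    show "cnj (diag_entry q S j) * offdiag_entry q S j +
        cnj (offdiag_entry q S (partner q j)) * diag_entry q S (partner q j) = 0"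
      using e[of j] e[of "j - 1"]
      by (auto simp: diag_entry_def offdiag_entry_def partner_def add.commute)
  qed
qed

definition block :: "int \<Rightarrow> (int \<Rightarrow> complex^2^2) \<Rightarrow> l2 \<Rightarrow> l2" where
  "block q S x = Abs_l2 (block_op q S (coord x))"

lemma coord_block: "(\<And>j. unitary2 (S j)) \<Longrightarrow> coord (block q S x) = block_op q S (coord x)"
  unfolding block_def by (intro coord_Abs block_op_ell2) auto

lemma block_unitary_pair:
  assumes S: "\<And>j. unitary2 (S j)"
  shows "unitary_pair (block q S) (block q (\<lambda>j. adjoint2 (S j)))"
proof
  have S': "\<And>j. unitary2 (adjoint2 (S j))" using S by (rule unitary2_adjoint2)
  note c = coord_block[of S q, OF S] coord_block[of "\<lambda>j. adjoint2 (S j)" q, OF S']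
  fix x y :: l2 and d :: complex
  show "block q S (x + y) = block q S x + block q S y"
    by (rule l2_eqI) (simp add: c plus_l2.rep_eq block_op_eq algebra_simps)
  show "block q S (d *\<^sub>C x) = d *\<^sub>C block q S x"
    by (rule l2_eqI) (simp add: c scaleC_l2.rep_eq block_op_eq algebra_simps)
  show 1: "block q (\<lambda>j. adjoint2 (S j)) (block q S x) = x" for x
    by (rule l2_eqI) (simp add: c block_op_adjoint_cancel[OF S])
  show "block q S (block q (\<lambda>j. adjoint2 (S j)) x) = x"
    using block_op_adjoint_cancel[of "\<lambda>j. adjoint2 (S j)", OF S'] by (intro l2_eqI) (simp add: c)
  show "cinner (block q S x) (block q S y) = cinner x y"
    using arg_cong[OF 1[of y], of "cinner x"]
    by (simp add: cinner_coord c block_op_adjoint[of S, OF S] block_op_ell2[of S, OF S])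
qed

lemma unitary_pair_comp:
  assumes "unitary_pair U V" and "unitary_pair U' V'"
  shows "unitary_pair (\<lambda>x. U (U' x)) (\<lambda>x. V' (V x))"
proof -
  interpret A: unitary_pair U V by (rule assms(1))
  interpret B: unitary_pair U' V' by (rule assms(2))
  show ?thesis
    by standard (simp_all add: A.U_add B.U_add A.U_scaleC B.U_scaleC A.U_isometry B.U_isometry)
qed

text \<open>The phase is that of the source site, as \<open>magnetic_shift_ket\<close>
  shows.\<close>

definition magnetic_shift :: "(int \<Rightarrow> complex) \<Rightarrow> int \<Rightarrow> l2 \<Rightarrow> l2" where
  "magnetic_shift w L x = Abs_l2 (\<lambda>j. w (j - L) * coord x (j - L))"

lemma bij_int_shift: "bij (\<lambda>j::int. j - L)"
  by (rule bij_betw_byWitness[where f' = "\<lambda>j. j + L"]) auto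

lemma coord_magnetic_shift:
  assumes "\<And>j. cmod (w j) = 1"
  shows "coord (magnetic_shift w L x) = (\<lambda>j. w (j - L) * coord x (j - L))"
  unfolding magnetic_shift_def
  by (intro coord_Abs ell2_bounded_mult[of _ _ 1] ell2_reindex[OF _ bij_int_shift]) (simp_all add: assms)

lemma magnetic_shift_unitary_pair:
  assumes w: "\<And>j. cmod (w j) = 1"
  shows "unitary_pair (magnetic_shift w L) (magnetic_shift (\<lambda>j. cnj (w (j - L))) (- L))"
proof
  have w': "cmod (cnj (w (j - L))) = 1" for j by (simp add: w)
  note c = coord_magnetic_shift[of w, OF w] coord_magnetic_shift[of "\<lambda>j. cnj (w (j - L))", OF w']
  have u: "w j * cnj (w j) = 1" "cnj (w j) * w j = 1" for j
    using w[of j] by (simp_all add: complex_norm_square[symmetric] mult.commute)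
  fix x y :: l2 and d :: complex
  show "magnetic_shift w L (x + y) = magnetic_shift w L x + magnetic_shift w L y"
    by (rule l2_eqI) (simp add: c plus_l2.rep_eq algebra_simps)
  show "magnetic_shift w L (d *\<^sub>C x) = d *\<^sub>C magnetic_shift w L x"
    by (rule l2_eqI) (simp add: c scaleC_l2.rep_eq algebra_simps)
  show "magnetic_shift w L (magnetic_shift (\<lambda>j. cnj (w (j - L))) (- L) x) = x"
    by (rule l2_eqI) (simp add: c mult.assoc[symmetric] u)
  show "magnetic_shift (\<lambda>j. cnj (w (j - L))) (- L) (magnetic_shift w L x) = x"
    by (rule l2_eqI) (simp add: c mult.assoc[symmetric] u)
  have "cinner (magnetic_shift w L x) (magnetic_shift w L y)
     = (\<Sum>\<^sub>\<infinity>j. cnj (coord x (j - L)) * coord y (j - L))"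
    unfolding cinner_coord ell2_inner_def c
  proof (rule infsum_cong)
    fix j
    have "cnj (w (j - L) * coord x (j - L)) * (w (j - L) * coord y (j - L))
      = (cnj (w (j - L)) * w (j - L)) * (cnj (coord x (j - L)) * coord y (j - L))" by (simp add: mult_ac)
    thus "cnj (w (j - L) * coord x (j - L)) * (w (j - L) * coord y (j - L))
      = cnj (coord x (j - L)) * coord y (j - L)" by (simp add: u)
  qed
  also have "\<dots> = cinner x y"
    unfolding cinner_coord ell2_inner_def
    by (rule infsum_reindex_bij_betw[OF bij_int_shift, of "\<lambda>j. cnj (coord x j) * coord y j"])
  finally show "cinner (magnetic_shift w L x) (magnetic_shift w L y) = cinner x y" .
qed

lemma magnetic_shift_ket:
  assumes "\<And>j. cmod (w j) = 1"
  shows "magnetic_shift w L (ket j) = w j *\<^sub>C ket (j + L)"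
  by (rule l2_eqI) (auto simp: coord_magnetic_shift[of w, OF assms] ket.rep_eq scaleC_l2.rep_eq)

text \<open>An intertwining with two different phase sequences, since one factor of U alone may
  change the phases; the second factor has to change them back. An even L keeps the pairing of
  sites.\<close>

lemma block_magnetic_shift:
  assumes S: "\<And>j. unitary2 (S j)" and v: "\<And>j. cmod (v j) = 1" and w: "\<And>j. cmod (w j) = 1"
    and "even L"
    and d: "\<And>j. diag_entry q S (j + L) * w j = v j * diag_entry q S j"
    and o: "\<And>j. offdiag_entry q S (j + L) * w (partner q j) = v j * offdiag_entry q S j"
  shows "block q S (magnetic_shift w L x) = magnetic_shift v L (block q S x)"
proof (rule l2_eqI)
  fix j
  have p: "partner q j - L = partner q (j - L)" using \<open>even L\<close> by (auto simp: partner_def)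
  show "coord (block q S (magnetic_shift w L x)) j = coord (magnetic_shift v L (block q S x)) j"
    using d[of "j - L"] o[of "j - L"]
    by (simp add: coord_block[of S, OF S] coord_magnetic_shift[of w, OF w] coord_magnetic_shift[of v, OF v]
        block_op_eq p distrib_left mult.assoc[symmetric])
qed

lemma block_ket_first:
  assumes S: "\<And>j. unitary2 (S j)" and "even (m - q)"
  shows "block q S (ket m) = S m $ 1 $ 1 *\<^sub>C ket m + S m $ 2 $ 1 *\<^sub>C ket (m + 1)"
  by (rule l2_eqI)
     (use assms(2) in \<open>auto simp: coord_block[of S, OF S] block_op_eq ket.rep_eq plus_l2.rep_eq scaleC_l2.rep_eq
       diag_entry_def offdiag_entry_def partner_def\<close>)

lemma block_ket_second:
  assumes S: "\<And>j. unitary2 (S j)" and "even (m - q)"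
  shows "block q S (ket (m + 1)) = S m $ 1 $ 2 *\<^sub>C ket m + S m $ 2 $ 2 *\<^sub>C ket (m + 1)"
  by (rule l2_eqI)
     (use assms(2) in \<open>auto simp: coord_block[of S, OF S] block_op_eq ket.rep_eq plus_l2.rep_eq scaleC_l2.rep_eq
       diag_entry_def offdiag_entry_def partner_def\<close>)

section \<open>Transfer matrices\<close>

context unitary_pair
begin

text \<open>\<open>transfer_rel x y x' y'\<close>: \<open>(x', y')\<close> arises from \<open>(x, y)\<close> by a transfer matrix with entries in
  \<open>\<complex>[U, U\<^sup>-\<^sup>1]\<close> and constant unimodular determinant.\<close>

definition transfer_rel :: "'a \<Rightarrow> 'a \<Rightarrow> 'a \<Rightarrow> 'a \<Rightarrow> bool" where
  "transfer_rel x y x' y' \<longleftrightarrow> (\<exists>a A b B c C d D \<kappa>. trig a A \<and> trig b B \<and> trig c C \<and> trig d D \<and> cmod \<kappa> = 1 \<and>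
     (\<forall>z. cmod z = 1 \<longrightarrow> a z * d z - b z * c z = \<kappa>) \<and> x' = A x + B y \<and> y' = C x + D y)"

lemma transfer_relI:
  assumes "trig a A" "trig b B" "trig c C" "trig d D" "cmod \<kappa> = 1"
    "\<And>z. cmod z = 1 \<Longrightarrow> a z * d z - b z * c z = \<kappa>" "x' = A x + B y" "y' = C x + D y"
  shows "transfer_rel x y x' y'"
  unfolding transfer_rel_def using assms by blast

text \<open>The matrices multiply, and so do their determinants, which stay constant on the
  circle.\<close>

lemma transfer_rel_trans:
  assumes "transfer_rel x y x' y'" and "transfer_rel x' y' x'' y''"
  shows "transfer_rel x y x'' y''"
proof -
  from assms(1) obtain a A b B c C d D \<kappa> where 1: "trig a A" "trig b B" "trig c C" "trig d D" "cmod \<kappa> = 1"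
    "\<And>z. cmod z = 1 \<Longrightarrow> a z * d z - b z * c z = \<kappa>" "x' = A x + B y" "y' = C x + D y"
    unfolding transfer_rel_def by blast
  from assms(2) obtain a' A' b' B' c' C' d' D' \<kappa>' where 2: "trig a' A'" "trig b' B'" "trig c' C'" "trig d' D'"
    "cmod \<kappa>' = 1" "\<And>z. cmod z = 1 \<Longrightarrow> a' z * d' z - b' z * c' z = \<kappa>'" "x'' = A' x' + B' y'" "y'' = C' x' + D' y'"
    unfolding transfer_rel_def by blast
  show ?thesis
  proof (rule transfer_relI)
    show "trig (\<lambda>z. a' z * a z + b' z * c z) (\<lambda>v. A' (A v) + B' (C v))"
      "trig (\<lambda>z. a' z * b z + b' z * d z) (\<lambda>v. A' (B v) + B' (D v))"
      "trig (\<lambda>z. c' z * a z + d' z * c z) (\<lambda>v. C' (A v) + D' (C v))"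
      "trig (\<lambda>z. c' z * b z + d' z * d z) (\<lambda>v. C' (B v) + D' (D v))"
      by (intro trig_add trig_mult 1 2)+
    show "cmod (\<kappa>' * \<kappa>) = 1" using 1(5) 2(5) by (simp add: norm_mult)
    fix z :: complex assume z: "cmod z = 1"
    have "(a' z * a z + b' z * c z) * (c' z * b z + d' z * d z) - (a' z * b z + b' z * d z) * (c' z * a z + d' z * c z)
      = (a' z * d' z - b' z * c' z) * (a z * d z - b z * c z)" by (simp add: algebra_simps)
    thus "(a' z * a z + b' z * c z) * (c' z * b z + d' z * d z) - (a' z * b z + b' z * d z) * (c' z * a z + d' z * c z)
      = \<kappa>' * \<kappa>" by (simp add: 1(6) 2(6) z)
  next
    show "x'' = A' (A x) + B' (C x) + (A' (B y) + B' (D y))"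
      by (simp add: 1 2 trig_additive[OF 2(1)] trig_additive[OF 2(2)] algebra_simps)
    show "y'' = C' (A x) + D' (C x) + (C' (B y) + D' (D y))"
      by (simp add: 1 2 trig_additive[OF 2(3)] trig_additive[OF 2(4)] algebra_simps)
  qed
qed

lemma transfer_rel_const:
  assumes "x' = a *\<^sub>C x + b *\<^sub>C y" and "y' = c *\<^sub>C x + d *\<^sub>C y" and "cmod (a * d - b * c) = 1"
  shows "transfer_rel x y x' y'"
  by (rule transfer_relI[OF trig_const trig_const trig_const trig_const assms(3) _ assms(1,2)]) simp

text \<open>The bound by the supremum over the circle, applied to p minus its constant value, is
  zero. It turns the determinant of a transfer matrix, given as a function, into a scalar
  operator.\<close>

lemma trig_unit_const:
  assumes P: "trig p P" and p: "\<And>z. cmod z = 1 \<Longrightarrow> p z = \<kappa>"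
  shows "P x = \<kappa> *\<^sub>C x"
proof -
  have "norm (P x - \<kappa> *\<^sub>C x) \<le> 0 * norm x"
    by (rule trig_norm_spectral_proj_le[OF _ trig_diff[OF P trig_const] spectral_proj_UNIV]) (simp_all add: p)
  thus ?thesis by simp
qed

end

context commuting_unitaries
begin

text \<open>The Cayley-Hamilton identity for the \<open>2 \<times> 2\<close> transfer matrix, whose entries commute with \<open>T\<close>.\<close>

lemma transfer_rel_quadratic:
  assumes "transfer_rel x y (T x) (T y)"
  obtains D D_op \<delta> where "trig D D_op" and "cmod \<delta> = 1" and "T (T x) - D_op (T x) + \<delta> *\<^sub>C x = 0"
proof -
  from assms obtain a A b B c C d D \<kappa> where 1: "trig a A" "trig b B" "trig c C" "trig d D" "cmod \<kappa> = 1"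
    "\<And>z. cmod z = 1 \<Longrightarrow> a z * d z - b z * c z = \<kappa>" and Tx: "T x = A x + B y" and Ty: "T y = C x + D y"
    unfolding transfer_rel_def by blast
  have DU: "D (U v) = U (D v)" for v
    by (rule trig_commute[OF U_diff U_scaleC _ 1(4), symmetric]) simp
  have DB: "D (B v) = B (D v)" and DA: "D (A v) = A (D v)" for v
    by (rule trig_commute[OF trig_diff_right[OF 1(4)] trig_scaleC[OF 1(4)] DU 1(2)],
        rule trig_commute[OF trig_diff_right[OF 1(4)] trig_scaleC[OF 1(4)] DU 1(1)])
  have k: "A (D x) - B (C x) = \<kappa> *\<^sub>C x"
    by (rule trig_unit_const[OF trig_diff[OF trig_mult[OF 1(1,4)] trig_mult[OF 1(2,3)]] 1(6)])
  have "T (T x) = T (A x + B y)" by (simp only: Tx)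
  also have "\<dots> = A (T x) + B (T y)" by (simp only: T.U_add trig_T[OF 1(1)] trig_T[OF 1(2)])
  also have "\<dots> = A (T x) + (B (C x) + B (D y))" by (simp only: Ty trig_additive[OF 1(2)])
  finally have TT: "T (T x) = A (T x) + (B (C x) + B (D y))" .
  \<comment> \<open>Subtracting this from \<open>TT\<close> cancels \<open>B (D y)\<close>; what
    remains besides \<open>A (T x)\<close> is minus the determinant applied to x.\<close>
  have "D (T x) = A (D x) + B (D y)" by (simp add: Tx trig_additive[OF 1(4)] DA DB)
  hence "T (T x) - (A (T x) + D (T x)) + \<kappa> *\<^sub>C x = 0"
    unfolding TT k[symmetric] by simp
  thus ?thesis by (rule that[OF trig_add[OF 1(1,4)] 1(5)])
qed

end

text \<open>\<open>S_nz\<close> lets the recursion be solved for the next site, and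
  \<open>S_mod\<close> makes the determinant -S12/S21 of each step unimodular.\<close>

locale scattering_walk =
  fixes S :: "int \<Rightarrow> complex^2^2"
  assumes S: "unitary2 (S j)"
    and S_nz: "S j $ 2 $ 1 \<noteq> 0"
    and S_mod: "cmod (S j $ 1 $ 2) = cmod (S j $ 2 $ 1)"
begin

definition U :: "l2 \<Rightarrow> l2" where "U x = block 1 S (block 0 S x)"

definition V :: "l2 \<Rightarrow> l2" where
  "V x = block 0 (\<lambda>j. adjoint2 (S j)) (block 1 (\<lambda>j. adjoint2 (S j)) x)"

lemma U_unitary_pair: "unitary_pair U V"
  unfolding U_def[abs_def] V_def[abs_def]
  by (rule unitary_pair_comp[OF block_unitary_pair[of S, OF S] block_unitary_pair[of S, OF S]])

sublocale unitary_pair U V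
  by (rule U_unitary_pair)

text \<open>The companion of \<open>ket j\<close> in the recursion. For even j the operator U sends
  \<open>ket j\<close> into the span of \<open>eta j\<close> and \<open>eta (j + 1)\<close>; for odd
  j the block of \<open>U_odd\<close> gives \<open>eta j\<close> in terms of \<open>ket j\<close>
  and \<open>ket (j + 1)\<close>. Each step thus involves only neighbouring sites.\<close>

definition eta :: "int \<Rightarrow> l2" where "eta j = block 1 S (ket j)"

lemma block_add: "block q S (x + y) = block q S x + block q S y"
  by (rule unitary_pair.U_add[OF block_unitary_pair[of S, OF S]])

lemma block_scaleC: "block q S (c *\<^sub>C x) = c *\<^sub>C block q S x"
  by (rule unitary_pair.U_scaleC[OF block_unitary_pair[of S, OF S]])

lemma transfer_rel_step: "transfer_rel (ket j) (eta j) (ket (j + 1)) (eta (j + 1))"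
proof -
  define a b c d where abcd: "a = S j $ 1 $ 1" "b = S j $ 1 $ 2" "c = S j $ 2 $ 1" "d = S j $ 2 $ 2"
  have c0: "c \<noteq> 0" and bc: "cmod (- b / c) = 1"
    using S_nz[of j] S_mod[of j] by (simp_all add: abcd norm_divide)
  have solve: "w = (1 / c) *\<^sub>C u + (- a / c) *\<^sub>C v" if "u = a *\<^sub>C v + c *\<^sub>C w" for u v w :: l2
    using c0 by (simp add: that scaleC_add_right scaleC_scaleC minus_scaleC flip: add.assoc scaleC_add_left)
  show ?thesis
  proof (cases "even j")
    case True
    have "U (ket j) = a *\<^sub>C eta j + c *\<^sub>C eta (j + 1)"
      using True by (simp add: U_def block_ket_first[of S, OF S] block_add block_scaleC eta_def abcd)
    from solve[OF this] have e: "eta (j + 1) = (1 / c) *\<^sub>C U (ket j) + (- a / c) *\<^sub>C eta j" .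
    have "U (ket (j + 1)) = b *\<^sub>C eta j + d *\<^sub>C eta (j + 1)"
      using True by (simp add: U_def block_ket_second[of S, OF S] block_add block_scaleC eta_def abcd)
    \<comment> \<open>V brings the second column back to the kets; \<open>V (eta (j + 1))\<close> is
      then eliminated with \<open>e\<close>.\<close>
    hence "V (U (ket (j + 1))) = V (b *\<^sub>C eta j + d *\<^sub>C eta (j + 1))" by simp
    hence "ket (j + 1) = b *\<^sub>C V (eta j) + d *\<^sub>C ((1 / c) *\<^sub>C ket j + (- a / c) *\<^sub>C V (eta j))"
      by (simp add: e V_add V_scaleC)
    also have "\<dots> = (d / c) *\<^sub>C ket j + (b - a * d / c) *\<^sub>C V (eta j)"
      by (simp add: scaleC_add_right scaleC_scaleC scaleC_diff_left minus_scaleC mult.commute)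
    finally have k: "ket (j + 1) = (d / c) *\<^sub>C ket j + (b - a * d / c) *\<^sub>C V (eta j)" .
    show ?thesis
    proof (rule transfer_relI[OF trig_const trig_cmult[OF trig_V] trig_cmult[OF trig_U] trig_const bc _ k e])
      fix z :: complex assume "cmod z = 1"
      hence z: "cnj z * z = 1" by (simp add: mult.commute complex_norm_square[symmetric])
      \<comment> \<open>The powers of U sit off the diagonal, one V against one U, and cancel in the
        determinant.\<close>
      have "d / c * (- a / c) - (b - a * d / c) * cnj z * (1 / c * z)
        = d / c * (- a / c) - (b - a * d / c) * (1 / c) * (cnj z * z)" by simp
      also have "\<dots> = - b / c" unfolding z using c0 by (simp add: field_simps)
      finally show "d / c * (- a / c) - (b - a * d / c) * cnj z * (1 / c * z) = - b / c" .
    qed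
  next
    case False
    have "eta j = a *\<^sub>C ket j + c *\<^sub>C ket (j + 1)"
      using False by (simp add: eta_def block_ket_first[of S, OF S] abcd)
    from solve[OF this] have k: "ket (j + 1) = (- a / c) *\<^sub>C ket j + (1 / c) *\<^sub>C eta j"
      by (simp add: add.commute)
    have "eta (j + 1) = b *\<^sub>C ket j + d *\<^sub>C ket (j + 1)"
      using False by (simp add: eta_def block_ket_second[of S, OF S] abcd)
    also have "\<dots> = (b - a * d / c) *\<^sub>C ket j + (d / c) *\<^sub>C eta j"
      by (simp add: k scaleC_add_right scaleC_scaleC scaleC_diff_left minus_scaleC mult.commute)
    finally have e: "eta (j + 1) = (b - a * d / c) *\<^sub>C ket j + (d / c) *\<^sub>C eta j" .
    have "- a / c * (d / c) - 1 / c * (b - a * d / c) = - b / c" using c0 by (simp add: field_simps)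
    thus ?thesis by (intro transfer_rel_const[OF k e]) (simp add: bc[simplified])
  qed
qed

lemma transfer_rel_steps: "transfer_rel (ket j) (eta j) (ket (j + int n)) (eta (j + int n))"
proof (induction n)
  case 0
  show ?case by (rule transfer_rel_const[of _ 1 _ 0 _ _ 0 1]) simp_all
next
  case (Suc n)
  from transfer_rel_trans[OF this transfer_rel_step[of "j + int n"]] show ?case by (simp add: ac_simps)
qed

end

text \<open>The first pair of conditions says that the even factor takes the shift with phases w to
  the one with phases v, the second pair that the odd factor takes it back. Together they make T
  commute with U.\<close>

locale magnetic_periodic_walk = scattering_walk S for S +
  fixes v w :: "int \<Rightarrow> complex" and L :: nat
  assumes v: "cmod (v j) = 1" and w: "cmod (w j) = 1" and L: "even L" "L > 0"
    and d0: "diag_entry 0 S (j + int L) * w j = v j * diag_entry 0 S j"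
    and o0: "offdiag_entry 0 S (j + int L) * w (partner 0 j) = v j * offdiag_entry 0 S j"
    and d1: "diag_entry 1 S (j + int L) * v j = w j * diag_entry 1 S j"
    and o1: "offdiag_entry 1 S (j + int L) * v (partner 1 j) = w j * offdiag_entry 1 S j"
begin

definition T :: "l2 \<Rightarrow> l2" where "T = magnetic_shift w (int L)"

definition W :: "l2 \<Rightarrow> l2" where "W = magnetic_shift (\<lambda>j. cnj (w (j - int L))) (- int L)"

lemma T_block_1: "T (block 1 S x) = block 1 S (magnetic_shift v (int L) x)"
  unfolding T_def using L by (intro block_magnetic_shift[symmetric] S v w d1 o1) simp

lemma T_block_0: "magnetic_shift v (int L) (block 0 S x) = block 0 S (T x)"
  unfolding T_def using L by (intro block_magnetic_shift[symmetric] S v w d0 o0) simp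

sublocale commuting_unitaries U V T W
proof (rule commuting_unitaries.intro[OF U_unitary_pair])
  show "unitary_pair T W"
    unfolding T_def W_def by (rule magnetic_shift_unitary_pair[OF w])
  show "commuting_unitaries_axioms U T"
    by standard (simp add: U_def T_block_1 T_block_0)
qed

lemma T_ket: "T (ket j) = w j *\<^sub>C ket (j + int L)"
  unfolding T_def by (rule magnetic_shift_ket[OF w])

lemma T_eta: "T (eta j) = v j *\<^sub>C eta (j + int L)"
  unfolding eta_def T_block_1 by (simp add: magnetic_shift_ket[OF v] block_scaleC)

lemma T_moments: "cinner (ket j) ((T ^^ n) (ket j)) = (if n = 0 then 1 else 0)"
proof -
  have "\<exists>c. (T ^^ n) (ket j) = c *\<^sub>C ket (j + int (n * L))"
  proof (induction n)
    case 0
    show ?case by (intro exI[of _ 1]) simp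
  next
    case (Suc n)
    then obtain c where "(T ^^ n) (ket j) = c *\<^sub>C ket (j + int (n * L))" by blast
    hence "(T ^^ Suc n) (ket j) = (c * w (j + int (n * L))) *\<^sub>C ket (j + int (n * L) + int L)"
      by (simp add: T.U_scaleC T_ket scaleC_scaleC)
    thus ?case by (auto simp: algebra_simps)
  qed
  then obtain c where c: "(T ^^ n) (ket j) = c *\<^sub>C ket (j + int (n * L))" by blast
  show ?thesis
  proof (cases "n = 0")
    case True
    thus ?thesis by (simp add: cinner_ket ket.rep_eq)
  next
    case False
    thus ?thesis using L by (simp add: c cinner_ket scaleC_l2.rep_eq ket.rep_eq)
  qed
qed

lemma spectral_proj_ket_null:
  assumes "B \<in> sets borel" and "negligible {x. cis x \<in> B}"
  shows "spectral_proj B (ket j) = 0"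
proof -
  \<comment> \<open>L steps of the recursion lead to the sites shifted by L. The diagonal matrix of
    the phases \<open>w j\<close> and \<open>v j\<close>, of modulus-one determinant, completes them
    to the images under T.\<close>
  have "transfer_rel (ket (j + int L)) (eta (j + int L)) (T (ket j)) (T (eta j))"
    by (rule transfer_rel_const[of _ "w j" _ 0 _ _ 0 "v j"]) (simp_all add: T_ket T_eta norm_mult v w)
  from transfer_rel_trans[OF transfer_rel_steps this]
  have "transfer_rel (ket j) (eta j) (T (ket j)) (T (eta j))" .
  then obtain D D_op \<delta> where "trig D D_op" "cmod \<delta> = 1"
      "T (T (ket j)) - D_op (T (ket j)) + \<delta> *\<^sub>C ket j = 0"
    by (rule transfer_rel_quadratic)
  then interpret quadratic_relation U V T W D D_op \<delta> "ket j"
    by unfold_locales (simp_all add: T_moments)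
  show ?thesis by (rule spectral_proj_null[OF assms])
qed

end

section \<open>The given scattering matrices\<close>

lemma scattering_matrix_unitary2:
  assumes "r\<^sup>2 + t\<^sup>2 = 1"
  shows "unitary2 (scattering_matrix r t \<theta> \<alpha> \<gamma>)"
proof -
  have rt: "complex_of_real r * of_real r + of_real t * of_real t = 1"
    using assms by (simp add: power2_eq_square flip: of_real_mult of_real_add)
  have c: "cis x * cis y = cis (x + y)" "cis x * (cis y * z) = cis (x + y) * z" for x y z
    by (simp_all add: cis_mult mult.assoc[symmetric])
  show ?thesis
    unfolding unitary2_def
    using rt
    by (auto simp: vec_eq_iff forall_2 matrix_matrix_mult_def sum_2 adjoint2_def mat_def
       scattering_matrix_def cis_cnj c mult_ac algebra_simps)
qed

theorem theorem6p1:
  fixes t r a :: real and \<theta> \<alpha> \<gamma> p :: "int \<Rightarrow> real" and N :: nat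
  assumes "0 < t" and "t < 1" and "r = sqrt (1 - t\<^sup>2)"
    and "N \<ge> 2"
    and "\<forall>k. \<theta> (k + int N) = \<theta> k"
    and "\<forall>k. \<alpha> k = a * of_int k + p k"
    and "\<forall>k. p (k + int N) = p k"
  shows "unitary_op (M_op r t \<theta> \<alpha> \<gamma>) \<and> purely_absolutely_continuous (M_op r t \<theta> \<alpha> \<gamma>)"
proof -
  define S where "S k = scattering_matrix r t (\<theta> k) (\<alpha> k) (\<gamma> k)" for k
  have "t\<^sup>2 \<le> 1" using assms(1,2) by (simp add: abs_square_le_1)
  hence rt: "r\<^sup>2 + t\<^sup>2 = 1" using assms(3) by simp
  have S11: "S k $ 1 $ 1 = cis (- \<theta> k) * (of_real r * cis (- \<alpha> k))"
    and S12: "S k $ 1 $ 2 = cis (- \<theta> k) * (\<i> * of_real t * cis (\<gamma> k))"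
    and S21: "S k $ 2 $ 1 = cis (- \<theta> k) * (\<i> * of_real t * cis (- \<gamma> k))"
    and S22: "S k $ 2 $ 2 = cis (- \<theta> k) * (of_real r * cis (\<alpha> k))" for k
    by (simp_all add: S_def scattering_matrix_def)
  interpret scattering_walk S
    using scattering_matrix_unitary2[OF rt] assms(1)
    by unfold_locales (simp_all add: S_def[symmetric] S12 S21 norm_mult, simp add: S_def)
  \<comment> \<open>Twice the period, so that the shift is even also for odd N.\<close>
  define L where "L = 2 * N"
  have \<theta>L: "\<theta> (k + int L) = \<theta> k" for k
    using assms(5) by (metis L_def add.assoc mult_2 of_nat_add)
  have pL: "p (k + int L) = p k" for k
    using assms(7) by (metis L_def add.assoc mult_2 of_nat_add)
  have \<alpha>L: "\<alpha> (k + int L) = \<alpha> k + a * real L" for k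
    using assms(6) pL by (simp add: algebra_simps)
  \<comment> \<open>A discrete primitive: by telescoping, its increments are the discrepancies
    \<open>\<gamma> (k + int L) - \<gamma> k\<close> that the phases of the shift must
    absorb.\<close>
  define G where "G k = (\<Sum>l<L. \<gamma> (k + int l))" for k
  have GS: "G (k + 1) - G k = \<gamma> (k + int L) - \<gamma> k" for k
  proof -
    have "G k + \<gamma> (k + int L) = (\<Sum>l<Suc L. \<gamma> (k + int l))" by (simp add: G_def)
    also have "\<dots> = \<gamma> k + G (k + 1)"
      unfolding sum.lessThan_Suc_shift G_def by (simp add: add.assoc)
    finally show ?thesis by simp
  qed
  \<comment> \<open>\<open>x 0\<close> and \<open>x 1\<close> are the phases of the shifts \<open>T\<close>, \<open>T'\<close> with \<open>T' U\<^sub>e = U\<^sub>e T\<close> and \<open>T U\<^sub>o = U\<^sub>o T'\<close>.\<close>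
  define x where "x q k = cis (- G k) * (if even (k - q) then 1 else cis (- a * real L))" for q k :: int
  have par: "even (j + int L - q) = even (j - q)" "even (j - (q + 1)) = (\<not> even (j - q))" for q j :: int
    by (simp_all add: L_def)
  \<comment> \<open>The shift multiplies the diagonal entry by \<open>cis (- a * real L)\<close> or
    its inverse according to parity, which is the quotient of \<open>x (q + 1) j\<close> by
    \<open>x q j\<close>.\<close>
  have xd: "diag_entry q S (j + int L) * x q j = x (q + 1) j * diag_entry q S j" for q j
  proof (cases "even (j - q)")
    case True
    have "cis (- \<alpha> (j + int L)) = cis (- \<alpha> j) * cis (- a * real L)" by (simp add: cis_mult \<alpha>L)
    thus ?thesis using True unfolding diag_entry_def x_def par S11 \<theta>L by simp
  next
    case False
    have "\<alpha> (j + int L - 1) = \<alpha> (j - 1) + a * real L" "\<theta> (j + int L - 1) = \<theta> (j - 1)"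
      using \<alpha>L[of "j - 1"] \<theta>L[of "j - 1"] by (simp_all add: algebra_simps)
    moreover have "cis (\<alpha> (j - 1) + a * real L) * cis (- a * real L) = cis (\<alpha> (j - 1))" by (simp add: cis_mult)
    ultimately show ?thesis using False unfolding diag_entry_def x_def par S22 by simp
  qed
  \<comment> \<open>The alternating factors agree on both sides, since j and its partner have
    opposite parity; only \<gamma> against the increment of G remains.\<close>
  have xo: "offdiag_entry q S (j + int L) * x q (partner q j) = x (q + 1) j * offdiag_entry q S j" for q j
  proof (cases "even (j - q)")
    case True
    have "cis (\<gamma> (j + int L)) * cis (- G (j + 1)) = cis (- G j) * cis (\<gamma> j)"
      unfolding cis_mult using GS[of j] by (intro arg_cong[of _ _ cis]) linarith
    thus ?thesis using True unfolding offdiag_entry_def x_def par partner_def S12 \<theta>L by simp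
  next
    case False
    have "\<theta> (j + int L - 1) = \<theta> (j - 1)" using \<theta>L[of "j - 1"] by (simp add: algebra_simps)
    moreover have "cis (- \<gamma> (j + int L - 1)) * cis (- G (j - 1)) = cis (- G j) * cis (- \<gamma> (j - 1))"
    proof -
      have e: "j - 1 + int L = j + int L - 1" by simp
      show ?thesis
        unfolding cis_mult using GS[of "j - 1", unfolded e] by (intro arg_cong[of _ _ cis]) simp
    qed
    ultimately show ?thesis using False unfolding offdiag_entry_def x_def par partner_def S21 by simp
  qed
  interpret magnetic_periodic_walk S "x 1" "x 0" L
  proof
    \<comment> \<open>The phases depend on q only through its parity, so after both factors they
      have returned to their initial values.\<close>
    have x2: "x 2 j = x 0 j" for j by (simp add: x_def)
    fix j
    show "cmod (x 1 j) = 1" "cmod (x 0 j) = 1" by (simp_all add: x_def norm_mult)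
    show "even L" "L > 0" using assms(4) by (simp_all add: L_def)
    show "diag_entry 0 S (j + int L) * x 0 j = x 1 j * diag_entry 0 S j"
      "offdiag_entry 0 S (j + int L) * x 0 (partner 0 j) = x 1 j * offdiag_entry 0 S j"
      using xd[of 0 j] xo[of 0 j] by simp_all
    show "diag_entry 1 S (j + int L) * x 1 j = x 0 j * diag_entry 1 S j"
      "offdiag_entry 1 S (j + int L) * x 1 (partner 1 j) = x 0 j * offdiag_entry 1 S j"
      using xd[of 1 j] xo[of 1 j] by (simp_all add: x2)
  qed
  interpret l2_unitary U V "M_op r t \<theta> \<alpha> \<gamma>"
    by unfold_locales
       (simp add: seq_operator_def M_op_def U_even_def U_odd_def U_def coord_block[of S, OF S] S_def[symmetric])
  show ?thesis using unitary_op_F purely_absolutely_continuousI[OF spectral_proj_ket_null] by blast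
qed

end
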